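(* Let $-A$ be the generator of a bounded $C_0$-semigroup $(T(s))_{s\ge0}$ on a Banach space $X$, and suppose $A$ is injective. (a) For each $x\in\operatorname{dom}(\log A)$, $\|\mathcal C_t(A)x\|=O\big(1/\log t\big)$ as $t\to\infty$. (b) If $\operatorname{ran}(A)$ is dense in $X$, then for each $x\in\operatorname{dom}(\log A)$, $\|\mathcal C_t(A)x\|=o\big(1/\log t\big)$ as $t\to\infty$. (c) If $0$ is an accumulation point of $\sigma(A)$, then for any decreasing function $\epsilon:(0,\infty)\to(0,\infty)$ with $\lim_{t\to\infty}\epsilon(t)=0$ there exists $y\in\operatorname{dom}(\log A)$ such that $\sup_{t\ge1}\frac{\log t\,\|\mathcal C_t(A)y\|}{\epsilon(t)}=\infty$.
   Context: $\log z$ denotes the principal branch. For injective $A$, the operator $\log A$ is defined in the extended Hille–Phillips calculus with regularizer $e(z)=z(1+z)^{-2}$: for Laplace transforms $\hat\nu(z)=\int_{[0,\infty)}e^{-sz}\nu(\mathrm ds)$ of bounded complex measures, $\hat\nu(A)x=\int T(s)x\,\nu(\mathrm ds)$; both $e$ and $e\log$ are such Laplace transforms, $e(A)=A(1+A)^{-2}$ is injective, and $\log A:=e(A)^{-1}(e\log)(A)$ with domain $\{x:(e\log)(A)x\in\operatorname{ran}e(A)\}$ (this agrees with the logarithm from the sectorial functional calculus). Cesàro means: $\mathcal C_t(A)x=\frac1t\int_0^tT(s)x\,\mathrm ds$. *)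

theory Defs
  imports "HOL-Analysis.Analysis" "HOL-Library.Landau_Symbols"
begin

text \<open>A complex Banach space is modelled as a real Banach space of type 'a
  together with a complex scalar multiplication cs compatible with the real one.\<close>
definition complex_scaling :: "(complex \<Rightarrow> 'a::banach \<Rightarrow> 'a) \<Rightarrow> bool" where
  "complex_scaling cs \<longleftrightarrow>
     (\<forall>c x y. cs c (x + y) = cs c x + cs c y) \<and>
     (\<forall>c d x. cs (c + d) x = cs c x + cs d x) \<and>
     (\<forall>c d x. cs (c * d) x = cs c (cs d x)) \<and>
     (\<forall>x. cs 1 x = x) \<and>
     (\<forall>r x. cs (complex_of_real r) x = r *\<^sub>R x) \<and>
     (\<forall>c x. norm (cs c x) = cmod c * norm x)"

definition bounded_C0_semigroup ::
  "(complex \<Rightarrow> 'a::banach \<Rightarrow> 'a) \<Rightarrow> (real \<Rightarrow> 'a \<Rightarrow> 'a) \<Rightarrow> bool" where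
  "bounded_C0_semigroup cs T \<longleftrightarrow>
     (\<forall>s\<ge>0. bounded_linear (T s) \<and> (\<forall>c x. T s (cs c x) = cs c (T s x))) \<and>
     (\<forall>x. T 0 x = x) \<and>
     (\<forall>s t x. 0 \<le> s \<longrightarrow> 0 \<le> t \<longrightarrow> T (s + t) x = T s (T t x)) \<and>
     (\<forall>x. continuous_on {0..} (\<lambda>s. T s x)) \<and>
     (\<exists>M. \<forall>s\<ge>0. \<forall>x. norm (T s x) \<le> M * norm x)"

definition neg_generator ::
  "(real \<Rightarrow> 'a::banach \<Rightarrow> 'a) \<Rightarrow> 'a set \<Rightarrow> ('a \<Rightarrow> 'a) \<Rightarrow> bool" where
  "neg_generator T D A \<longleftrightarrow>
     D = {x. \<exists>y. ((\<lambda>h. (1 / h) *\<^sub>R (T h x - x)) \<longlongrightarrow> y) (at_right 0)} \<and>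
     (\<forall>x\<in>D. ((\<lambda>h. (1 / h) *\<^sub>R (T h x - x)) \<longlongrightarrow> - A x) (at_right 0))"

definition op_spectrum ::
  "(complex \<Rightarrow> 'a::banach \<Rightarrow> 'a) \<Rightarrow> 'a set \<Rightarrow> ('a \<Rightarrow> 'a) \<Rightarrow> complex set" where
  "op_spectrum cs D A = {l. \<not> (\<exists>R. bounded_linear R \<and> (\<forall>c x. R (cs c x) = cs c (R x)) \<and>
       (\<forall>x. R x \<in> D) \<and> (\<forall>x. cs l (R x) - A (R x) = x) \<and>
       (\<forall>x\<in>D. R (cs l x - A x) = x))}"

text \<open>A bounded complex measure on [0,\<infinity>) is represented as h d\<mu> with \<mu> a finite
  Borel measure on the reals concentrated on [0,\<infinity>) and h \<in> L^1(\<mu>).\<close>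
definition bdd_cmeasure :: "real measure \<Rightarrow> (real \<Rightarrow> complex) \<Rightarrow> bool" where
  "bdd_cmeasure \<mu> h \<longleftrightarrow> sets \<mu> = sets borel \<and> finite_measure \<mu> \<and>
     emeasure \<mu> {..<0} = 0 \<and> integrable \<mu> h"

definition laplace_cm :: "real measure \<Rightarrow> (real \<Rightarrow> complex) \<Rightarrow> complex \<Rightarrow> complex" where
  "laplace_cm \<mu> h z = (\<integral>s. exp (- (complex_of_real s * z)) * h s \<partial>\<mu>)"

text \<open>Hille-Phillips calculus: y = \<nu>^(A) x = \<integral> T(s) x \<nu>(ds), the vector integral
  taken in the weak (Pettis) sense, which coincides with the Bochner integral here
  (s \<mapsto> T s x is continuous) and avoids a separability assumption on X.
  y is unique by Hahn-Banach.\<close>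
definition HP_value ::
  "(complex \<Rightarrow> 'a::banach \<Rightarrow> 'a) \<Rightarrow> (real \<Rightarrow> 'a \<Rightarrow> 'a) \<Rightarrow> real measure \<Rightarrow> (real \<Rightarrow> complex) \<Rightarrow> 'a \<Rightarrow> 'a \<Rightarrow> bool" where
  "HP_value cs T \<mu> h x y \<longleftrightarrow>
     (\<forall>\<phi>::'a \<Rightarrow> real. bounded_linear \<phi> \<longrightarrow>
        integrable \<mu> (\<lambda>s. \<phi> (cs (h s) (T s x))) \<and>
        \<phi> y = (\<integral>s. \<phi> (cs (h s) (T s x)) \<partial>\<mu>))"

definition reg_e :: "complex \<Rightarrow> complex" where
  "reg_e z = z / (1 + z)^2"

text \<open>e(A) = A(1+A)^-2, given by the Hille-Phillips calculus: e is the Laplace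
  transform of the measure (1 - s) e^-s ds on [0,\<infinity>).\<close>
definition eA :: "(real \<Rightarrow> 'a::banach \<Rightarrow> 'a) \<Rightarrow> 'a \<Rightarrow> 'a" where
  "eA T x = integral {0..} (\<lambda>s. ((1 - s) * exp (- s)) *\<^sub>R T s x)"

text \<open>Domain of log A = e(A)^-1 (e log)(A): those x with (e log)(A) x \<in> ran e(A),
  where (e log)(A) is \<nu>^(A) for the (unique) bounded measure \<nu> with \<nu>^ = e log.\<close>
definition log_dom ::
  "(complex \<Rightarrow> 'a::banach \<Rightarrow> 'a) \<Rightarrow> (real \<Rightarrow> 'a \<Rightarrow> 'a) \<Rightarrow> 'a set" where
  "log_dom cs T = {x. \<exists>\<mu> h. bdd_cmeasure \<mu> h \<and>
      (\<forall>z. 0 < Re z \<longrightarrow> laplace_cm \<mu> h z = reg_e z * Ln z) \<and>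
      (\<exists>y. HP_value cs T \<mu> h x y \<and> y \<in> range (eA T))}"

definition cesaro :: "(real \<Rightarrow> 'a::banach \<Rightarrow> 'a) \<Rightarrow> real \<Rightarrow> 'a \<Rightarrow> 'a" where
  "cesaro T t x = (1 / t) *\<^sub>R integral {0..t} (\<lambda>s. T s x)"

end

theory Submission
  imports Defs
begin

text \<open>
  Let \<open>G(s) = \<integral>\<^sub>0\<^sup>1 s\<^sup>-\<^sup>\<alpha> / \<Gamma>(1 - \<alpha>) d\<alpha>\<close>, a positive decreasing function with Laplace transform
  \<open>(z - 1) / (z log z)\<close>. The difference \<open>P\<^sub>t(s) = (G(s) - G(s - t)) / t\<close> is integrable with
  \<open>\<parallel>P\<^sub>t\<parallel>\<^sub>1 \<le> (2/t) \<integral>\<^sub>0\<^sup>t G = O(1 / log t)\<close>, because \<open>G\<close> is decreasing, and its transform satisfies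
  \<open>P\<^sub>t(z) log z = (1 - e\<^sup>-\<^sup>t\<^sup>z) / t - c\<^sub>t(z)\<close>, where \<open>c\<^sub>t\<close> belongs to the Cesaro mean. Hence
  \<open>C\<^sub>t x = (x - T(t) x) / t - P\<^sub>t(A) log(A) x\<close> for \<open>x\<close> in the domain of the logarithm, which is (a).
  On vectors \<open>v - T(h) v\<close>, which are dense if \<open>ran A\<close> is, \<open>P\<^sub>t(A)\<close> is even \<open>O(1/t)\<close>, whence (b).
  The same identity shows \<open>ran P\<^sub>1(A) \<subseteq> dom (log A)\<close>. If (c) failed, uniform boundedness would give
  \<open>\<parallel>C\<^sub>t P\<^sub>1(A)\<parallel> = O(\<epsilon>(t) / log t)\<close>, while the spectral inclusion bounds this norm from below by
  \<open>\<bar>c\<^sub>t(\<lambda>) P\<^sub>1(\<lambda>)\<bar>\<close>, of order \<open>1 / log t\<close> for \<open>\<lambda> \<in> \<sigma>(A)\<close> and \<open>t = 1 / (4 \<bar>\<lambda>\<bar>)\<close>.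

  All vector-valued integrals are handled weakly, by means of the Hahn-Banach theorem, so that
  identities between operators reduce to identities between scalar Laplace transforms.
\<close>

section \<open>Functional-analytic prerequisites\<close>

text \<open>The obvious candidate \<open>1 / log z\<close> for inverting the logarithm has a pole at
  \<open>z = 1\<close>, so it is not the transform of a bounded measure. The factor
  \<open>(z - 1) / z\<close> removes the pole and turns the quotient into an average of the
  elementary transforms \<open>z^(a - 1)\<close>; the price is the term
  \<open>(1 - e^(-tz)) / t\<close>, which costs only \<open>O(1/t)\<close>. \<open>G\<close> itself
  is not integrable, its transform being unbounded near \<open>0\<close>; hence the difference
  \<open>P_t\<close>.

  The identity for \<open>P_t\<close> and the logarithm is one between bounded operators only after
  multiplication by \<open>e\<close>; \<open>e(A)\<close> is cancelled afterwards, and there the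
  injectivity of \<open>A\<close> enters. Transforms are compared at \<open>1, 2, 3, ...\<close>
  only: in the variable \<open>exp (- s)\<close> these values are moments on \<open>[0, 1]\<close>,
  and Weierstrass approximation does the rest.

  The spectral inclusion uses no Banach algebras: after truncation of \<open>k\<close>, the
  numerator \<open>k^(l) - k^(z)\<close> is divisible by \<open>z - l\<close> within the calculus,
  so if \<open>|k^(l)|\<close> exceeded the norm of \<open>k(A)\<close>, a Neumann series would make
  \<open>l - A\<close> invertible.\<close>

definition sublinear :: "('a::real_vector \<Rightarrow> real) \<Rightarrow> bool" where
  "sublinear q \<longleftrightarrow> (\<forall>x y. q (x + y) \<le> q x + q y) \<and> (\<forall>t x. 0 \<le> t \<longrightarrow> q (t *\<^sub>R x) = t * q x)"

text \<open>This lowers \<open>q\<close> as far as sublinearity allows along \<open>a\<close>: the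
  result lies below \<open>q\<close>, and \<open>t = 1\<close> shows that its value at
  \<open>- a\<close> is at most \<open>- q a\<close>. A functional that cannot be lowered in this
  way is odd.\<close>

definition slide :: "('a::real_vector \<Rightarrow> real) \<Rightarrow> 'a \<Rightarrow> 'a \<Rightarrow> real" where
  "slide q a x = (INF t\<in>{0..}. q (x + t *\<^sub>R a) - t * q a)"

lemma sublinear_zero: "sublinear q \<Longrightarrow> q 0 = 0"
  unfolding sublinear_def by (metis mult_zero_left order_refl scaleR_zero_left)

lemma sublinear_ge: "sublinear q \<Longrightarrow> - q (- x) \<le> q x"
  using sublinear_zero[of q] unfolding sublinear_def
  by (smt (verit) add.right_inverse)

lemma slide_bdd_below:
  assumes "sublinear q"
  shows "bdd_below ((\<lambda>t. q (x + t *\<^sub>R a) - t * q a) ` {0..})"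
proof (rule bdd_belowI2)
  fix t :: real assume "t \<in> {0..}"
  then have "t * q a = q ((x + t *\<^sub>R a) + (- x))"
    using assms by (simp add: sublinear_def)
  also have "\<dots> \<le> q (x + t *\<^sub>R a) + q (- x)"
    using assms by (simp only: sublinear_def)
  finally show "- q (- x) \<le> q (x + t *\<^sub>R a) - t * q a" by simp
qed

lemma slide_le:
  assumes "sublinear q" "0 \<le> t"
  shows "slide q a x \<le> q (x + t *\<^sub>R a) - t * q a"
  unfolding slide_def by (rule cINF_lower[OF slide_bdd_below]) (use assms in auto)

lemma slide_sublinear:
  assumes q: "sublinear q"
  shows "sublinear (slide q a)"
  unfolding sublinear_def
proof (intro conjI allI impI)
  fix x y
  have *: "slide q a (x + y) \<le> (q (x + t *\<^sub>R a) - t * q a) + (q (y + s *\<^sub>R a) - s * q a)"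
    if "0 \<le> t" "0 \<le> s" for t s
  proof -
    have "slide q a (x + y) \<le> q ((x + y) + (t + s) *\<^sub>R a) - (t + s) * q a"
      by (rule slide_le) (use q that in auto)
    also have "q ((x + y) + (t + s) *\<^sub>R a) \<le> q (x + t *\<^sub>R a) + q (y + s *\<^sub>R a)"
    proof -
      have "(x + y) + (t + s) *\<^sub>R a = (x + t *\<^sub>R a) + (y + s *\<^sub>R a)"
        by (simp add: algebra_simps)
      then show ?thesis using q by (simp only: sublinear_def)
    qed
    finally show ?thesis by (simp add: algebra_simps)
  qed
  have "slide q a (x + y) - (q (y + s *\<^sub>R a) - s * q a) \<le> slide q a x" if "0 \<le> s" for s
    unfolding slide_def[of q a x] by (rule cINF_greatest) (use *[OF _ that] in \<open>auto simp: algebra_simps\<close>)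
  then have "slide q a (x + y) - slide q a x \<le> slide q a y"
    unfolding slide_def[of q a y] by (intro cINF_greatest) (auto simp: algebra_simps)
  then show "slide q a (x + y) \<le> slide q a x + slide q a y" by simp
next
  \<comment> \<open>One inequality for all positive factors suffices: applied with the factor
    \<open>inverse t\<close> it yields the reverse one.\<close>
  have le: "slide q a (t *\<^sub>R x) \<le> t * slide q a x" if t: "0 < t" for t x
  proof -
    have "inverse t * slide q a (t *\<^sub>R x) \<le> slide q a x"
      unfolding slide_def[of q a x]
    proof (rule cINF_greatest)
      fix s :: real assume "s \<in> {0..}"
      then have s: "0 \<le> s" by simp
      have "slide q a (t *\<^sub>R x) \<le> q (t *\<^sub>R x + (t * s) *\<^sub>R a) - (t * s) * q a"
        by (rule slide_le) (use q t s in auto)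
      also have "t *\<^sub>R x + (t * s) *\<^sub>R a = t *\<^sub>R (x + s *\<^sub>R a)"
        by (simp add: algebra_simps)
      also have "q \<dots> = t * q (x + s *\<^sub>R a)"
        using q t by (simp add: sublinear_def)
      finally show "inverse t * slide q a (t *\<^sub>R x) \<le> q (x + s *\<^sub>R a) - s * q a"
        using t by (simp add: field_simps)
    qed auto
    then show ?thesis using t by (simp add: field_simps)
  qed
  fix t :: real and x assume t: "0 \<le> t"
  show "slide q a (t *\<^sub>R x) = t * slide q a x"
  proof (cases "t = 0")
    case True
    have "slide q a 0 = (INF s\<in>{0::real..}. 0)"
      unfolding slide_def using q by (intro INF_cong) (auto simp: sublinear_def)
    then show ?thesis using True by simp
  next
    case False
    then have "0 < t" using t by simp
    have "slide q a (inverse t *\<^sub>R (t *\<^sub>R x)) \<le> inverse t * slide q a (t *\<^sub>R x)"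
      using \<open>0 < t\<close> by (intro le) simp
    then show ?thesis using le[OF \<open>0 < t\<close>, of x] \<open>0 < t\<close> by (simp add: field_simps)
  qed
qed

text \<open>A minimal sublinear functional \<open>q\<close> coincides with every \<open>slide q a\<close>, hence is odd and
  therefore linear.\<close>
lemma sublinear_above_linear:
  fixes p :: "'a::real_vector \<Rightarrow> real"
  assumes p: "sublinear p"
  obtains q where "linear q" "\<And>x. q x \<le> p x"
proof -
  let ?S = "{q. sublinear q \<and> (\<forall>x. q x \<le> p x)}"
  let ?P = "\<lambda>q r :: 'a \<Rightarrow> real. \<forall>x. r x \<le> q x"
  \<comment> \<open>The order is reversed: \<open>?P q r\<close> puts \<open>r\<close> below
    \<open>q\<close>, so the maximal element from Zorn's lemma is a minimal sublinear
    functional.\<close>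
  have po: "partial_order_on ?S (relation_of ?P ?S)"
    by (rule partial_order_on_relation_ofI) (auto intro: order.trans simp: fun_eq_iff order.antisym)
  have "\<exists>m\<in>?S. \<forall>r\<in>?S. ?P m r \<longrightarrow> r = m"
  proof (rule predicate_Zorn[OF po])
    fix C assume C: "C \<in> Chains (relation_of ?P ?S)"
    have CS: "q \<in> ?S" if "q \<in> C" for q
      using C that unfolding Chains_def relation_of_def by blast
    have tot: "?P q r \<or> ?P r q" if "q \<in> C" "r \<in> C" for q r
      using C that unfolding Chains_def relation_of_def by blast
    show "\<exists>u\<in>?S. \<forall>a\<in>C. ?P a u"
    proof (cases "C = {}")
      case True
      then show ?thesis using p by auto
    next
      case False
      define u where "u x = (INF q\<in>C. q x)" for x
      have bdd: "bdd_below ((\<lambda>q. q x) ` C)" for x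
      proof (rule bdd_belowI2)
        fix q assume "q \<in> C"
        then have "sublinear q" "q (- x) \<le> p (- x)" using CS by auto
        then show "- p (- x) \<le> q x" using sublinear_ge[of q x] by linarith
      qed
      have le: "u x \<le> q x" if "q \<in> C" for q x
        unfolding u_def by (rule cINF_lower[OF bdd that])
      have scale: "u (t *\<^sub>R x) = t * u x" if t: "0 < t" for t x
      proof -
        have "t * u y \<le> u (t *\<^sub>R y)" if t: "0 < t" for t y
          unfolding u_def[of "t *\<^sub>R y"]
        proof (rule cINF_greatest[OF False])
          fix q assume "q \<in> C"
          then show "t * u y \<le> q (t *\<^sub>R y)"
            using CS[of q] le[of q y] t by (auto simp: sublinear_def)
        qed
        from this[OF t, of x] this[of "inverse t" "t *\<^sub>R x"] t show ?thesis
          by (simp add: field_simps)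
      qed
      have "sublinear u"
        unfolding sublinear_def
      proof (intro conjI allI impI)
        fix x y
        \<comment> \<open>The two infima may be approached by different members of the chain;
          totality allows both to be replaced by the smaller one, which is subadditive.\<close>
        have *: "u (x + y) \<le> q x + r y" if "q \<in> C" "r \<in> C" for q r
        proof (rule disjE[OF tot[OF that]])
          assume "?P q r"
          then show ?thesis
            using le[OF \<open>r \<in> C\<close>, of "x + y"] CS[OF \<open>r \<in> C\<close>]
            by (auto simp: sublinear_def) (smt (verit))
        next
          assume "?P r q"
          then show ?thesis
            using le[OF \<open>q \<in> C\<close>, of "x + y"] CS[OF \<open>q \<in> C\<close>]
            by (auto simp: sublinear_def) (smt (verit))
        qed
        have "u (x + y) - r y \<le> u x" if "r \<in> C" for r
          unfolding u_def[of x]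
          by (rule cINF_greatest[OF False]) (use *[OF _ that] in \<open>auto simp: algebra_simps\<close>)
        then have "u (x + y) - u x \<le> u y"
          unfolding u_def[of y] by (intro cINF_greatest[OF False]) (auto simp: algebra_simps)
        then show "u (x + y) \<le> u x + u y" by simp
      next
        fix t :: real and x assume "0 \<le> t"
        moreover have "u 0 = 0"
        proof -
          have "u 0 = (INF q\<in>C. 0)"
            unfolding u_def using CS sublinear_zero by (intro INF_cong) auto
          then show ?thesis using False by simp
        qed
        ultimately show "u (t *\<^sub>R x) = t * u x"
          using scale[of t x] by (cases "t = 0") auto
      qed
      moreover have "u x \<le> p x" for x
      proof -
        obtain q where "q \<in> C" using False by blast
        then show ?thesis using le[of q x] CS[of q] by (auto intro: order.trans)
      qed
      ultimately show ?thesis using le by blast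
    qed
  qed
  then obtain q where q: "sublinear q" "\<And>x. q x \<le> p x"
    and minimal: "\<forall>r\<in>?S. ?P q r \<longrightarrow> r = q"
    by blast
  have odd: "q (- a) = - q a" for a
  proof -
    have "slide q a = q"
    proof (rule minimal[rule_format])
      have "slide q a x \<le> q x" for x using slide_le[OF q(1), of 0 a x] by simp
      then show "slide q a \<in> ?S" "\<And>x. slide q a x \<le> q x"
        using slide_sublinear[OF q(1)] q(2) by (auto intro: order.trans)
    qed
    then have "q (- a) \<le> q (- a + 1 *\<^sub>R a) - 1 * q a"
      using slide_le[OF q(1), of 1 a "- a"] by simp
    then have "q (- a) \<le> - q a" using sublinear_zero[OF q(1)] by simp
    then show ?thesis using sublinear_ge[OF q(1), of a] by linarith
  qed
  have "linear q"
  proof (rule linearI)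
    fix x y
    have "q (x + y) \<le> q x + q y" "q (- x + - y) \<le> q (- x) + q (- y)"
      using q(1) by (simp_all only: sublinear_def)
    then show "q (x + y) = q x + q y"
      using odd[of "x + y"] by (simp add: odd)
  next
    fix t x
    show "q (t *\<^sub>R x) = t *\<^sub>R q x"
    proof (cases "0 \<le> t")
      case True then show ?thesis using q(1) by (simp add: sublinear_def)
    next
      case False
      have "q (s *\<^sub>R x) = s * q x" if "0 \<le> s" for s
        using q(1) that by (simp add: sublinear_def)
      from this[of "- t"] False show ?thesis using odd[of "t *\<^sub>R x"] by simp
    qed
  qed
  then show ?thesis using that q(2) by blast
qed

text \<open>Starting from \<open>slide norm x\<close> instead of \<open>norm\<close> forces
  \<open>q (- x) <= - norm x\<close>. The norm is thus attained at \<open>x\<close>, and no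
  functional has to be extended from a line.\<close>

lemma norming_functional:
  fixes x :: "'a::real_normed_vector"
  obtains \<phi> where "linear \<phi>" "\<And>y. \<bar>\<phi> y\<bar> \<le> norm y" "\<phi> x = norm x"
proof -
  have n: "sublinear (norm :: 'a \<Rightarrow> real)"
    by (auto simp: sublinear_def norm_triangle_ineq)
  obtain q where q: "linear q" "\<And>y. q y \<le> slide norm x y"
    using sublinear_above_linear[OF slide_sublinear[OF n]] by blast
  have le: "q y \<le> norm y" for y
    using q(2)[of y] slide_le[OF n, of 0 x y] by simp
  have neg: "q (- y) = - q y" for y by (rule linear_neg[OF q(1)])
  have "q (- x) \<le> - norm x"
    using q(2)[of "- x"] slide_le[OF n, of 1 x "- x"] by simp
  then have "q x = norm x" using neg[of x] le[of x] by linarith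
  moreover have "\<bar>q y\<bar> \<le> norm y" for y
    using le[of y] le[of "- y"] neg[of y] by auto
  ultimately show ?thesis using that q(1) by blast
qed

section \<open>Uniform boundedness and Neumann inverses\<close>

lemma uniform_boundedness:
  fixes B :: "'i \<Rightarrow> 'a::banach \<Rightarrow> 'b::real_normed_vector"
  assumes lin: "\<And>i. i \<in> I \<Longrightarrow> bounded_linear (B i)"
    and pw: "\<And>x. \<exists>K. \<forall>i\<in>I. norm (B i x) \<le> K"
  obtains K where "0 \<le> K" "\<And>i x. i \<in> I \<Longrightarrow> norm (B i x) \<le> K * norm x"
proof -
  define F where "F n = {x. \<forall>i\<in>I. norm (B i x) \<le> real n}" for n :: nat
  have F_closed: "closed (F n)" for n
  proof -
    have "F n = (\<Inter>i\<in>I. {x. norm (B i x) \<le> real n})" by (auto simp: F_def)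
    moreover have "closed {x. norm (B i x) \<le> real n}" if "i \<in> I" for i
      by (intro closed_Collect_le continuous_intros linear_continuous_on lin that)
    ultimately show ?thesis by auto
  qed
  have "(\<Union>n. F n) = UNIV"
  proof -
    have "x \<in> (\<Union>n. F n)" for x
    proof -
      obtain K where "\<forall>i\<in>I. norm (B i x) \<le> K" using pw by blast
      moreover obtain n where "K \<le> real n" using real_arch_simple by blast
      ultimately have "x \<in> F n" unfolding F_def by (auto intro: order.trans)
      then show ?thesis by blast
    qed
    then show ?thesis by blast
  qed
  have "\<exists>n. interior (F n) \<noteq> {}"
  proof (rule ccontr)
    assume "\<not> ?thesis"
    moreover have "euclidean interior_of S = interior S" for S :: "'a set"
      by (auto simp: interior_of_def interior_def)
    ultimately have "euclidean interior_of \<Union>(range F) = {}"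
      by (intro Baire_category_alt) (auto simp: completely_metrizable_space_euclidean F_closed)
    then show False using \<open>(\<Union>n. F n) = UNIV\<close> by simp
  qed
  then obtain n x0 r where r: "0 < r" "cball x0 r \<subseteq> F n"
    by (metis all_not_in_conv mem_interior_cball)
  have "norm (B i x) \<le> (2 * real n / r) * norm x" if i: "i \<in> I" for i x
  proof (cases "x = 0")
    case True
    then show ?thesis using linear_simps(3)[OF lin[OF i]] by simp
  next
    case False
    interpret bounded_linear "B i" by (rule lin[OF i])
    \<comment> \<open>Scaled to norm \<open>r\<close>, the vector can be added to \<open>x0\<close>
      without leaving the ball inside \<open>F n\<close>. Subtracting the bound at \<open>x0\<close>
      produces the factor 2.\<close>
    define y where "y = (r / norm x) *\<^sub>R x"
    have "norm y = r" using False r by (simp add: y_def)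
    then have "x0 + y \<in> F n" "x0 \<in> F n"
      using r by (auto simp: dist_norm subset_iff)
    then have *: "norm (B i (x0 + y)) \<le> n" "norm (B i x0) \<le> n" using i by (auto simp: F_def)
    have "norm (B i y) \<le> 2 * n"
      using norm_triangle_ineq4[of "B i (x0 + y)" "B i x0"] * by (simp add: add)
    then have "(r / norm x) * norm (B i x) \<le> 2 * n"
      using r by (simp add: y_def scaleR)
    then show ?thesis using r False by (simp add: field_simps)
  qed
  then show ?thesis using that[of "2 * real n / r"] r by simp
qed

text \<open>The solution of \<open>x - B x = y\<close> is the fixed point of the contraction that
  sends \<open>x\<close> to \<open>y + B x\<close>, so Banach's theorem replaces the operator
  series.\<close>

lemma neumann_inverse:
  fixes B :: "'a::banach \<Rightarrow> 'a"
  assumes lin: "bounded_linear B" and q: "0 \<le> q" "q < 1" and le: "\<And>x. norm (B x) \<le> q * norm x"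
  obtains S where "bounded_linear S" "\<And>x. S (x - B x) = x" "\<And>x. S x - B (S x) = x"
proof -
  interpret bounded_linear B by (rule lin)
  have ex: "\<exists>!x. y + B x = x" for y
  proof -
    have "dist (y + B u) (y + B v) \<le> q * dist u v" for u v
      using le[of "u - v"] by (simp add: dist_norm diff)
    from banach_fix_type[OF q allI[OF allI[OF this]]] show ?thesis .
  qed
  define S where "S y = (THE x. y + B x = x)" for y
  have S: "y + B (S y) = S y" for y
    unfolding S_def by (rule theI'[OF ex])
  have uni: "S y = x" if "y + B x = x" for x y
    using ex[of y] S[of y] that by blast
  have "bounded_linear S"
  proof (rule bounded_linear_intro)
    show "S (x + y) = S x + S y" for x y
      by (rule uni) (metis S add add.assoc add.commute)
    show "S (r *\<^sub>R x) = r *\<^sub>R S x" for r x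
      by (rule uni) (metis S scaleR scaleR_add_right)
    show "norm (S x) \<le> norm x * (1 / (1 - q))" for x
    proof -
      have "norm (S x) \<le> norm x + norm (B (S x))"
        using norm_triangle_ineq[of x "B (S x)"] S[of x] by simp
      also have "\<dots> \<le> norm x + q * norm (S x)" using le[of "S x"] by simp
      finally show ?thesis using q by (simp add: field_simps)
    qed
  qed
  moreover have "S (x - B x) = x" for x by (rule uni) simp
  moreover have "S x - B (S x) = x" for x using S[of x] by (simp add: algebra_simps)
  ultimately show ?thesis using that by blast
qed

section \<open>Integrable densities and their Laplace transforms\<close>

text \<open>The bound on \<open>f\<close> is asked only where \<open>w\<close> is nonzero because
  kernels such as \<open>exp (- s z)\<close> are unbounded on the negative axis, where the weights
  vanish.\<close>

lemma integrable_mult_bounded: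
  fixes f w :: "'a \<Rightarrow> complex"
  assumes "integrable M w" "f \<in> borel_measurable M" "AE s in M. w s \<noteq> 0 \<longrightarrow> cmod (f s) \<le> C"
  shows "integrable M (\<lambda>s. f s * w s)"
proof (rule Bochner_Integration.integrable_bound)
  show "integrable M (\<lambda>s. C * cmod (w s))" using assms(1) by auto
  show "(\<lambda>s. f s * w s) \<in> borel_measurable M" using assms by auto
  show "AE s in M. norm (f s * w s) \<le> norm (C * cmod (w s))"
    using assms(3)
  proof eventually_elim
    case (elim s)
    then have "cmod (f s) * cmod (w s) \<le> \<bar>C\<bar> * cmod (w s)"
      by (cases "w s = 0") (auto intro!: mult_right_mono)
    then show ?case by (simp add: norm_mult abs_mult)
  qed
qed

lemma norm_integral_mult_bounded:
  fixes f w :: "'a \<Rightarrow> complex"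
  assumes "integrable M w" "f \<in> borel_measurable M" "AE s in M. w s \<noteq> 0 \<longrightarrow> cmod (f s) \<le> C"
  shows "cmod (\<integral>s. f s * w s \<partial>M) \<le> C * (\<integral>s. cmod (w s) \<partial>M)"
proof -
  have i: "integrable M (\<lambda>s. f s * w s)" by (rule integrable_mult_bounded[OF assms])
  have "cmod (\<integral>s. f s * w s \<partial>M) \<le> (\<integral>s. cmod (f s * w s) \<partial>M)"
    by (rule integral_norm_bound)
  also have "\<dots> \<le> (\<integral>s. C * cmod (w s) \<partial>M)"
  proof (rule integral_mono_AE)
    show "integrable M (\<lambda>s. cmod (f s * w s))" using i by auto
    show "integrable M (\<lambda>s. C * cmod (w s))" using assms(1) by auto
    show "AE s in M. cmod (f s * w s) \<le> C * cmod (w s)"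
      using assms(3) by eventually_elim (auto simp: norm_mult mult_right_mono)
  qed
  finally show ?thesis by simp
qed

text \<open>With \<open>p = exp (- s)\<close> the transform at \<open>n\<close> is a moment of order
  \<open>n\<close> on \<open>[0, 1]\<close>. Hence the two weights agree on polynomials in
  \<open>p\<close> without constant term, and these approximate every continuous \<open>v\<close>
  with \<open>v 0 = 0\<close> uniformly.\<close>

lemma laplace_unique_real:
  fixes w1 w2 :: "real \<Rightarrow> complex" and v :: "real \<Rightarrow> real"
  assumes M1: "sets M1 = sets borel" "integrable M1 w1" "AE s in M1. w1 s \<noteq> 0 \<longrightarrow> 0 \<le> s"
    and M2: "sets M2 = sets borel" "integrable M2 w2" "AE s in M2. w2 s \<noteq> 0 \<longrightarrow> 0 \<le> s"
    and eq: "\<And>n. 1 \<le> n \<Longrightarrow> (\<integral>s. exp (- (of_real s * of_nat n)) * w1 s \<partial>M1) =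
                          (\<integral>s. exp (- (of_real s * of_nat n)) * w2 s \<partial>M2)"
    and v: "continuous_on {0..1} v" "v 0 = 0" "(\<lambda>s. v (exp (- s))) \<in> borel_measurable borel"
  shows "(\<integral>s. of_real (v (exp (- s))) * w1 s \<partial>M1) = (\<integral>s. of_real (v (exp (- s))) * w2 s \<partial>M2)"
    (is "?I1 = ?I2")
proof -
  define N where "N = (\<integral>s. cmod (w1 s) \<partial>M1) + (\<integral>s. cmod (w2 s) \<partial>M2)"
  have "0 \<le> N" unfolding N_def by simp
  have est: "cmod (?I1 - ?I2) \<le> 2 * e * N" if e: "0 < e" for e
  proof -
    obtain p where p: "real_polynomial_function p" "\<And>x. x \<in> {0..1} \<Longrightarrow> \<bar>v x - p x\<bar> < e"
      by (rule Stone_Weierstrass_real_polynomial_function[of "{0..1::real}" v e])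
        (use v e in auto)
    obtain a n where an: "p = (\<lambda>x. \<Sum>i\<le>n. a i * x ^ i)"
      using p(1) real_polynomial_function_iff_sum by auto
    \<comment> \<open>The transforms at \<open>0\<close> are not known to agree, so the constant
      term is dropped. As \<open>v 0 = 0\<close> it is smaller than \<open>e\<close>, and the error
      grows to \<open>2 * e\<close>.\<close>
    define q where "q x = (\<Sum>i=1..n. a i * x ^ i)" for x
    have pq: "p x = a 0 + q x" for x
      unfolding an q_def by (simp add: sum.atLeast1_atMost_eq sum.atMost_shift)
    have "\<bar>a 0\<bar> < e" using p(2)[of 0] pq[of 0] v(2) by (simp add: q_def)
    then have vq: "\<bar>v x - q x\<bar> \<le> 2 * e" if "x \<in> {0..1}" for x
      using p(2)[OF that] pq[of x] by linarith
    have qint: "(\<integral>s. of_real (q (exp (- s))) * w s \<partial>M) =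
          (\<Sum>i=1..n. of_real (a i) * (\<integral>s. exp (- (of_real s * of_nat i)) * w s \<partial>M))"
      if M: "sets M = sets borel" "integrable M w" "AE s in M. w s \<noteq> 0 \<longrightarrow> 0 \<le> s" for M :: "real measure" and w :: "real \<Rightarrow> complex"
    proof -
      have [measurable_cong]: "sets M = sets borel" by (rule M)
      have "integrable M (\<lambda>s. exp (- (of_real s * of_nat i)) * w s)" for i
        by (rule integrable_mult_bounded[where C = 1]) (use M(2,3) in \<open>auto simp: mult_nonneg_nonneg\<close>)
      moreover have "of_real (q (exp (- s))) * w s =
          (\<Sum>i=1..n. of_real (a i) * (exp (- (of_real s * of_nat i)) * w s))" for s
      proof -
        have "complex_of_real (exp (- s)) ^ i = exp (- (of_real s * of_nat i))" for i
          using exp_of_nat_mult[of i "- of_real s :: complex"] by (simp add: mult.commute flip: exp_of_real)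
        then show ?thesis by (simp add: q_def sum_distrib_left mult_ac)
      qed
      ultimately show ?thesis by simp
    qed
    have diff: "cmod ((\<integral>s. of_real (v (exp (- s))) * w s \<partial>M) - (\<integral>s. of_real (q (exp (- s))) * w s \<partial>M))
          \<le> 2 * e * (\<integral>s. cmod (w s) \<partial>M)"
      if M: "sets M = sets borel" "integrable M w" "AE s in M. w s \<noteq> 0 \<longrightarrow> 0 \<le> s" for M :: "real measure" and w :: "real \<Rightarrow> complex"
    proof -
      have [measurable_cong]: "sets M = sets borel" by (rule M)
      have [measurable]: "(\<lambda>s. v (exp (- s))) \<in> borel_measurable M"
        using v(3) M(1) by (simp cong: measurable_cong_sets)
      have [measurable]: "(\<lambda>s. q (exp (- s))) \<in> borel_measurable M"
        unfolding q_def by measurable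
      obtain B where B: "\<And>x. x \<in> {0..1} \<Longrightarrow> \<bar>v x\<bar> \<le> B"
        using compact_imp_bounded[OF compact_continuous_image[OF v(1)]]
        unfolding bounded_iff by (metis compact_Icc imageI real_norm_def)
      have iv: "integrable M (\<lambda>s. of_real (v (exp (- s))) * w s)"
        by (rule integrable_mult_bounded[where C = B]) (use M(2,3) B in auto)
      have vqb: "AE s in M. w s \<noteq> 0 \<longrightarrow> cmod (of_real (v (exp (- s)) - q (exp (- s)))) \<le> 2 * e"
        using M(3) by eventually_elim (use vq in \<open>simp only: norm_of_real, auto\<close>)
      have id: "integrable M (\<lambda>s. of_real (v (exp (- s)) - q (exp (- s))) * w s)"
        by (rule integrable_mult_bounded[OF M(2) _ vqb]) auto
      have "integrable M (\<lambda>s. of_real (v (exp (- s))) * w s - of_real (v (exp (- s)) - q (exp (- s))) * w s)"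
        by (rule Bochner_Integration.integrable_diff[OF iv id])
      then have iq: "integrable M (\<lambda>s. of_real (q (exp (- s))) * w s)"
        by (simp add: algebra_simps)
      have "(\<integral>s. of_real (v (exp (- s))) * w s \<partial>M) - (\<integral>s. of_real (q (exp (- s))) * w s \<partial>M) =
          (\<integral>s. of_real (v (exp (- s)) - q (exp (- s))) * w s \<partial>M)"
        using iv iq by (simp add: algebra_simps)
      then show ?thesis
        using norm_integral_mult_bounded[OF M(2) _ vqb] by simp
    qed
    have "(\<integral>s. of_real (q (exp (- s))) * w1 s \<partial>M1) = (\<integral>s. of_real (q (exp (- s))) * w2 s \<partial>M2)"
      unfolding qint[OF M1] qint[OF M2] using eq by (intro sum.cong) auto
    then have "?I1 - ?I2 = (?I1 - (\<integral>s. of_real (q (exp (- s))) * w1 s \<partial>M1))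
        - (?I2 - (\<integral>s. of_real (q (exp (- s))) * w2 s \<partial>M2))" by simp
    also have "cmod \<dots> \<le> 2 * e * (\<integral>s. cmod (w1 s) \<partial>M1) + 2 * e * (\<integral>s. cmod (w2 s) \<partial>M2)"
      using norm_triangle_ineq4 diff[OF M1] diff[OF M2] by (smt (verit, best))
    finally show ?thesis by (simp add: N_def algebra_simps)
  qed
  have "cmod (?I1 - ?I2) \<le> 0"
  proof (rule field_le_epsilon)
    fix d :: real assume "0 < d"
    have "cmod (?I1 - ?I2) \<le> 2 * (d / (2 * (N + 1))) * N"
      by (rule est) (use \<open>0 < d\<close> \<open>0 \<le> N\<close> in auto)
    also have "\<dots> \<le> d" using \<open>0 < d\<close> \<open>0 \<le> N\<close> by (simp add: field_simps)
    finally show "cmod (?I1 - ?I2) \<le> 0 + d" by simp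
  qed
  then show ?thesis by simp
qed

text \<open>A bounded continuous \<open>u\<close> need not have a limit at infinity, so it is cut
  off there, and dominated convergence removes the cutoff. The base measures may differ because an
  arbitrary measure from \<open>log_dom\<close> will be compared with a Lebesgue density.\<close>

lemma laplace_unique:
  fixes w1 w2 :: "real \<Rightarrow> complex" and u :: "real \<Rightarrow> complex"
  assumes M1: "sets M1 = sets borel" "integrable M1 w1" "AE s in M1. w1 s \<noteq> 0 \<longrightarrow> 0 \<le> s"
    and M2: "sets M2 = sets borel" "integrable M2 w2" "AE s in M2. w2 s \<noteq> 0 \<longrightarrow> 0 \<le> s"
    and eq: "\<And>n. 1 \<le> n \<Longrightarrow> (\<integral>s. exp (- (of_real s * of_nat n)) * w1 s \<partial>M1) =
                          (\<integral>s. exp (- (of_real s * of_nat n)) * w2 s \<partial>M2)"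
    and u: "continuous_on UNIV u" "\<And>s. cmod (u s) \<le> C"
  shows "(\<integral>s. u s * w1 s \<partial>M1) = (\<integral>s. u s * w2 s \<partial>M2)"
proof -
  have real: "(\<integral>s. of_real (f s) * w1 s \<partial>M1) = (\<integral>s. of_real (f s) * w2 s \<partial>M2)"
    if f: "continuous_on UNIV f" "\<And>s. \<bar>f s\<bar> \<le> C" for f :: "real \<Rightarrow> real"
  proof -
    have [measurable]: "f \<in> borel_measurable borel"
      using f(1) by (rule borel_measurable_continuous_onI)
    \<comment> \<open>The factor vanishes at \<open>p = 0\<close>, that is at \<open>s\<close> =
      infinity, whatever \<open>ln 0\<close> is. At a fixed \<open>s\<close> it equals 1 as soon as
      \<open>j\<close> is at least \<open>exp s\<close>.\<close>
    define v where "v j p = min 1 (real j * p) * f (- ln p)" for j p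
    have vexp: "v j (exp (- s)) = min 1 (real j * exp (- s)) * f s" for j s by (simp add: v_def)
    have cont: "continuous_on {0..1} (v j)" for j
    proof (rule continuous_on_eq_continuous_within[THEN iffD2], rule ballI)
      fix x :: real assume x: "x \<in> {0..1}"
      show "continuous (at x within {0..1}) (v j)"
      proof (cases "x = 0")
        case True
        have "(v j \<longlongrightarrow> 0) (at 0 within {0..1})"
        proof (rule Lim_null_comparison)
          show "\<forall>\<^sub>F p in at 0 within {0..1}. norm (v j p) \<le> real j * p * C"
            unfolding eventually_at_filter
          proof (rule eventuallyI, intro impI)
            fix p :: real assume "p \<in> {0..1}"
            then show "norm (v j p) \<le> real j * p * C"
              unfolding v_def norm_mult using f(2)[of "- ln p"]
              by (intro mult_mono) auto
          qed
          show "((\<lambda>p. real j * p * C) \<longlongrightarrow> 0) (at 0 within {0..1})"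
            by (auto intro!: tendsto_eq_intros)
        qed
        then show ?thesis by (simp add: True continuous_within v_def)
      next
        case False
        have "continuous_on {0<..} (\<lambda>p. f (- ln p))"
          by (rule continuous_on_compose2[OF f(1)]) (auto intro!: continuous_intros)
        then have "continuous_on {0<..} (v j)"
          unfolding v_def by (intro continuous_intros)
        then have "isCont (v j) x"
          using x False by (simp add: continuous_on_eq_continuous_at)
        then show ?thesis by (rule continuous_at_imp_continuous_at_within)
      qed
    qed
    have eqj: "(\<integral>s. of_real (v j (exp (- s))) * w1 s \<partial>M1) =
        (\<integral>s. of_real (v j (exp (- s))) * w2 s \<partial>M2)" for j
      by (rule laplace_unique_real[OF M1 M2 eq cont]) (auto simp: v_def)
    have lim: "(\<lambda>j. \<integral>s. of_real (v j (exp (- s))) * w s \<partial>M) \<longlonglongrightarrow> (\<integral>s. of_real (f s) * w s \<partial>M)"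
      if M: "sets M = sets borel" "integrable M w" "AE s in M. w s \<noteq> 0 \<longrightarrow> 0 \<le> s"
      for M :: "real measure" and w :: "real \<Rightarrow> complex"
    proof (rule integral_dominated_convergence)
      have [measurable_cong]: "sets M = sets borel" by (rule M)
      have [measurable]: "w \<in> borel_measurable M" using M(2) by auto
      show "(\<lambda>s. of_real (f s) * w s) \<in> borel_measurable M" by measurable
      show "(\<lambda>s. of_real (v j (exp (- s))) * w s) \<in> borel_measurable M" for j
        unfolding vexp by measurable
      show "integrable M (\<lambda>s. C * cmod (w s))" using M(2) by auto
      show "AE s in M. (\<lambda>j. of_real (v j (exp (- s))) * w s) \<longlonglongrightarrow> of_real (f s) * w s"
      proof (rule AE_I2)
        fix s :: real
        have "\<forall>\<^sub>F j in sequentially. 1 \<le> real j * exp (- s)"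
        proof -
          obtain n where n: "exp s \<le> real n" using real_arch_simple by blast
          have "1 \<le> real j * exp (- s)" if "n \<le> j" for j
          proof -
            have "exp s \<le> real j" using n that by linarith
            then have "exp s * exp (- s) \<le> real j * exp (- s)" by (intro mult_right_mono) auto
            then show ?thesis by (simp flip: exp_add)
          qed
          then show ?thesis unfolding eventually_sequentially by blast
        qed
        then have "\<forall>\<^sub>F j in sequentially. of_real (v j (exp (- s))) * w s = of_real (f s) * w s"
          by eventually_elim (simp add: vexp)
        then show "(\<lambda>j. of_real (v j (exp (- s))) * w s) \<longlonglongrightarrow> of_real (f s) * w s"
          by (rule tendsto_eventually)
      qed
      show "AE s in M. norm (of_real (v j (exp (- s))) * w s) \<le> C * cmod (w s)" for j
      proof (rule AE_I2)
        fix s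
        have "\<bar>min 1 (real j * exp (- s))\<bar> * \<bar>f s\<bar> \<le> 1 * C"
          using f(2)[of s] by (intro mult_mono) auto
        then show "norm (of_real (v j (exp (- s))) * w s) \<le> C * cmod (w s)"
          unfolding norm_mult vexp norm_of_real abs_mult by (intro mult_right_mono) auto
      qed
    qed
    show ?thesis
      using LIMSEQ_unique[OF lim[OF M1]] lim[OF M2] eqj by simp
  qed
  have [measurable]: "u \<in> borel_measurable borel"
    using u(1) by (rule borel_measurable_continuous_onI)
  have split: "(\<integral>s. u s * w s \<partial>M) =
      (\<integral>s. of_real (Re (u s)) * w s \<partial>M) + \<i> * (\<integral>s. of_real (Im (u s)) * w s \<partial>M)"
    if M: "sets M = sets borel" "integrable M w" for M :: "real measure" and w :: "real \<Rightarrow> complex"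
  proof -
    have [measurable_cong]: "sets M = sets borel" by (rule M)
    have "integrable M (\<lambda>s. of_real (Re (u s)) * w s)"
      by (rule integrable_mult_bounded[OF M(2), where C = C])
        (auto intro!: AE_I2 order.trans[OF abs_Re_le_cmod u(2)])
    moreover have "integrable M (\<lambda>s. of_real (Im (u s)) * w s)"
      by (rule integrable_mult_bounded[OF M(2), where C = C])
        (auto intro!: AE_I2 order.trans[OF abs_Im_le_cmod u(2)])
    moreover have "u s * w s = of_real (Re (u s)) * w s + \<i> * (of_real (Im (u s)) * w s)" for s
      by (subst complex_eq[of "u s"]) (simp add: algebra_simps)
    ultimately show ?thesis by (simp del: complex_of_real_def)
  qed
  have "(\<integral>s. of_real (Re (u s)) * w1 s \<partial>M1) = (\<integral>s. of_real (Re (u s)) * w2 s \<partial>M2)"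
    by (rule real) (use u in \<open>auto intro!: continuous_intros order.trans[OF abs_Re_le_cmod]\<close>)
  moreover have "(\<integral>s. of_real (Im (u s)) * w1 s \<partial>M1) = (\<integral>s. of_real (Im (u s)) * w2 s \<partial>M2)"
    by (rule real) (use u in \<open>auto intro!: continuous_intros order.trans[OF abs_Im_le_cmod]\<close>)
  ultimately show ?thesis
    unfolding split[OF M1(1,2)] split[OF M2(1,2)] by simp
qed

text \<open>Vanishing on the negative axis is required at every point, not only almost everywhere,
  so that shifts and convolutions vanish there by inspection of their integrands.\<close>

definition dens :: "(real \<Rightarrow> complex) \<Rightarrow> bool" where
  "dens k \<longleftrightarrow> integrable lborel k \<and> (\<forall>s<0. k s = 0)"

definition laplace :: "(real \<Rightarrow> complex) \<Rightarrow> complex \<Rightarrow> complex" where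
  "laplace k z = (\<integral>s. exp (- (of_real s * z)) * k s \<partial>lborel)"

definition l1 :: "(real \<Rightarrow> complex) \<Rightarrow> real" where
  "l1 k = (\<integral>s. cmod (k s) \<partial>lborel)"

definition conv :: "(real \<Rightarrow> complex) \<Rightarrow> (real \<Rightarrow> complex) \<Rightarrow> real \<Rightarrow> complex" where
  "conv k l s = (\<integral>r. k (s - r) * l r \<partial>lborel)"

definition shift :: "real \<Rightarrow> (real \<Rightarrow> complex) \<Rightarrow> real \<Rightarrow> complex" where
  "shift h k s = k (s - h)"

lemma densD: "dens k \<Longrightarrow> integrable lborel k" "dens k \<Longrightarrow> s < 0 \<Longrightarrow> k s = 0"
  by (auto simp: dens_def)

lemma dens_measurable: "dens k \<Longrightarrow> k \<in> borel_measurable borel"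
  using borel_measurable_integrable[OF densD(1)] by simp

lemma dens_add: "dens k \<Longrightarrow> dens l \<Longrightarrow> dens (\<lambda>s. k s + l s)"
  and dens_diff: "dens k \<Longrightarrow> dens l \<Longrightarrow> dens (\<lambda>s. k s - l s)"
  and dens_cmult: "dens k \<Longrightarrow> dens (\<lambda>s. c * k s)"
  by (auto simp: dens_def)

lemma integrable_translate:
  fixes k :: "real \<Rightarrow> complex"
  assumes "integrable lborel k"
  shows "integrable lborel (\<lambda>s. k (s - h))"
  using lborel_integrable_real_affine[OF assms, of 1 "- h"] by simp

lemma integral_translate:
  fixes k :: "real \<Rightarrow> 'a::euclidean_space"
  shows "(\<integral>s. k (s - h) \<partial>lborel) = (\<integral>s. k s \<partial>lborel)"
  using lborel_integral_real_affine[of 1 k "- h"] by simp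

lemma dens_shift: "dens k \<Longrightarrow> 0 \<le> h \<Longrightarrow> dens (shift h k)"
  using integrable_translate[of k h] by (auto simp: dens_def shift_def[abs_def])

text \<open>The test function \<open>u\<close> is arbitrary so that one application of Fubini serves
  twice: exponentials give the transform of a convolution, orbits give the product of two
  operators.\<close>

lemma conv_fubini:
  assumes k: "integrable lborel k" and l: "integrable lborel l"
    and u: "u \<in> borel_measurable borel" "\<And>s. cmod (u s) \<le> C"
  shows "integrable lborel (conv k l)"
    and "(\<integral>s. u s * conv k l s \<partial>lborel) = (\<integral>r. (\<integral>s. u (s + r) * k s \<partial>lborel) * l r \<partial>lborel)"
proof -
  have [measurable]: "k \<in> borel_measurable borel" "l \<in> borel_measurable borel" "u \<in> borel_measurable borel"
    using k l u(1) by (auto dest: borel_measurable_integrable)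
  let ?f = "\<lambda>r s. k (s - r) * l r"
  have nf: "(\<integral>s. cmod (?f r s) \<partial>lborel) = l1 k * cmod (l r)" for r
    using integral_translate[of "\<lambda>s. cmod (k s)" r] by (simp add: norm_mult l1_def)
  have f: "integrable (lborel \<Otimes>\<^sub>M lborel) (case_prod ?f)"
  proof (rule lborel_pair.Fubini_integrable)
    show "case_prod ?f \<in> borel_measurable (lborel \<Otimes>\<^sub>M lborel)" by measurable
    show "integrable lborel (\<lambda>r. \<integral>s. norm (case_prod ?f (r, s)) \<partial>lborel)"
      using l by (simp add: nf)
    show "AE r in lborel. integrable lborel (\<lambda>s. case_prod ?f (r, s))"
      using integrable_translate[OF k] by auto
  qed
  show "integrable lborel (conv k l)"
    using lborel_pair.integrable_snd[OF f] unfolding conv_def .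
  have g: "integrable (lborel \<Otimes>\<^sub>M lborel) (case_prod (\<lambda>r s. u s * ?f r s))"
  proof -
    have "integrable (lborel \<Otimes>\<^sub>M lborel) (\<lambda>p. u (snd p) * case_prod ?f p)"
      by (rule integrable_mult_bounded[OF f, where C = C]) (use u(2) in auto)
    moreover have "(\<lambda>p. u (snd p) * case_prod ?f p) = case_prod (\<lambda>r s. u s * ?f r s)"
      by auto
    ultimately show ?thesis by (simp only:)
  qed
  have "(\<integral>s. u s * conv k l s \<partial>lborel) = (\<integral>s. (\<integral>r. u s * ?f r s \<partial>lborel) \<partial>lborel)"
    by (simp add: conv_def)
  also have "\<dots> = (\<integral>r. (\<integral>s. u s * ?f r s \<partial>lborel) \<partial>lborel)"
    by (rule lborel_pair.Fubini_integral[OF g])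
  also have "(\<lambda>r. \<integral>s. u s * ?f r s \<partial>lborel) = (\<lambda>r. (\<integral>s. u (s + r) * k s \<partial>lborel) * l r)"
  proof
    fix r
    have "(\<integral>s. u s * ?f r s \<partial>lborel) = (\<integral>s. (u s * k (s - r)) * l r \<partial>lborel)"
      by (simp add: mult_ac)
    also have "\<dots> = (\<integral>s. u s * k (s - r) \<partial>lborel) * l r"
      by simp
    also have "(\<integral>s. u s * k (s - r) \<partial>lborel) = (\<integral>s. u (s + r) * k s \<partial>lborel)"
      using integral_translate[of "\<lambda>s. u (s + r) * k s" r] by simp
    finally show "(\<integral>s. u s * ?f r s \<partial>lborel) = (\<integral>s. u (s + r) * k s \<partial>lborel) * l r" .
  qed
  finally show "(\<integral>s. u s * conv k l s \<partial>lborel) = (\<integral>r. (\<integral>s. u (s + r) * k s \<partial>lborel) * l r \<partial>lborel)" .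
qed

lemma dens_conv:
  assumes k: "dens k" and l: "dens l"
  shows "dens (conv k l)"
proof -
  have "integrable lborel (conv k l)"
    by (rule conv_fubini(1)[OF densD(1)[OF k] densD(1)[OF l], of "\<lambda>_. 0" 0]) auto
  moreover have "conv k l s = 0" if "s < 0" for s
  proof -
    have "k (s - r) * l r = 0" for r
      using densD(2)[OF k, of "s - r"] densD(2)[OF l, of r] that by (cases "r < 0") auto
    then show ?thesis unfolding conv_def by (simp only: integral_zero)
  qed
  ultimately show ?thesis by (simp add: dens_def)
qed

lemma cmod_exp_le_1:
  assumes "0 \<le> Re z" "0 \<le> s"
  shows "cmod (exp (- (of_real s * z))) \<le> 1"
  using assms by (simp add: norm_exp_eq_Re)

text \<open>Replacing \<open>s\<close> by \<open>max 0 s\<close> makes the kernel bounded and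
  continuous on the whole line, as a global test function has to be.\<close>

lemma laplace_max: "dens k \<Longrightarrow> laplace k z = (\<integral>s. exp (- (of_real (max 0 s) * z)) * k s \<partial>lborel)"
  unfolding laplace_def by (intro Bochner_Integration.integral_cong) (auto simp: densD(2) max_def)

lemma dens_bounded_integrable:
  assumes k: "dens k" and u: "u \<in> borel_measurable borel" "\<And>s. 0 \<le> s \<Longrightarrow> cmod (u s) \<le> C"
  shows "integrable lborel (\<lambda>s. u s * k s)"
    and "cmod (\<integral>s. u s * k s \<partial>lborel) \<le> C * l1 k"
proof -
  have [measurable]: "u \<in> borel_measurable borel" by (rule u)
  have *: "AE s in lborel. k s \<noteq> 0 \<longrightarrow> cmod (u s) \<le> C"
    using u(2) densD(2)[OF k] by (intro AE_I2) (metis not_less)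
  show "integrable lborel (\<lambda>s. u s * k s)"
    by (rule integrable_mult_bounded[OF densD(1)[OF k] _ *]) simp
  show "cmod (\<integral>s. u s * k s \<partial>lborel) \<le> C * l1 k"
    unfolding l1_def by (rule norm_integral_mult_bounded[OF densD(1)[OF k] _ *]) simp
qed

lemma laplace_integrable:
  assumes "dens k" "0 \<le> Re z"
  shows "integrable lborel (\<lambda>s. exp (- (of_real s * z)) * k s)"
  by (rule dens_bounded_integrable(1)[OF assms(1), where C = 1])
    (use cmod_exp_le_1[OF assms(2)] in auto)

lemma laplace_add: "dens k \<Longrightarrow> dens l \<Longrightarrow> 0 \<le> Re z \<Longrightarrow> laplace (\<lambda>s. k s + l s) z = laplace k z + laplace l z"
  and laplace_diff: "dens k \<Longrightarrow> dens l \<Longrightarrow> 0 \<le> Re z \<Longrightarrow> laplace (\<lambda>s. k s - l s) z = laplace k z - laplace l z"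
  using laplace_integrable[of k z] laplace_integrable[of l z]
  unfolding laplace_def ring_distribs by simp_all

lemma laplace_cmult: "laplace (\<lambda>s. c * k s) z = c * laplace k z"
  by (simp add: laplace_def mult.left_commute)

lemma laplace_shift: "laplace (shift h k) z = exp (- (of_real h * z)) * laplace k z"
proof -
  have "laplace (shift h k) z = (\<integral>s. exp (- (of_real h * z)) * (exp (- (of_real (s - h) * z)) * k (s - h)) \<partial>lborel)"
    unfolding laplace_def shift_def mult.assoc[symmetric] mult_exp_exp by (simp add: algebra_simps)
  then show ?thesis
    using integral_translate[of "\<lambda>s. exp (- (of_real s * z)) * k s" h] by (simp add: laplace_def)
qed

lemma laplace_conv:
  assumes k: "dens k" and l: "dens l" and z: "0 \<le> Re z"
  shows "laplace (conv k l) z = laplace k z * laplace l z"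
proof -
  let ?u = "\<lambda>s. exp (- (of_real (max 0 s) * z))"
  have "laplace (conv k l) z = (\<integral>r. (\<integral>s. ?u (s + r) * k s \<partial>lborel) * l r \<partial>lborel)"
    unfolding laplace_max[OF dens_conv[OF k l]]
    by (rule conv_fubini(2)[OF densD(1)[OF k] densD(1)[OF l], where C = 1])
      (measurable, rule cmod_exp_le_1[OF z], simp)
  also have "\<dots> = (\<integral>r. laplace k z * (exp (- (of_real r * z)) * l r) \<partial>lborel)"
  proof (rule Bochner_Integration.integral_cong[OF refl])
    fix r :: real
    show "(\<integral>s. ?u (s + r) * k s \<partial>lborel) * l r = laplace k z * (exp (- (of_real r * z)) * l r)"
    proof (cases "r < 0")
      case True then show ?thesis using densD(2)[OF l] by simp
    next
      case False
      have "?u (s + r) * k s = exp (- (of_real r * z)) * (exp (- (of_real s * z)) * k s)" for s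
      proof (cases "s < 0")
        case True then show ?thesis using densD(2)[OF k] by simp
      next
        case False
        then have "max 0 (s + r) = s + r" using \<open>\<not> r < 0\<close> by simp
        moreover have "exp (- (of_real (s + r) * z)) = exp (- (of_real r * z)) * exp (- (of_real s * z))"
          by (simp add: mult_exp_exp algebra_simps)
        ultimately show ?thesis by simp
      qed
      then have "(\<integral>s. ?u (s + r) * k s \<partial>lborel) =
          (\<integral>s. exp (- (of_real r * z)) * (exp (- (of_real s * z)) * k s) \<partial>lborel)"
        by (simp only:)
      also have "\<dots> = exp (- (of_real r * z)) * laplace k z"
        unfolding laplace_def by (rule integral_mult_right_zero)
      finally show ?thesis by (simp only: mult_ac)
    qed
  qed
  finally show ?thesis by (simp add: laplace_def)
qed

lemma laplace_eq_imp_integral_eq: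
  assumes k: "dens k" and l: "dens l"
    and eq: "\<And>n. 1 \<le> n \<Longrightarrow> laplace k (of_nat n) = laplace l (of_nat n)"
    and u: "continuous_on UNIV u" "\<And>s. cmod (u s) \<le> C"
  shows "(\<integral>s. u s * k s \<partial>lborel) = (\<integral>s. u s * l s \<partial>lborel)"
proof -
  have "AE s in lborel. k s \<noteq> 0 \<longrightarrow> 0 \<le> s" if "dens k" for k
    using densD(2)[OF that] by (intro AE_I2) (metis not_less)
  then show ?thesis
    by (intro laplace_unique[OF _ _ _ _ _ _ _ u]) (use k l eq densD(1) in \<open>auto simp: laplace_def\<close>)
qed

section \<open>The Hille--Phillips calculus for integrable densities\<close>

text \<open>Here \<open>N * N\<close> cells of length \<open>1 / N\<close> tile
  \<open>[0, N)\<close>, so a single parameter refines the mesh and exhausts the half-line. Every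
  \<open>s\<close> below \<open>N\<close> lies in exactly one cell.\<close>

lemma sum_indicator_lattice:
  fixes f :: "nat \<Rightarrow> 'b::real_algebra_1"
  assumes N: "0 < N" and s: "0 \<le> s"
  shows "(\<Sum>j<N * N. indicator {real j / real N..<(real j + 1) / real N} s * f j) =
    (if s < real N then f (nat \<lfloor>s * real N\<rfloor>) else 0)"
proof -
  have iff: "s \<in> {real j / real N..<(real j + 1) / real N} \<longleftrightarrow> j = nat \<lfloor>s * real N\<rfloor>" for j
  proof -
    have "s \<in> {real j / real N..<(real j + 1) / real N} \<longleftrightarrow> real j \<le> s * real N \<and> s * real N < real j + 1"
      using N by (simp add: divide_le_eq less_divide_eq)
    also have "\<dots> \<longleftrightarrow> \<lfloor>s * real N\<rfloor> = int j" by (simp add: floor_eq_iff)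
    also have "\<dots> \<longleftrightarrow> j = nat \<lfloor>s * real N\<rfloor>" using s by auto
    finally show ?thesis .
  qed
  have "(\<Sum>j<N * N. indicator {real j / real N..<(real j + 1) / real N} s * f j) =
      (\<Sum>j<N * N. if nat \<lfloor>s * real N\<rfloor> = j then f j else 0)"
    unfolding indicator_def of_bool_def iff by (intro sum.cong) auto
  also have "\<dots> = (if nat \<lfloor>s * real N\<rfloor> < N * N then f (nat \<lfloor>s * real N\<rfloor>) else 0)"
    by (simp add: sum.delta)
  also have "nat \<lfloor>s * real N\<rfloor> < N * N \<longleftrightarrow> s < real N"
  proof -
    have "nat \<lfloor>s * real N\<rfloor> < N * N \<longleftrightarrow> s * real N < real N * real N"
      using s by (simp add: nat_less_iff floor_less_iff)
    then show ?thesis using N by simp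
  qed
  finally show ?thesis .
qed

text \<open>The bound \<open>M\<close> is a parameter so that all estimates can refer to it;
  \<open>1 <= M\<close> keeps the constants built from it positive.\<close>

locale C0_semigroup =
  fixes cs :: "complex \<Rightarrow> 'a::banach \<Rightarrow> 'a" and T :: "real \<Rightarrow> 'a \<Rightarrow> 'a" and M :: real
  assumes scaling: "complex_scaling cs"
    and semigroup: "bounded_C0_semigroup cs T"
    and M_ge_1: "1 \<le> M" and M_bound: "\<And>s x. 0 \<le> s \<Longrightarrow> norm (T s x) \<le> M * norm x"
begin

lemma cs_add: "cs c (x + y) = cs c x + cs c y"
  and cs_add_left: "cs (c + d) x = cs c x + cs d x"
  and cs_mult: "cs (c * d) x = cs c (cs d x)"
  and cs_1: "cs 1 x = x"
  and cs_of_real: "cs (of_real r) x = r *\<^sub>R x"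
  and norm_cs: "norm (cs c x) = cmod c * norm x"
  using scaling unfolding complex_scaling_def by auto

lemma cs_bounded_linear: "bounded_linear (cs c)"
proof (rule bounded_linear_intro)
  show "cs c (r *\<^sub>R x) = r *\<^sub>R cs c x" for r x
    by (metis cs_mult cs_of_real mult.commute)
  show "norm (cs c x) \<le> norm x * cmod c" for x by (simp add: norm_cs)
qed (rule cs_add)

lemmas cs_diff = linear_diff[OF bounded_linear.linear[OF cs_bounded_linear]]
  and cs_minus = linear_neg[OF bounded_linear.linear[OF cs_bounded_linear]]
  and cs_scaleR = linear_scale[OF bounded_linear.linear[OF cs_bounded_linear]]

lemma cs_0: "cs 0 x = 0" using cs_of_real[of 0 x] by simp

lemma cs_minus_left: "cs (- c) x = - cs c x"
  using cs_add_left[of c "- c" x] cs_0[of x] by (simp add: eq_neg_iff_add_eq_0 add.commute)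

lemma T_bounded_linear: "0 \<le> s \<Longrightarrow> bounded_linear (T s)"
  and T_cs: "0 \<le> s \<Longrightarrow> T s (cs c x) = cs c (T s x)"
  and T_0: "T 0 x = x"
  and T_add: "0 \<le> s \<Longrightarrow> 0 \<le> t \<Longrightarrow> T (s + t) x = T s (T t x)"
  and T_continuous: "continuous_on {0..} (\<lambda>s. T s x)"
  using semigroup unfolding bounded_C0_semigroup_def by auto

text \<open>Orbits are continued by the constant value \<open>x\<close> to negative times. They
  become bounded and continuous on the whole line, and integrals against densities do not
  change.\<close>

definition U :: "real \<Rightarrow> 'a \<Rightarrow> 'a" where "U s = T (max 0 s)"

lemma U_eq: "0 \<le> s \<Longrightarrow> U s = T s" by (simp add: U_def)

lemma U_bounded_linear: "bounded_linear (U s)"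
  unfolding U_def by (rule T_bounded_linear) simp

lemma U_cs: "U s (cs c x) = cs c (U s x)"
  unfolding U_def by (rule T_cs) simp

lemma U_norm: "norm (U s x) \<le> M * norm x"
  unfolding U_def by (rule M_bound) simp

lemma U_continuous: "continuous_on UNIV (\<lambda>s. U s x)"
  unfolding U_def by (rule continuous_on_compose2[OF T_continuous]) (auto intro!: continuous_intros)

section \<open>Complex-linear functionals and the weak integral\<close>

definition dual :: "('a \<Rightarrow> complex) set" where
  "dual = {\<psi>. bounded_linear \<psi> \<and> (\<forall>c x. \<psi> (cs c x) = c * \<psi> x)}"

lemma dual_bounded_linear: "\<psi> \<in> dual \<Longrightarrow> bounded_linear \<psi>"
  and dual_cs: "\<psi> \<in> dual \<Longrightarrow> \<psi> (cs c x) = c * \<psi> x"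
  by (auto simp: dual_def)

lemmas dual_linear = bounded_linear.linear[OF dual_bounded_linear]

text \<open>This is the usual \<open>phi y - i phi (i y)\<close>. Rotating \<open>y\<close> by a
  unimodular scalar makes the value real and nonnegative, hence a value of \<open>phi\<close>, so
  the bound \<open>K\<close> carries over.\<close>

lemma complexify:
  fixes \<phi> :: "'a \<Rightarrow> real"
  assumes lin: "linear \<phi>" and K: "\<And>y. \<bar>\<phi> y\<bar> \<le> K * norm y"
  obtains \<psi> where "\<psi> \<in> dual" "\<And>y. Re (\<psi> y) = \<phi> y" "\<And>y. cmod (\<psi> y) \<le> K * norm y"
proof -
  define \<psi> where "\<psi> y = Complex (\<phi> y) (- \<phi> (cs \<i> y))" for y
  have Re: "Re (\<psi> y) = \<phi> y" for y by (simp add: \<psi>_def)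
  have add: "\<psi> (y + z) = \<psi> y + \<psi> z" for y z
    by (simp add: \<psi>_def linear_add[OF lin] cs_add complex_eq_iff)
  have scale: "\<psi> (r *\<^sub>R y) = r *\<^sub>R \<psi> y" for r y
    by (simp add: \<psi>_def linear_scale[OF lin] cs_scaleR complex_eq_iff)
  have i: "\<psi> (cs \<i> y) = \<i> * \<psi> y" for y
  proof -
    have "cs \<i> (cs \<i> y) = - y"
      using cs_mult[of \<i> \<i> y] by (simp add: cs_minus_left cs_1)
    then show ?thesis by (simp add: \<psi>_def complex_eq_iff linear_neg[OF lin])
  qed
  have cs: "\<psi> (cs c y) = c * \<psi> y" for c y
  proof -
    have "cs c y = Re c *\<^sub>R y + Im c *\<^sub>R cs \<i> y"
      by (subst complex_eq[of c]) (simp only: cs_add_left cs_of_real mult.commute[of \<i>] cs_mult)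
    then have "\<psi> (cs c y) = of_real (Re c) * \<psi> y + of_real (Im c) * (\<i> * \<psi> y)"
      by (simp add: add scale i scaleR_conv_of_real)
    also have "\<dots> = c * \<psi> y"
      by (subst (3) complex_eq[of c]) (simp add: algebra_simps)
    finally show ?thesis .
  qed
  have norm: "cmod (\<psi> y) \<le> K * norm y" for y
  proof (cases "\<psi> y = 0")
    case True
    then show ?thesis using K[of y] by (simp add: Re[symmetric])
  next
    case False
    define c where "c = cnj (\<psi> y) / of_real (cmod (\<psi> y))"
    have "c * \<psi> y = of_real (cmod (\<psi> y))"
      using False by (simp add: c_def complex_norm_square[symmetric] power2_eq_square mult.commute)
    then have "cmod (\<psi> y) = Re (\<psi> (cs c y))" by (simp add: cs)
    also have "\<dots> \<le> K * norm (cs c y)" unfolding Re using K[of "cs c y"] by linarith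
    also have "\<dots> = K * norm y" using False by (simp add: norm_cs c_def norm_divide)
    finally show ?thesis .
  qed
  have "bounded_linear \<psi>"
    by (rule bounded_linear_intro[where K = K]) (use add scale norm in \<open>auto simp: mult.commute\<close>)
  then have "\<psi> \<in> dual" using cs by (simp add: dual_def)
  then show ?thesis using that Re norm by blast
qed

lemma dual_norming:
  obtains \<psi> where "\<psi> \<in> dual" "\<And>y. cmod (\<psi> y) \<le> norm y" "norm x \<le> cmod (\<psi> x)"
proof -
  obtain \<phi> :: "'a \<Rightarrow> real" where \<phi>: "linear \<phi>" "\<And>y. \<bar>\<phi> y\<bar> \<le> norm y" "\<phi> x = norm x"
    using norming_functional[of x] by metis
  have "\<And>y. \<bar>\<phi> y\<bar> \<le> 1 * norm y" using \<phi>(2) by simp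
  then obtain \<psi> where \<psi>: "\<psi> \<in> dual" "\<And>y. Re (\<psi> y) = \<phi> y" "\<And>y. cmod (\<psi> y) \<le> 1 * norm y"
    using complexify[OF \<phi>(1)] by blast
  moreover have "norm x \<le> cmod (\<psi> x)"
    using \<phi>(3) \<psi>(2)[of x] complex_Re_le_cmod[of "\<psi> x"] by simp
  ultimately show ?thesis using that by simp
qed

lemma norm_le_dualI:
  assumes "\<And>\<psi>. \<psi> \<in> dual \<Longrightarrow> (\<And>y. cmod (\<psi> y) \<le> norm y) \<Longrightarrow> cmod (\<psi> x) \<le> C"
  shows "norm x \<le> C"
  using assms dual_norming[of x] by (metis order.trans)

lemma dual_eqI:
  assumes "\<And>\<psi>. \<psi> \<in> dual \<Longrightarrow> \<psi> x = \<psi> y"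
  shows "x = y"
proof -
  have "norm (x - y) \<le> 0"
    by (rule norm_le_dualI) (simp add: linear_diff[OF dual_linear] assms)
  then show ?thesis by simp
qed

lemma dual_compose_U: "\<psi> \<in> dual \<Longrightarrow> (\<lambda>x. \<psi> (U s x)) \<in> dual"
  unfolding dual_def using bounded_linear_compose[OF _ U_bounded_linear] by (auto simp: U_cs)

lemma orbit_continuous: "\<psi> \<in> dual \<Longrightarrow> continuous_on UNIV (\<lambda>s. \<psi> (U s x))"
  by (rule bounded_linear.continuous_on[OF dual_bounded_linear U_continuous])

lemma orbit_measurable: "\<psi> \<in> dual \<Longrightarrow> (\<lambda>s. \<psi> (U s x)) \<in> borel_measurable borel"
  by (rule borel_measurable_continuous_onI[OF orbit_continuous])

lemma orbit_bounded:
  assumes "\<psi> \<in> dual"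
  obtains C where "\<And>s. cmod (\<psi> (U s x)) \<le> C"
proof -
  obtain K where K: "0 \<le> K" "\<And>y. cmod (\<psi> y) \<le> norm y * K"
    using bounded_linear.nonneg_bounded[OF dual_bounded_linear[OF assms]] by blast
  have "cmod (\<psi> (U s x)) \<le> (M * norm x) * K" for s
    using K(2)[of "U s x"] mult_right_mono[OF U_norm K(1)] by (rule order.trans)
  then show ?thesis by (rule that)
qed

lemma orbit_norm_measurable: "(\<lambda>s. norm (y - U s x)) \<in> borel_measurable borel"
  by (rule borel_measurable_continuous_onI) (intro continuous_intros U_continuous)

text \<open>The weak integral must be found in the space itself and not in its bidual. Sums
  \<open>S n\<close> of orbit values at grid points, weighted with the \<open>k\<close>-mass of the
  cells, form a Cauchy sequence in norm: \<open>d n\<close> measures the discretisation error of the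
  orbit, and its mean \<open>E n\<close> against \<open>|k|\<close> tends to 0 by dominated
  convergence.\<close>

lemma Op_exists:
  assumes k: "dens k"
  shows "\<exists>y. \<forall>\<psi>\<in>dual. \<psi> y = (\<integral>s. \<psi> (U s x) * k s \<partial>lborel)"
proof -
  have [measurable]: "k \<in> borel_measurable borel" by (rule dens_measurable[OF k])
  define J where "J n j = {real j / real (Suc n)..<(real j + 1) / real (Suc n)}" for n j :: nat
  define p where "p n j = real j / real (Suc n)" for n j :: nat
  define S where "S n = (\<Sum>j<Suc n * Suc n. cs (\<integral>s. indicator (J n j) s * k s \<partial>lborel) (U (p n j) x))" for n
  \<comment> \<open>The second summand is the error beyond the range of the grid, where the step
    function is 0.\<close>
  define d where "d n s = (\<Sum>j<Suc n * Suc n. indicator (J n j) s * norm (U (p n j) x - U s x))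
      + (if s < real (Suc n) then 0 else norm (0 - U s x))" for n s
  define E where "E n = (\<integral>s. d n s * cmod (k s) \<partial>lborel)" for n
  have [measurable]: "J n j \<in> sets borel" for n j by (simp add: J_def)
  have [measurable]: "(\<lambda>s. norm (y - U s x)) \<in> borel_measurable borel" for y
    by (rule orbit_norm_measurable)
  have [measurable]: "d n \<in> borel_measurable borel" for n
    unfolding d_def by measurable
  have sum_J: "(\<Sum>j<Suc n * Suc n. indicator (J n j) s * f j) =
      (if s < real (Suc n) then f (nat \<lfloor>s * real (Suc n)\<rfloor>) else 0)"
    if "0 \<le> s" for n s and f :: "nat \<Rightarrow> 'b::real_algebra_1"
    unfolding J_def by (rule sum_indicator_lattice) (use that in auto)
  have d_eq: "d n s = (if s < real (Suc n) then norm (U (p n (nat \<lfloor>s * real (Suc n)\<rfloor>)) x - U s x) else norm (U s x))"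
    if "0 \<le> s" for n s
    unfolding d_def using sum_J[OF that, of n "\<lambda>j. norm (U (p n j) x - U s x)"] by simp
  have d_nonneg: "0 \<le> d n s" for n s
    unfolding d_def by (intro add_nonneg_nonneg sum_nonneg mult_nonneg_nonneg) auto
  have d_le: "d n s \<le> 2 * M * norm x" if "0 \<le> s" for n s
  proof -
    have "norm (U a x - U s x) \<le> 2 * M * norm x" for a
      using norm_triangle_ineq4[of "U a x" "U s x"] U_norm[of a x] U_norm[of s x] by linarith
    moreover have "norm (U s x) \<le> 2 * M * norm x"
      using U_norm[of s x] norm_ge_zero[of "U s x"] by linarith
    ultimately show ?thesis unfolding d_eq[OF that] by simp
  qed
  have d_lim: "(\<lambda>n. d n s) \<longlonglongrightarrow> 0" if s: "0 \<le> s" for s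
  proof -
    have pl: "(\<lambda>n. p n (nat \<lfloor>s * real (Suc n)\<rfloor>)) \<longlonglongrightarrow> s"
    proof (rule LIM_zero_cancel, rule Lim_null_comparison)
      show "(\<lambda>n. inverse (real (Suc n))) \<longlonglongrightarrow> 0" by (rule LIMSEQ_inverse_real_of_nat)
      show "\<forall>\<^sub>F n in sequentially. norm (p n (nat \<lfloor>s * real (Suc n)\<rfloor>) - s) \<le> inverse (real (Suc n))"
      proof (rule always_eventually, rule allI)
        fix n
        have r: "real (nat \<lfloor>s * real (Suc n)\<rfloor>) = real_of_int \<lfloor>s * real (Suc n)\<rfloor>"
          using s by simp
        have "\<bar>real (nat \<lfloor>s * real (Suc n)\<rfloor>) - s * real (Suc n)\<bar> \<le> 1"
          unfolding r by linarith
        then have "\<bar>real (nat \<lfloor>s * real (Suc n)\<rfloor>) - s * real (Suc n)\<bar> / real (Suc n) \<le> 1 / real (Suc n)"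
          by (rule divide_right_mono) simp
        moreover have "\<bar>real (nat \<lfloor>s * real (Suc n)\<rfloor>) - s * real (Suc n)\<bar> / real (Suc n) =
            \<bar>p n (nat \<lfloor>s * real (Suc n)\<rfloor>) - s\<bar>"
          unfolding p_def by (subst abs_div_pos) (auto simp: diff_divide_distrib)
        ultimately show "norm (p n (nat \<lfloor>s * real (Suc n)\<rfloor>) - s) \<le> inverse (real (Suc n))"
          by (simp add: inverse_eq_divide)
      qed
    qed
    have "isCont (\<lambda>s. U s x) s" using U_continuous by (simp add: continuous_on_eq_continuous_at)
    from isCont_tendsto_compose[OF this pl]
    have "(\<lambda>n. norm (U (p n (nat \<lfloor>s * real (Suc n)\<rfloor>)) x - U s x)) \<longlonglongrightarrow> norm (U s x - U s x)"
      by (intro tendsto_intros)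
    moreover have "\<forall>\<^sub>F n in sequentially. norm (U (p n (nat \<lfloor>s * real (Suc n)\<rfloor>)) x - U s x) = d n s"
    proof -
      obtain m where "s < real m" using reals_Archimedean2 by blast
      then have "s < real (Suc n)" if "m \<le> n" for n using that by linarith
      then show ?thesis unfolding eventually_sequentially d_eq[OF s] by (intro exI[of _ m]) auto
    qed
    ultimately show ?thesis by (auto intro: Lim_transform_eventually)
  qed
  have E_lim: "E \<longlonglongrightarrow> 0"
  proof -
    have "(\<lambda>n. \<integral>s. d n s * cmod (k s) \<partial>lborel) \<longlonglongrightarrow> (\<integral>s. 0 \<partial>(lborel :: real measure))"
    proof (rule integral_dominated_convergence[where w = "\<lambda>s. 2 * M * norm x * cmod (k s)"])
      show "integrable lborel (\<lambda>s. 2 * M * norm x * cmod (k s))" using densD(1)[OF k] by auto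
      show "AE s in lborel. (\<lambda>n. d n s * cmod (k s)) \<longlonglongrightarrow> 0"
      proof (rule AE_I2)
        fix s show "(\<lambda>n. d n s * cmod (k s)) \<longlonglongrightarrow> 0"
          using tendsto_mult_left_zero[OF d_lim[of s], of "cmod (k s)"] densD(2)[OF k, of s]
          by (cases "s < 0") auto
      qed
      show "AE s in lborel. norm (d n s * cmod (k s)) \<le> 2 * M * norm x * cmod (k s)" for n
      proof (rule AE_I2)
        fix s show "norm (d n s * cmod (k s)) \<le> 2 * M * norm x * cmod (k s)"
          using d_le[of s n] d_nonneg[of n s] densD(2)[OF k, of s]
          by (cases "s < 0") (auto simp: abs_mult intro!: mult_right_mono)
      qed
    qed auto
    then show ?thesis by (simp add: E_def[abs_def])
  qed
  \<comment> \<open>Used twice: with \<open>K = 1\<close> for norming functionals it shows that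
    \<open>S\<close> is Cauchy, and with the bound of an arbitrary functional it identifies the
    limit.\<close>
  have key: "cmod (\<psi> (S n) - (\<integral>s. \<psi> (U s x) * k s \<partial>lborel)) \<le> K * E n"
    if \<psi>: "\<psi> \<in> dual" and K: "\<And>y. cmod (\<psi> y) \<le> K * norm y" for \<psi> K n
  proof -
    have [measurable]: "(\<lambda>s. \<psi> (U s x)) \<in> borel_measurable borel" by (rule orbit_measurable[OF \<psi>])
    obtain C where C: "\<And>s. cmod (\<psi> (U s x)) \<le> C" using orbit_bounded[OF \<psi>, of x] by blast
    have i1: "integrable lborel (\<lambda>s. \<psi> (U s x) * k s)"
      by (rule dens_bounded_integrable(1)[OF k _ C]) auto
    have i2: "integrable lborel (\<lambda>s. indicator (J n j) s * k s)" for j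
      by (rule dens_bounded_integrable(1)[OF k, where C = 1]) (auto simp: indicator_def)
    define g where "g s = (\<Sum>j<Suc n * Suc n. indicator (J n j) s * \<psi> (U (p n j) x))" for s
    have gk: "g s * k s = (\<Sum>j<Suc n * Suc n. \<psi> (U (p n j) x) * (indicator (J n j) s * k s))" for s
      unfolding g_def sum_distrib_right by (intro sum.cong) (auto simp: mult_ac)
    have ig: "integrable lborel (\<lambda>s. g s * k s)"
      unfolding gk by (intro Bochner_Integration.integrable_sum integrable_mult_right i2)
    have "\<psi> (S n) = (\<integral>s. g s * k s \<partial>lborel)"
    proof -
      have "\<psi> (S n) = (\<Sum>j<Suc n * Suc n. (\<integral>s. \<psi> (U (p n j) x) * (indicator (J n j) s * k s) \<partial>lborel))"
        unfolding S_def linear_sum[OF dual_linear[OF \<psi>]] dual_cs[OF \<psi>]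
        by (intro sum.cong refl) (simp add: mult.commute)
      also have "\<dots> = (\<integral>s. g s * k s \<partial>lborel)"
        unfolding gk
        by (intro Bochner_Integration.integral_sum[symmetric] integrable_mult_right i2)
      finally show ?thesis .
    qed
    then have "\<psi> (S n) - (\<integral>s. \<psi> (U s x) * k s \<partial>lborel) = (\<integral>s. (g s - \<psi> (U s x)) * k s \<partial>lborel)"
      using ig i1 by (simp add: algebra_simps)
    also have "cmod \<dots> \<le> (\<integral>s. cmod ((g s - \<psi> (U s x)) * k s) \<partial>lborel)"
      by (rule integral_norm_bound)
    also have "\<dots> \<le> (\<integral>s. K * (d n s * cmod (k s)) \<partial>lborel)"
    proof (rule integral_mono)
      show "integrable lborel (\<lambda>s. cmod ((g s - \<psi> (U s x)) * k s))"
        using Bochner_Integration.integrable_diff[OF ig i1]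
        by (intro integrable_norm) (simp add: algebra_simps)
      have "integrable lborel (\<lambda>s. of_real (d n s) * k s)"
        by (rule dens_bounded_integrable(1)[OF k, where C = "2 * M * norm x"]) (use d_le d_nonneg in auto)
      from integrable_norm[OF this] show "integrable lborel (\<lambda>s. K * (d n s * cmod (k s)))"
        using d_nonneg by (simp add: norm_mult)
      fix s :: real
      show "cmod ((g s - \<psi> (U s x)) * k s) \<le> K * (d n s * cmod (k s))"
      proof (cases "s < 0")
        case True then show ?thesis using densD(2)[OF k] by simp
      next
        case False
        then have s: "0 \<le> s" by simp
        have "cmod (g s - \<psi> (U s x)) \<le> K * d n s"
          unfolding g_def d_eq[OF s] sum_J[OF s]
          using K[of "U (p n (nat \<lfloor>s * real (Suc n)\<rfloor>)) x - U s x"] K[of "U s x"]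
          by (simp add: linear_diff[OF dual_linear[OF \<psi>]])
        then show ?thesis by (simp add: norm_mult mult.assoc[symmetric] mult_right_mono)
      qed
    qed
    finally show ?thesis by (simp add: E_def)
  qed
  have "norm (S n - S m) \<le> E n + E m" for n m
  proof (rule norm_le_dualI)
    fix \<psi> assume \<psi>: "\<psi> \<in> dual" and n: "\<And>y. cmod (\<psi> y) \<le> norm y"
    let ?I = "\<integral>s. \<psi> (U s x) * k s \<partial>lborel"
    have "cmod (\<psi> (S n) - ?I) \<le> E n" "cmod (\<psi> (S m) - ?I) \<le> E m"
      using key[OF \<psi>, of 1] n by auto
    then show "cmod (\<psi> (S n - S m)) \<le> E n + E m"
      unfolding linear_diff[OF dual_linear[OF \<psi>]]
      using norm_triangle_ineq4[of "\<psi> (S n) - ?I" "\<psi> (S m) - ?I"] by simp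
  qed
  note S_diff = this
  have "Cauchy S"
  proof (rule metric_CauchyI)
    fix e :: real assume "0 < e"
    then have "\<forall>\<^sub>F n in sequentially. E n < e / 2"
      by (intro order_tendstoD(2)[OF E_lim]) simp
    then obtain N where N: "\<And>n. N \<le> n \<Longrightarrow> E n < e / 2"
      by (auto simp: eventually_sequentially)
    have "dist (S m) (S n) < e" if "N \<le> m" "N \<le> n" for m n
      using S_diff[of m n] N[OF that(1)] N[OF that(2)] by (simp add: dist_norm)
    then show "\<exists>N. \<forall>m\<ge>N. \<forall>n\<ge>N. dist (S m) (S n) < e" by blast
  qed
  then obtain y where y: "S \<longlonglongrightarrow> y" using Cauchy_convergent convergent_def by blast
  have "\<psi> y = (\<integral>s. \<psi> (U s x) * k s \<partial>lborel)" if \<psi>: "\<psi> \<in> dual" for \<psi>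
  proof -
    obtain K where K: "\<And>y. cmod (\<psi> y) \<le> norm y * K"
      using bounded_linear.nonneg_bounded[OF dual_bounded_linear[OF \<psi>]] by blast
    have "(\<lambda>n. \<psi> (S n) - (\<integral>s. \<psi> (U s x) * k s \<partial>lborel)) \<longlonglongrightarrow> 0"
    proof (rule Lim_null_comparison)
      show "(\<lambda>n. K * E n) \<longlonglongrightarrow> 0" using tendsto_mult_right_zero[OF E_lim] .
      show "\<forall>\<^sub>F n in sequentially. cmod (\<psi> (S n) - (\<integral>s. \<psi> (U s x) * k s \<partial>lborel)) \<le> K * E n"
        using key[OF \<psi>, of K] K by (auto simp: mult.commute)
    qed
    then have "(\<lambda>n. \<psi> (S n)) \<longlonglongrightarrow> (\<integral>s. \<psi> (U s x) * k s \<partial>lborel)" by (rule LIM_zero_cancel)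
    moreover have "(\<lambda>n. \<psi> (S n)) \<longlonglongrightarrow> \<psi> y"
      by (rule bounded_linear.tendsto[OF dual_bounded_linear[OF \<psi>] y])
    ultimately show ?thesis by (rule LIMSEQ_unique[symmetric])
  qed
  then show ?thesis by blast
qed

definition Op :: "(real \<Rightarrow> complex) \<Rightarrow> 'a \<Rightarrow> 'a" where
  "Op k x = (SOME y. \<forall>\<psi>\<in>dual. \<psi> y = (\<integral>s. \<psi> (U s x) * k s \<partial>lborel))"

lemma Op_weak: "dens k \<Longrightarrow> \<psi> \<in> dual \<Longrightarrow> \<psi> (Op k x) = (\<integral>s. \<psi> (U s x) * k s \<partial>lborel)"
  unfolding Op_def using someI_ex[OF Op_exists] by blast

lemma Op_eqI:
  assumes "dens k" "\<And>\<psi>. \<psi> \<in> dual \<Longrightarrow> \<psi> y = (\<integral>s. \<psi> (U s x) * k s \<partial>lborel)"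
  shows "Op k x = y"
  by (rule dual_eqI) (simp add: Op_weak assms)

lemma orbit_integrable:
  assumes k: "dens k" and \<psi>: "\<psi> \<in> dual"
  shows "integrable lborel (\<lambda>s. \<psi> (U s x) * k s)"
proof -
  obtain C where C: "\<And>s. cmod (\<psi> (U s x)) \<le> C" using orbit_bounded[OF \<psi>, of x] by blast
  show ?thesis by (rule dens_bounded_integrable(1)[OF k orbit_measurable[OF \<psi>] C])
qed

lemma Op_norm:
  assumes k: "dens k"
  shows "norm (Op k x) \<le> M * l1 k * norm x"
proof (rule norm_le_dualI)
  fix \<psi> assume \<psi>: "\<psi> \<in> dual" and n: "\<And>y. cmod (\<psi> y) \<le> norm y"
  have "cmod (\<integral>s. \<psi> (U s x) * k s \<partial>lborel) \<le> (M * norm x) * l1 k"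
    by (rule dens_bounded_integrable(2)[OF k orbit_measurable[OF \<psi>]]) (rule order.trans[OF n U_norm])
  then show "cmod (\<psi> (Op k x)) \<le> M * l1 k * norm x"
    by (simp add: Op_weak[OF k \<psi>] mult_ac)
qed

lemma Op_cs:
  assumes k: "dens k"
  shows "Op k (cs c x) = cs c (Op k x)"
  by (rule Op_eqI[OF k])
    (simp add: dual_cs Op_weak[OF k] U_cs mult.assoc)

lemma Op_bounded_linear:
  assumes k: "dens k"
  shows "bounded_linear (Op k)"
proof (rule bounded_linear_intro)
  fix x y r
  show "Op k (x + y) = Op k x + Op k y"
  proof (rule Op_eqI[OF k])
    fix \<psi> assume \<psi>: "\<psi> \<in> dual"
    show "\<psi> (Op k x + Op k y) = (\<integral>s. \<psi> (U s (x + y)) * k s \<partial>lborel)"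
      using orbit_integrable[OF k \<psi>, of x] orbit_integrable[OF k \<psi>, of y]
      by (simp add: linear_add[OF dual_linear[OF \<psi>]] Op_weak[OF k \<psi>]
          linear_add[OF bounded_linear.linear[OF U_bounded_linear]] distrib_right)
  qed
  show "Op k (r *\<^sub>R x) = r *\<^sub>R Op k x"
    using Op_cs[OF k, of "of_real r" x] by (simp add: cs_of_real)
  show "norm (Op k x) \<le> norm x * (M * l1 k)"
    using Op_norm[OF k, of x] by (simp add: mult_ac)
qed

lemmas Op_linear = bounded_linear.linear[OF Op_bounded_linear]

lemma Op_add_dens:
  assumes "dens k" "dens l"
  shows "Op (\<lambda>s. k s + l s) x = Op k x + Op l x"
proof (rule Op_eqI[OF dens_add[OF assms]])
  fix \<psi> assume \<psi>: "\<psi> \<in> dual"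
  show "\<psi> (Op k x + Op l x) = (\<integral>s. \<psi> (U s x) * (k s + l s) \<partial>lborel)"
    using orbit_integrable[OF assms(1) \<psi>] orbit_integrable[OF assms(2) \<psi>]
    by (simp add: linear_add[OF dual_linear[OF \<psi>]] Op_weak[OF _ \<psi>] assms distrib_left)
qed

lemma Op_cmult_dens:
  assumes "dens k"
  shows "Op (\<lambda>s. c * k s) x = cs c (Op k x)"
  by (rule Op_eqI[OF dens_cmult[OF assms]])
    (simp add: Op_weak assms dual_cs mult.left_commute)

lemma Op_diff_dens:
  assumes "dens k" "dens l"
  shows "Op (\<lambda>s. k s - l s) x = Op k x - Op l x"
  using Op_add_dens[OF assms(1) dens_cmult[OF assms(2)], of "-1" x]
    Op_cmult_dens[OF assms(2), of "-1" x]
  by (simp add: cs_minus_left cs_1)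

lemma Op_cong_laplace:
  assumes "dens k" "dens l" "\<And>n. 1 \<le> n \<Longrightarrow> laplace k (of_nat n) = laplace l (of_nat n)"
  shows "Op k x = Op l x"
proof (rule Op_eqI[OF assms(1)])
  fix \<psi> assume \<psi>: "\<psi> \<in> dual"
  obtain C where C: "\<And>s. cmod (\<psi> (U s x)) \<le> C" using orbit_bounded[OF \<psi>, of x] by blast
  show "\<psi> (Op l x) = (\<integral>s. \<psi> (U s x) * k s \<partial>lborel)"
    unfolding Op_weak[OF assms(2) \<psi>]
    by (rule laplace_eq_imp_integral_eq[symmetric, OF assms orbit_continuous[OF \<psi>] C])
qed

lemma U_U: "0 \<le> r \<Longrightarrow> 0 \<le> s \<Longrightarrow> U r (U s x) = U (r + s) x"
  by (simp add: U_eq T_add)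

lemma Op_conv_flip:
  assumes k: "dens k" and l: "dens l"
  shows "Op (conv k l) x = Op l (Op k x)"
proof (rule Op_eqI[OF dens_conv[OF k l]])
  fix \<psi> assume \<psi>: "\<psi> \<in> dual"
  obtain C where C: "\<And>s. cmod (\<psi> (U s x)) \<le> C" using orbit_bounded[OF \<psi>, of x] by blast
  have "(\<integral>s. \<psi> (U s x) * conv k l s \<partial>lborel) =
      (\<integral>r. (\<integral>s. \<psi> (U (s + r) x) * k s \<partial>lborel) * l r \<partial>lborel)"
    by (rule conv_fubini(2)[OF densD(1)[OF k] densD(1)[OF l] orbit_measurable[OF \<psi>] C])
  also have "\<dots> = (\<integral>r. \<psi> (U r (Op k x)) * l r \<partial>lborel)"
  proof (rule Bochner_Integration.integral_cong[OF refl])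
    fix r :: real
    show "(\<integral>s. \<psi> (U (s + r) x) * k s \<partial>lborel) * l r = \<psi> (U r (Op k x)) * l r"
    proof (cases "r < 0")
      case True then show ?thesis using densD(2)[OF l] by simp
    next
      case False
      have "\<psi> (U r (Op k x)) = (\<integral>s. \<psi> (U r (U s x)) * k s \<partial>lborel)"
        by (rule Op_weak[OF k dual_compose_U[OF \<psi>]])
      also have "\<dots> = (\<integral>s. \<psi> (U (s + r) x) * k s \<partial>lborel)"
      proof (rule Bochner_Integration.integral_cong[OF refl])
        fix s show "\<psi> (U r (U s x)) * k s = \<psi> (U (s + r) x) * k s"
          using False densD(2)[OF k, of s] by (cases "s < 0") (auto simp: U_U add.commute)
      qed
      finally show ?thesis by simp
    qed
  qed
  also have "\<dots> = \<psi> (Op l (Op k x))" by (rule Op_weak[OF l \<psi>, symmetric])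
  finally show "\<psi> (Op l (Op k x)) = (\<integral>s. \<psi> (U s x) * conv k l s \<partial>lborel)" by simp
qed

text \<open>Fubini yields the factors in reverse order. They commute because \<open>conv k l\<close>
  and \<open>conv l k\<close> have the same transform, so \<open>Op_commute\<close> needs no
  separate computation.\<close>

lemma Op_conv:
  assumes "dens k" "dens l"
  shows "Op (conv k l) x = Op k (Op l x)"
proof -
  have "Op (conv k l) x = Op (conv l k) x"
    by (rule Op_cong_laplace) (simp_all add: dens_conv assms laplace_conv)
  then show ?thesis by (simp add: Op_conv_flip assms)
qed

lemma Op_commute: "dens k \<Longrightarrow> dens l \<Longrightarrow> Op k (Op l x) = Op l (Op k x)"
  by (metis Op_conv Op_conv_flip)

lemma Op_U: 
  assumes k: "dens k"
  shows "Op k (U h x) = U h (Op k x)"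
proof (rule Op_eqI[OF k])
  fix \<psi> assume \<psi>: "\<psi> \<in> dual"
  have "U h (U s x) = U s (U h x)" for s
    unfolding U_def by (metis T_add add.commute max.cobounded1)
  then show "\<psi> (U h (Op k x)) = (\<integral>s. \<psi> (U s (U h x)) * k s \<partial>lborel)"
    using Op_weak[OF k dual_compose_U[OF \<psi>, of h], of x] by simp
qed

lemma Op_shift:
  assumes k: "dens k" and h: "0 \<le> h"
  shows "Op (shift h k) x = U h (Op k x)"
proof (rule Op_eqI[OF dens_shift[OF k h]])
  fix \<psi> assume \<psi>: "\<psi> \<in> dual"
  have "(\<integral>s. \<psi> (U s x) * shift h k s \<partial>lborel) = (\<integral>s. \<psi> (U (s + h) x) * k s \<partial>lborel)"
    using integral_translate[of "\<lambda>s. \<psi> (U (s + h) x) * k s" h] by (simp add: shift_def)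
  also have "\<dots> = (\<integral>s. \<psi> (U h (U s x)) * k s \<partial>lborel)"
  proof (rule Bochner_Integration.integral_cong[OF refl])
    fix s show "\<psi> (U (s + h) x) * k s = \<psi> (U h (U s x)) * k s"
      using h densD(2)[OF k, of s] by (cases "s < 0") (auto simp: U_U add.commute)
  qed
  also have "\<dots> = \<psi> (U h (Op k x))" by (rule Op_weak[OF k dual_compose_U[OF \<psi>], symmetric])
  finally show "\<psi> (U h (Op k x)) = (\<integral>s. \<psi> (U s x) * shift h k s \<partial>lborel)" by simp
qed

end

section \<open>The density of the regularised logarithm\<close>

lemma integral_FTC_at_top:
  fixes f F :: "real \<Rightarrow> 'b::euclidean_space"
  assumes int: "integrable lborel (\<lambda>x. indicator {a..} x *\<^sub>R f x)"
    and F: "\<And>x. a \<le> x \<Longrightarrow> (F has_vector_derivative f x) (at x)"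
    and f: "continuous_on {a..} f" and lim: "(F \<longlongrightarrow> L) at_top"
  shows "(\<integral>x. indicator {a..} x *\<^sub>R f x \<partial>lborel) = L - F a"
proof -
  have "((\<lambda>y. \<integral>x. indicator {..y} x *\<^sub>R (indicator {a..} x *\<^sub>R f x) \<partial>lborel)
      \<longlongrightarrow> (\<integral>x. indicator {a..} x *\<^sub>R f x \<partial>lborel)) at_top"
    by (rule tendsto_integral_at_top[OF _ int]) simp
  moreover have "\<forall>\<^sub>F y in at_top. (\<integral>x. indicator {..y} x *\<^sub>R (indicator {a..} x *\<^sub>R f x) \<partial>lborel) = F y - F a"
    using eventually_ge_at_top[of a]
  proof eventually_elim
    case (elim y)
    have "(\<integral>x. indicator {a..y} x *\<^sub>R f x \<partial>lborel) = F y - F a"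
      by (rule integral_FTC_Icc[OF elim has_vector_derivative_at_within[OF F]])
        (use continuous_on_subset[OF f] in auto)
    moreover have "indicator {..y} x *\<^sub>R (indicator {a..} x *\<^sub>R f x) = indicator {a..y} x *\<^sub>R f x" for x
      by (auto simp: indicator_def)
    ultimately show ?case by (simp only:)
  qed
  ultimately have "((\<lambda>y. F y - F a) \<longlongrightarrow> (\<integral>x. indicator {a..} x *\<^sub>R f x \<partial>lborel)) at_top"
    by (rule Lim_transform_eventually)
  moreover have "((\<lambda>y. F y - F a) \<longlongrightarrow> L - F a) at_top" by (intro tendsto_intros lim)
  ultimately show ?thesis by (rule tendsto_unique[OF trivial_limit_at_top_linorder])
qed

lemma integrable_FTC_at_top:
  fixes f F :: "real \<Rightarrow> real"
  assumes [measurable]: "f \<in> borel_measurable borel"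
    and F: "\<And>x. a \<le> x \<Longrightarrow> DERIV F x :> f x"
    and nonneg: "\<And>x. a \<le> x \<Longrightarrow> 0 \<le> f x"
    and lim: "(F \<longlongrightarrow> L) at_top"
  shows "integrable lborel (\<lambda>x. indicator {a..} x *\<^sub>R f x)"
proof (rule integrableI_nonneg)
  show "AE x in lborel. 0 \<le> indicator {a..} x *\<^sub>R f x"
    using nonneg by (auto simp: indicator_def)
  have "(\<integral>\<^sup>+x. ennreal (indicator {a..} x *\<^sub>R f x) \<partial>lborel) = (\<integral>\<^sup>+x. ennreal (f x) * indicator {a..} x \<partial>lborel)"
    by (intro nn_integral_cong) (auto simp: indicator_def)
  also have "\<dots> = ennreal (L - F a)" by (rule nn_integral_FTC_atLeast) (use assms in auto)
  finally show "(\<integral>\<^sup>+x. ennreal (indicator {a..} x *\<^sub>R f x) \<partial>lborel) < \<infinity>" by simp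
qed auto

section \<open>Exponential densities, the Cesaro density and the square of the resolvent\<close>

definition exp_dens :: "complex \<Rightarrow> real \<Rightarrow> complex" where
  "exp_dens c s = (if 0 \<le> s then exp (- (of_real s * c)) else 0)"

lemma exp_dens_indicator: "exp_dens c = (\<lambda>s. indicator {0..} s *\<^sub>R exp (- (of_real s * c)))"
  by (auto simp: exp_dens_def fun_eq_iff)

lemma exp_dens_measurable [measurable]: "exp_dens c \<in> borel_measurable borel"
  unfolding exp_dens_indicator by measurable

lemma exp_integral_real:
  assumes a: "0 < (a::real)"
  shows "integrable lborel (\<lambda>s. indicator {0..} s *\<^sub>R exp (- (s * a)))"
    and "(\<integral>s. indicator {0..} s *\<^sub>R exp (- (s * a)) \<partial>lborel) = 1 / a"
proof -
  let ?F = "\<lambda>s. - exp (- (s * a)) / a"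
  have F: "DERIV ?F x :> exp (- (x * a))" for x
    using a by (auto intro!: derivative_eq_intros)
  have lim: "(?F \<longlongrightarrow> 0) at_top"
  proof -
    have "filterlim (\<lambda>s. - (s * a)) at_bot at_top"
      using a by (simp add: filterlim_uminus_at_bot filterlim_at_top_mult_tendsto_pos[OF tendsto_const _ filterlim_ident])
    then have "((\<lambda>s. exp (- (s * a))) \<longlongrightarrow> 0) at_top"
      by (rule filterlim_compose[OF exp_at_bot])
    then show ?thesis using tendsto_divide[OF tendsto_minus tendsto_const[of a]] a by fastforce
  qed
  show i: "integrable lborel (\<lambda>s. indicator {0..} s *\<^sub>R exp (- (s * a)))"
    by (rule integrable_FTC_at_top[OF _ F _ lim]) auto
  show "(\<integral>s. indicator {0..} s *\<^sub>R exp (- (s * a)) \<partial>lborel) = 1 / a"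
  proof -
    have "(\<integral>s. indicator {0..} s *\<^sub>R exp (- (s * a)) \<partial>lborel) = 0 - ?F 0"
      by (rule integral_FTC_at_top[OF i _ _ lim])
        (use F in \<open>auto simp: has_real_derivative_iff_has_vector_derivative intro!: continuous_intros\<close>)
    then show ?thesis by simp
  qed
qed

lemma dens_exp_dens:
  assumes "0 < Re c"
  shows "dens (exp_dens c)"
proof -
  have "integrable lborel (exp_dens c)"
  proof (rule Bochner_Integration.integrable_bound[OF exp_integral_real(1)[OF assms]])
    show "AE s in lborel. norm (exp_dens c s) \<le> norm (indicator {0..} s *\<^sub>R exp (- (s * Re c)))"
      by (rule AE_I2) (simp add: exp_dens_def)
  qed simp
  then show ?thesis by (simp add: dens_def exp_dens_def)
qed

lemma integral_exp_dens:
  assumes "0 < Re c"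
  shows "(\<integral>s. exp_dens c s \<partial>lborel) = 1 / c"
proof -
  have c: "c \<noteq> 0" using assms by auto
  let ?F = "\<lambda>s. - exp (- (of_real s * c)) / c"
  have "(\<integral>s. indicator {0..} s *\<^sub>R exp (- (of_real s * c)) \<partial>lborel) = 0 - ?F 0"
  proof (rule integral_FTC_at_top)
    show "integrable lborel (\<lambda>s. indicator {0..} s *\<^sub>R exp (- (of_real s * c)))"
      using densD(1)[OF dens_exp_dens[OF assms]] by (simp add: exp_dens_indicator)
    show "(?F has_vector_derivative exp (- (of_real s * c))) (at s)" for s
      by (rule has_vector_derivative_real_field) (use c in \<open>auto intro!: derivative_eq_intros\<close>)
    show "(?F \<longlongrightarrow> 0) at_top"
    proof (rule tendsto_norm_zero_cancel)
      have "filterlim (\<lambda>s. - (s * Re c)) at_bot at_top"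
        using assms by (simp add: filterlim_uminus_at_bot filterlim_at_top_mult_tendsto_pos[OF tendsto_const _ filterlim_ident])
      then have "((\<lambda>s. exp (- (s * Re c)) / cmod c) \<longlongrightarrow> 0 / cmod c) at_top"
        using c by (intro tendsto_divide filterlim_compose[OF exp_at_bot] tendsto_const) auto
      then show "((\<lambda>s. norm (?F s)) \<longlongrightarrow> 0) at_top" by (simp add: norm_divide)
    qed
  qed (intro continuous_intros)
  then show ?thesis by (simp add: exp_dens_indicator)
qed

lemma laplace_exp_dens:
  assumes "0 < Re (c + z)"
  shows "laplace (exp_dens c) z = 1 / (c + z)"
proof -
  have "laplace (exp_dens c) z = (\<integral>s. exp_dens (c + z) s \<partial>lborel)"
    unfolding laplace_def
    by (intro Bochner_Integration.integral_cong refl) (simp add: exp_dens_def mult_exp_exp algebra_simps)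
  then show ?thesis by (simp add: integral_exp_dens[OF assms])
qed

definition c_dens :: "real \<Rightarrow> real \<Rightarrow> complex" where
  "c_dens t s = (if 0 \<le> s \<and> s \<le> t then of_real (1 / t) else 0)"

lemma c_dens_indicator: "c_dens t = (\<lambda>s. indicator {0..t} s *\<^sub>R of_real (1 / t))"
  by (auto simp: c_dens_def fun_eq_iff)

lemma dens_c_dens: "dens (c_dens t)"
proof -
  have "integrable lborel (c_dens t)"
    unfolding c_dens_indicator by (rule integrable_scaleR_left) (simp add: emeasure_lborel_Icc_eq)
  then show ?thesis by (simp add: dens_def c_dens_def)
qed

lemma laplace_c_dens:
  assumes "0 < t"
  shows "of_real t * z * laplace (c_dens t) z = 1 - exp (- (of_real t * z))"
proof -
  have "(\<integral>s. indicator {0..t} s *\<^sub>R (of_real t * z * exp (- (of_real s * z)) * of_real (1 / t)) \<partial>lborel)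
      = - exp (- (of_real t * z)) - (- exp (- (of_real 0 * z)))"
  proof (rule integral_FTC_Icc)
    show "0 \<le> t" using assms by simp
    show "((\<lambda>s. - exp (- (of_real s * z))) has_vector_derivative
        of_real t * z * exp (- (of_real s * z)) * of_real (1 / t)) (at s within {0..t})" for s
      by (rule has_vector_derivative_real_field) (use assms in \<open>auto intro!: derivative_eq_intros\<close>)
  qed (intro continuous_intros)
  moreover have "indicator {0..t} s *\<^sub>R (of_real t * z * exp (- (of_real s * z)) * of_real (1 / t)) =
      of_real t * z * (exp (- (of_real s * z)) * c_dens t s)" for s
    by (simp add: c_dens_indicator)
  ultimately have "(\<integral>s. of_real t * z * (exp (- (of_real s * z)) * c_dens t s) \<partial>lborel)
      = 1 - exp (- (of_real t * z))" by simp
  then show ?thesis unfolding laplace_def by simp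
qed

definition W_dens :: "real \<Rightarrow> complex" where
  "W_dens s = (if 0 \<le> s then of_real (s * exp (- s)) else 0)"

lemma W_dens_eq_conv: "W_dens = conv (exp_dens 1) (exp_dens 1)"
proof
  fix s :: real
  have "exp_dens 1 (s - r) * exp_dens 1 r = indicator {0..s} r *\<^sub>R of_real (exp (- s))" for r
    by (auto simp: exp_dens_def indicator_def mult_exp_exp exp_of_real[symmetric] algebra_simps)
  then have "conv (exp_dens 1) (exp_dens 1) s = (\<integral>r. indicator {0..s} r *\<^sub>R of_real (exp (- s)) \<partial>lborel)"
    by (simp add: conv_def)
  also have "\<dots> = W_dens s"
    by (subst integral_scaleR_left)
      (auto simp: W_dens_def emeasure_lborel_Icc_eq measure_def scaleR_conv_of_real)
  finally show "W_dens s = conv (exp_dens 1) (exp_dens 1) s" by simp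
qed

lemma dens_W_dens: "dens W_dens"
  unfolding W_dens_eq_conv by (intro dens_conv dens_exp_dens) auto

lemma laplace_exp_dens_1: "0 \<le> Re z \<Longrightarrow> laplace (exp_dens 1) z = 1 / (1 + z)"
  by (rule laplace_exp_dens) simp

lemma laplace_W_dens: "0 \<le> Re z \<Longrightarrow> laplace W_dens z = 1 / (1 + z)\<^sup>2"
  unfolding W_dens_eq_conv
  by (simp add: laplace_conv dens_exp_dens laplace_exp_dens_1 power2_eq_square)

lemma dens_exp_dens_1: "dens (exp_dens 1)" by (rule dens_exp_dens) simp

section \<open>Mixtures of exponentials and the integral representation of the logarithm\<close>

definition exp_mix :: "(real \<Rightarrow> real) \<Rightarrow> real \<Rightarrow> complex" where
  "exp_mix \<rho> s = (\<integral>r. of_real (\<rho> r) * exp_dens (of_real r) s \<partial>lborel)"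

text \<open>For \<open>r > 0\<close> the exponential \<open>exp (- r s)\<close> on the half-line has
  integral \<open>1 / r\<close> and transform \<open>1 / (r + z)\<close>. Integrability of
  \<open>rho r / r\<close> is thus exactly what Fubini requires.\<close>

lemma exp_mix:
  assumes m[measurable]: "\<rho> \<in> borel_measurable borel"
    and pos: "\<And>r. \<rho> r \<noteq> 0 \<Longrightarrow> 0 < r" "\<And>r. 0 \<le> \<rho> r"
    and int: "integrable lborel (\<lambda>r. \<rho> r / r)"
  shows "dens (exp_mix \<rho>)"
    and "0 \<le> Re z \<Longrightarrow> laplace (exp_mix \<rho>) z = (\<integral>r. of_real (\<rho> r) / (of_real r + z) \<partial>lborel)"
proof -
  let ?f = "\<lambda>r s. of_real (\<rho> r) * exp_dens (of_real r) s"
  have [measurable]: "(\<lambda>p. exp_dens (of_real (fst p)) (snd p)) \<in> borel_measurable (lborel \<Otimes>\<^sub>M lborel)"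
    unfolding exp_dens_def by measurable
  have i: "integrable lborel (?f r)" for r
    using densD(1)[OF dens_exp_dens[of "of_real r"]] pos(1)[of r] by (cases "\<rho> r = 0") auto
  have n: "(\<integral>s. norm (?f r s) \<partial>lborel) = \<rho> r / r" for r
  proof (cases "\<rho> r = 0")
    case False
    have "norm (?f r s) = \<rho> r * (indicator {0..} s *\<^sub>R exp (- (s * r)))" for s
      using pos(2)[of r] by (simp add: norm_mult exp_dens_def)
    then show ?thesis using exp_integral_real(2)[OF pos(1)[OF False]] by simp
  qed simp
  have f: "integrable (lborel \<Otimes>\<^sub>M lborel) (case_prod ?f)"
  proof (rule lborel_pair.Fubini_integrable)
    have "(\<lambda>p. of_real (\<rho> (fst p)) * exp_dens (of_real (fst p)) (snd p)) \<in> borel_measurable (lborel \<Otimes>\<^sub>M lborel)"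
      by measurable
    then show "case_prod ?f \<in> borel_measurable (lborel \<Otimes>\<^sub>M lborel)" by (simp add: case_prod_beta')
    show "integrable lborel (\<lambda>r. \<integral>s. norm (case_prod ?f (r, s)) \<partial>lborel)"
      using int by (simp only: case_prod_conv n)
    show "AE r in lborel. integrable lborel (\<lambda>s. case_prod ?f (r, s))"
      using i by simp
  qed
  show d: "dens (exp_mix \<rho>)"
    using lborel_pair.integrable_snd[OF f] by (simp add: dens_def exp_mix_def[abs_def] exp_dens_def)
  assume z: "0 \<le> Re z"
  have g: "integrable (lborel \<Otimes>\<^sub>M lborel) (case_prod (\<lambda>r s. exp (- (of_real (max 0 s) * z)) * ?f r s))"
  proof -
    have "integrable (lborel \<Otimes>\<^sub>M lborel) (\<lambda>p. exp (- (of_real (max 0 (snd p)) * z)) * case_prod ?f p)"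
      by (rule integrable_mult_bounded[OF f, where C = 1]) (measurable, rule AE_I2, rule impI, rule cmod_exp_le_1[OF z], simp)
    then show ?thesis by (simp only: case_prod_beta')
  qed
  have "laplace (exp_mix \<rho>) z = (\<integral>s. (\<integral>r. exp (- (of_real (max 0 s) * z)) * ?f r s \<partial>lborel) \<partial>lborel)"
    unfolding laplace_max[OF d] by (simp add: exp_mix_def)
  also have "\<dots> = (\<integral>r. (\<integral>s. exp (- (of_real (max 0 s) * z)) * ?f r s \<partial>lborel) \<partial>lborel)"
    by (rule lborel_pair.Fubini_integral[OF g])
  also have "\<dots> = (\<integral>r. of_real (\<rho> r) / (of_real r + z) \<partial>lborel)"
  proof (rule Bochner_Integration.integral_cong[OF refl])
    fix r
    show "(\<integral>s. exp (- (of_real (max 0 s) * z)) * ?f r s \<partial>lborel) = of_real (\<rho> r) / (of_real r + z)"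
    proof (cases "\<rho> r = 0")
      case False
      then have r: "0 < r" by (rule pos(1))
      have "(\<integral>s. exp (- (of_real (max 0 s) * z)) * ?f r s \<partial>lborel) =
          (\<integral>s. of_real (\<rho> r) * (exp (- (of_real (max 0 s) * z)) * exp_dens (of_real r) s) \<partial>lborel)"
        by (simp only: mult.left_commute)
      also have "\<dots> = of_real (\<rho> r) * laplace (exp_dens (of_real r)) z"
        using r by (subst laplace_max[OF dens_exp_dens]) auto
      finally show ?thesis using r z by (simp add: laplace_exp_dens)
    qed simp
  qed
  finally show "laplace (exp_mix \<rho>) z = (\<integral>r. of_real (\<rho> r) / (of_real r + z) \<partial>lborel)" .
qed

text \<open>These are the weights of \<open>1 / (r + z)\<close> in the formula for the logarithm. On
  \<open>[0, 1]\<close> the additional factor \<open>r\<close> comes from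
  \<open>z / (r + z) = 1 - r / (r + z)\<close>, where \<open>z\<close> is borrowed from
  \<open>reg_e\<close>; it makes \<open>rho_a r / r\<close> bounded.\<close>

definition rho_a :: "real \<Rightarrow> real" where "rho_a r = indicator {0..1} r * (r / (1 + r))"
definition rho_b :: "real \<Rightarrow> real" where "rho_b r = indicator {1..} r / (1 + r)"

lemma rho_a: "rho_a \<in> borel_measurable borel" "rho_a r \<noteq> 0 \<Longrightarrow> 0 < r" "0 \<le> rho_a r"
    "integrable lborel (\<lambda>r. rho_a r / r)"
proof -
  show [measurable]: "rho_a \<in> borel_measurable borel" unfolding rho_a_def by measurable
  show "rho_a r \<noteq> 0 \<Longrightarrow> 0 < r" "0 \<le> rho_a r"
    by (auto simp: rho_a_def indicator_def split: if_splits)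
  show "integrable lborel (\<lambda>r. rho_a r / r)"
  proof (rule Bochner_Integration.integrable_bound)
    show "integrable lborel (indicator {0..1::real} :: real \<Rightarrow> real)" by (simp add: emeasure_lborel_Icc_eq)
    show "AE r in lborel. norm (rho_a r / r) \<le> norm (indicator {0..1} r :: real)"
      by (rule AE_I2) (auto simp: rho_a_def indicator_def)
  qed simp
qed

lemma rho_b: "rho_b \<in> borel_measurable borel" "rho_b r \<noteq> 0 \<Longrightarrow> 0 < r" "0 \<le> rho_b r"
    "integrable lborel (\<lambda>r. rho_b r / r)"
proof -
  show [measurable]: "rho_b \<in> borel_measurable borel" unfolding rho_b_def by measurable
  show "rho_b r \<noteq> 0 \<Longrightarrow> 0 < r" "0 \<le> rho_b r"
    by (auto simp: rho_b_def indicator_def split: if_splits)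
  have "integrable lborel (\<lambda>r. indicator {1..} r *\<^sub>R (1 / r\<^sup>2 :: real))"
  proof (rule integrable_FTC_at_top)
    show "DERIV (\<lambda>r. - inverse r) x :> 1 / x\<^sup>2" if "1 \<le> x" for x :: real
      using that by (auto intro!: derivative_eq_intros simp: power2_eq_square field_simps)
    show "((\<lambda>r. - inverse r :: real) \<longlongrightarrow> 0) at_top"
      using tendsto_minus[OF tendsto_inverse_0_at_top[OF filterlim_ident]] by simp
  qed auto
  then show "integrable lborel (\<lambda>r. rho_b r / r)"
  proof (rule Bochner_Integration.integrable_bound)
    show "AE r in lborel. norm (rho_b r / r) \<le> norm (indicator {1..} r *\<^sub>R (1 / r\<^sup>2 :: real))"
    proof (rule AE_I2)
      fix r :: real
      have "1 / ((1 + r) * r) \<le> 1 / (r * r)" if "1 \<le> r"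
        using that by (intro frac_le mult_right_mono) auto
      then show "norm (rho_b r / r) \<le> norm (indicator {1..} r *\<^sub>R (1 / r\<^sup>2 :: real))"
        by (auto simp: rho_b_def indicator_def power2_eq_square)
    qed
  qed simp
qed

lemma Ln_shift_derivative:
  assumes z: "0 \<le> Re z" "z \<noteq> 0" and r: "0 \<le> r"
  shows "((\<lambda>r. Ln (of_real r + z)) has_vector_derivative 1 / (of_real r + z)) (at r within S)"
    and "of_real r + z \<noteq> 0"
proof -
  have n: "of_real r + z \<notin> \<real>\<^sub>\<le>\<^sub>0"
  proof
    assume "of_real r + z \<in> \<real>\<^sub>\<le>\<^sub>0"
    then have "r + Re z \<le> 0" "Im z = 0" by (auto simp: complex_nonpos_Reals_iff)
    then show False using z r by (auto simp: complex_eq_iff)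
  qed
  then show "of_real r + z \<noteq> 0" by auto
  have "(Ln has_field_derivative inverse (of_real r + z)) (at (of_real r + z))"
    by (rule has_field_derivative_Ln[OF n])
  moreover have "((\<lambda>r. of_real r + z) has_vector_derivative 1) (at r within S)"
    by (auto intro!: derivative_eq_intros)
  ultimately have "(Ln \<circ> (\<lambda>r. of_real r + z) has_vector_derivative 1 * inverse (of_real r + z)) (at r within S)"
    by (intro field_vector_diff_chain_within) (auto intro: has_field_derivative_at_within)
  then show "((\<lambda>r. Ln (of_real r + z)) has_vector_derivative 1 / (of_real r + z)) (at r within S)"
    by (simp add: o_def inverse_eq_divide)
qed

text \<open>The factor \<open>z - 1\<close> is the numerator left by partial fractions. Keeping it
  on the left avoids a case distinction at \<open>z = 1\<close>.\<close>

lemma laplace_exp_mix_a: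
  assumes z: "0 \<le> Re z" "z \<noteq> 0"
  shows "(z - 1) * laplace (exp_mix rho_a) z = z * (Ln (1 + z) - Ln z) - Ln 2"
proof -
  have eq: "indicator {0..1} r *\<^sub>R (z * (1 / (of_real r + z)) - 1 / (of_real r + 1)) =
      (z - 1) * (of_real (rho_a r) / (of_real r + z))" for r
  proof (cases "r \<in> {0..1}")
    case True
    then have "of_real r + z \<noteq> 0" "1 + of_real r \<noteq> (0::complex)" "of_real r + 1 \<noteq> (0::complex)"
      using Ln_shift_derivative(2)[OF z, of r] Ln_shift_derivative(2)[of 1 r] by (auto simp: add.commute)
    then have "z * (1 / (of_real r + z)) - 1 / (of_real r + 1) = (z - 1) * (of_real r / (1 + of_real r) / (of_real r + z))"
      by (simp add: divide_simps) (simp add: algebra_simps)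
    then show ?thesis using True by (simp add: rho_a_def)
  qed (simp add: rho_a_def)
  have "(z - 1) * laplace (exp_mix rho_a) z =
      (\<integral>r. indicator {0..1} r *\<^sub>R (z * (1 / (of_real r + z)) - 1 / (of_real r + 1)) \<partial>lborel)"
  proof -
    have "laplace (exp_mix rho_a) z = (\<integral>r. of_real (rho_a r) / (of_real r + z) \<partial>lborel)"
      by (rule exp_mix(2)[OF rho_a z(1)])
    then show ?thesis unfolding eq by (simp only: integral_mult_right_zero)
  qed
  also have "\<dots> = (z * Ln (of_real 1 + z) - Ln (of_real 1 + 1)) - (z * Ln (of_real 0 + z) - Ln (of_real 0 + 1))"
  proof (rule integral_FTC_Icc)
    show "((\<lambda>r. z * Ln (of_real r + z) - Ln (of_real r + 1)) has_vector_derivative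
        (z * (1 / (of_real r + z)) - 1 / (of_real r + 1))) (at r within {0..1})" if "0 \<le> r" for r
      by (intro has_vector_derivative_diff has_vector_derivative_mult_right Ln_shift_derivative)
        (use z that in auto)
    show "continuous_on {0..1} (\<lambda>r. z * (1 / (of_real r + z)) - 1 / (of_real r + 1))"
      using Ln_shift_derivative(2)[OF z] Ln_shift_derivative(2)[of 1]
      by (intro continuous_intros) auto
  qed simp
  finally show ?thesis by (simp add: algebra_simps)
qed

lemma laplace_exp_mix_b:
  assumes z: "0 \<le> Re z" "z \<noteq> 0"
  shows "(z - 1) * laplace (exp_mix rho_b) z = Ln (1 + z) - Ln 2"
proof -
  have eq: "indicator {1..} r *\<^sub>R (1 / (of_real r + 1) - 1 / (of_real r + z)) =
      (z - 1) * (of_real (rho_b r) / (of_real r + z))" for r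
  proof (cases "r \<in> {1..}")
    case True
    then have "of_real r + z \<noteq> 0" "1 + of_real r \<noteq> (0::complex)" "of_real r + 1 \<noteq> (0::complex)"
      using Ln_shift_derivative(2)[OF z, of r] Ln_shift_derivative(2)[of 1 r] by (auto simp: add.commute)
    then have "1 / (of_real r + 1) - 1 / (of_real r + z) = (z - 1) * (1 / (1 + of_real r) / (of_real r + z))"
      by (simp add: divide_simps)
    then show ?thesis using True by (simp add: rho_b_def)
  qed (simp add: rho_b_def)
  \<comment> \<open>Each of the two logarithms in the antiderivative differs from
    \<open>ln r\<close> by a null function, so the antiderivative tends to 0 although its parts
    diverge.\<close>
  have lim: "((\<lambda>r. Ln (of_real r + w) - of_real (ln r)) \<longlongrightarrow> 0) at_top" if w: "0 \<le> Re w" "w \<noteq> 0" for w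
  proof -
    have "((\<lambda>r. 1 + w * of_real (inverse r)) \<longlongrightarrow> 1 + w * of_real 0) at_top"
      by (intro tendsto_add tendsto_mult tendsto_const tendsto_of_real tendsto_inverse_0_at_top filterlim_ident)
    then have "((\<lambda>r. Ln (1 + w / of_real r)) \<longlongrightarrow> Ln 1) at_top"
      by (intro tendsto_Ln) (simp_all add: divide_inverse)
    moreover have "\<forall>\<^sub>F r in at_top. Ln (1 + w / of_real r) = Ln (of_real r + w) - of_real (ln r)"
      using eventually_gt_at_top[of 0]
    proof eventually_elim
      case (elim r)
      have "of_real r + w \<noteq> 0" using Ln_shift_derivative(2)[OF w, of r] elim by simp
      then have "1 + w / of_real r \<noteq> 0" using elim by (simp add: field_simps)
      then have "Ln (of_real r * (1 + w / of_real r)) = of_real (ln r) + Ln (1 + w / of_real r)"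
        using elim by (simp add: Ln_times_of_real Ln_of_real)
      then show ?case using elim by (simp add: distrib_left)
    qed
    ultimately show ?thesis by (auto dest: Lim_transform_eventually)
  qed
  have int: "integrable lborel (\<lambda>r. of_real (rho_b r) / (of_real r + z))"
  proof (rule Bochner_Integration.integrable_bound[OF rho_b(4)])
    have [measurable]: "rho_b \<in> borel_measurable borel" by (rule rho_b)
    show "(\<lambda>r. of_real (rho_b r) / (of_real r + z)) \<in> borel_measurable lborel" by measurable
    show "AE r in lborel. norm (complex_of_real (rho_b r) / (of_real r + z)) \<le> norm (rho_b r / r)"
    proof (rule AE_I2)
      fix r show "norm (complex_of_real (rho_b r) / (of_real r + z)) \<le> norm (rho_b r / r)"
      proof (cases "rho_b r = 0")
        case False
        then have "0 < r" by (rule rho_b)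
        moreover have "r \<le> cmod (of_real r + z)"
          using complex_Re_le_cmod[of "of_real r + z"] z by simp
        ultimately show ?thesis
          using rho_b(3)[of r] by (simp add: norm_divide frac_le)
      qed simp
    qed
  qed
  have "(\<integral>r. indicator {1..} r *\<^sub>R (1 / (of_real r + 1) - 1 / (of_real r + z)) \<partial>lborel)
      = 0 - (Ln (of_real 1 + 1) - Ln (of_real 1 + z))"
  proof (rule integral_FTC_at_top)
    show "((\<lambda>r. Ln (of_real r + 1) - Ln (of_real r + z)) has_vector_derivative
        (1 / (of_real r + 1) - 1 / (of_real r + z))) (at r)" if "1 \<le> r" for r
      by (intro has_vector_derivative_diff Ln_shift_derivative) (use z that in auto)
    show "continuous_on {1..} (\<lambda>r. 1 / (of_real r + 1) - 1 / (of_real r + z))"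
      using Ln_shift_derivative(2)[OF z] Ln_shift_derivative(2)[of 1]
      by (intro continuous_intros) auto
    show "((\<lambda>r. Ln (of_real r + 1) - Ln (of_real r + z)) \<longlongrightarrow> 0) at_top"
      using tendsto_diff[OF lim[of 1] lim[OF z]] by simp
    show "integrable lborel (\<lambda>r. indicator {1..} r *\<^sub>R (1 / (of_real r + 1) - 1 / (of_real r + z)))"
      unfolding eq using int by (rule integrable_mult_right)
  qed
  then show ?thesis
  proof -
    assume I: "(\<integral>r. indicator {1..} r *\<^sub>R (1 / (of_real r + 1) - 1 / (of_real r + z)) \<partial>lborel)
      = 0 - (Ln (of_real 1 + 1) - Ln (of_real 1 + z))"
    have "laplace (exp_mix rho_b) z = (\<integral>r. of_real (rho_b r) / (of_real r + z) \<partial>lborel)"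
      by (rule exp_mix(2)[OF rho_b z(1)])
    then have "(z - 1) * laplace (exp_mix rho_b) z = 0 - (Ln (of_real 1 + 1) - Ln (of_real 1 + z))"
      unfolding I[symmetric] eq by (simp only: integral_mult_right_zero)
    then show ?thesis by simp
  qed
qed

text \<open>
  From \<open>log z = \<integral>\<^sub>0\<^sup>\<infinity> (z - 1) / ((1 + r) (r + z)) dr\<close>, split at \<open>r = 1\<close>: the factor \<open>z / (1 + z)\<^sup>2\<close> of
  \<open>e\<close> makes the half near \<open>0\<close> integrable, and the half near \<open>\<infinity>\<close> already is.
\<close>
definition elog_dens :: "real \<Rightarrow> complex" where
  "elog_dens = (\<lambda>s. (Ln 2 * (exp_dens 1 s - 2 * W_dens s) - conv (\<lambda>s. exp_dens 1 s - 2 * W_dens s) (exp_mix rho_a) s)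
    + (exp_mix rho_b s - conv (\<lambda>s. 3 * exp_dens 1 s - 2 * W_dens s) (exp_mix rho_b) s))"

lemma dens_elog_dens: "dens elog_dens"
  unfolding elog_dens_def
  by (intro dens_add dens_diff dens_cmult dens_conv dens_exp_dens_1 dens_W_dens
      exp_mix(1)[OF rho_a] exp_mix(1)[OF rho_b])

text \<open>The multipliers are \<open>(z - 1) / (1 + z)^2 = 1 / (1 + z) - 2 / (1 + z)^2\<close> and
  \<open>z (z - 1) / (1 + z)^2 = 1 - (3 / (1 + z) - 2 / (1 + z)^2)\<close>. The constant 1 in the
  second is a Dirac mass, so \<open>exp_mix rho_b\<close> also appears without convolution.\<close>

lemma laplace_elog_dens:
  assumes z: "0 \<le> Re z" "z \<noteq> 0"
  shows "laplace elog_dens z = reg_e z * Ln z"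
proof -
  have nz: "1 + z \<noteq> 0" using z(1) by (auto simp: complex_eq_iff)
  let ?a = "laplace (exp_mix rho_a) z" and ?b = "laplace (exp_mix rho_b) z"
  have a: "(z - 1) * ?a = z * (Ln (1 + z) - Ln z) - Ln 2" by (rule laplace_exp_mix_a[OF z])
  have b: "(z - 1) * ?b = Ln (1 + z) - Ln 2" by (rule laplace_exp_mix_b[OF z])
  have d: "dens (exp_mix rho_a)" "dens (exp_mix rho_b)" using exp_mix(1)[OF rho_a] exp_mix(1)[OF rho_b] by auto
  have m: "laplace (\<lambda>s. exp_dens 1 s - 2 * W_dens s) z = (z - 1) / (1 + z)\<^sup>2"
  proof -
    have "laplace (\<lambda>s. exp_dens 1 s - 2 * W_dens s) z = 1 / (1 + z) - 2 / (1 + z)\<^sup>2"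
      by (simp add: laplace_diff dens_exp_dens_1 dens_cmult dens_W_dens z laplace_cmult laplace_exp_dens_1 laplace_W_dens)
    moreover have w: "1 / w - 2 / w\<^sup>2 = (w - 1 - 1) / w\<^sup>2" if "w \<noteq> 0" for w :: complex
      using that by (simp add: field_simps power2_eq_square)
    ultimately show ?thesis using w[OF nz] by simp
  qed
  have n: "1 - laplace (\<lambda>s. 3 * exp_dens 1 s - 2 * W_dens s) z = z * (z - 1) / (1 + z)\<^sup>2"
  proof -
    have "laplace (\<lambda>s. 3 * exp_dens 1 s - 2 * W_dens s) z = 3 / (1 + z) - 2 / (1 + z)\<^sup>2"
      by (simp add: laplace_diff dens_exp_dens_1 dens_cmult dens_W_dens z laplace_cmult laplace_exp_dens_1 laplace_W_dens)
    moreover have w: "1 - (3 / w - 2 / w\<^sup>2) = (w - 1) * (w - 1 - 1) / w\<^sup>2" if "w \<noteq> 0" for w :: complex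
      using that by (simp add: field_simps power2_eq_square)
    ultimately show ?thesis using w[OF nz] by simp
  qed
  have "laplace elog_dens z = laplace (\<lambda>s. exp_dens 1 s - 2 * W_dens s) z * (Ln 2 - ?a)
      + (1 - laplace (\<lambda>s. 3 * exp_dens 1 s - 2 * W_dens s) z) * ?b"
    unfolding elog_dens_def
    by (simp add: laplace_add laplace_diff laplace_conv laplace_cmult dens_add dens_diff dens_cmult dens_conv
        dens_exp_dens_1 dens_W_dens d z) (simp add: algebra_simps)
  also have "\<dots> = ((z - 1) * Ln 2 - (z - 1) * ?a + z * ((z - 1) * ?b)) / (1 + z)\<^sup>2"
    unfolding m n by (simp add: add_divide_distrib diff_divide_distrib algebra_simps)
  also have "\<dots> = reg_e z * Ln z"
    unfolding a b by (simp add: reg_e_def algebra_simps)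
  finally show ?thesis .
qed

section \<open>The densities inverting the logarithm\<close>

lemma powr_laplace:
  fixes z \<alpha> :: real
  assumes z: "0 < z" and \<alpha>: "\<alpha> < 1"
  shows "has_bochner_integral lborel (\<lambda>s. indicator {0<..} s * (exp (- (s * z)) * s powr (- \<alpha>)))
    (Gamma (1 - \<alpha>) * z powr (\<alpha> - 1))"
proof -
  let ?f = "\<lambda>t::real. indicat_real {0..} t * t powr (1 - \<alpha> - 1) / exp t"
  have "has_bochner_integral lborel ?f (Gamma (1 - \<alpha>))"
    by (rule has_bochner_integral_nn_integral)
      (use Gamma_conv_nn_integral_real[of "1 - \<alpha>"] \<alpha> in \<open>auto intro!: less_imp_le Gamma_real_pos simp: indicator_def\<close>)
  then have "has_bochner_integral lborel (\<lambda>s. ?f (0 + z * s)) (Gamma (1 - \<alpha>) /\<^sub>R \<bar>z\<bar>)"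
    by (subst (asm) lborel_has_bochner_integral_real_affine_iff[where c = z and t = 0]) (use z in auto)
  then have "has_bochner_integral lborel (\<lambda>s. z powr \<alpha> * ?f (0 + z * s)) (z powr \<alpha> * (Gamma (1 - \<alpha>) /\<^sub>R \<bar>z\<bar>))"
    by (rule has_bochner_integral_mult_right)
  note hb = this
  have e1: "z powr \<alpha> * (Gamma (1 - \<alpha>) /\<^sub>R \<bar>z\<bar>) = Gamma (1 - \<alpha>) * z powr (\<alpha> - 1)"
    using z by (simp add: powr_diff field_simps)
  have e2: "z powr \<alpha> * ?f (0 + z * s) = indicator {0<..} s * (exp (- (s * z)) * s powr (- \<alpha>))" for s
  proof (cases "0 < s")
    case True
    then show ?thesis using z
      by (simp add: powr_mult powr_minus exp_minus field_simps indicator_def)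
  next
    case False
    then show ?thesis using z by (cases "s = 0") (auto simp: indicator_def zero_le_mult_iff)
  qed
  show ?thesis using hb unfolding e1 e2 .
qed

text \<open>The density whose Laplace transform is \<open>\<integral>\<^sub>0\<^sup>1 z\<^sup>\<alpha>\<^sup>-\<^sup>1 d\<alpha> = (z - 1) / (z log z)\<close>.\<close>
definition G_dens :: "real \<Rightarrow> real" where
  "G_dens s = (\<integral>\<alpha>. indicator {0..1} \<alpha> * (indicator {0<..} s * (s powr (- \<alpha>) * rGamma (1 - \<alpha>))) \<partial>lborel)"

definition G_laplace :: "real \<Rightarrow> real" where
  "G_laplace z = (\<integral>s. exp (- (s * z)) * G_dens s \<partial>lborel)"

lemma rGamma_real_measurable [measurable]: "(rGamma :: real \<Rightarrow> real) \<in> borel_measurable borel"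
  by (rule borel_measurable_continuous_onI[OF continuous_on_rGamma])

lemma rGamma_real_nonneg: "0 \<le> x \<Longrightarrow> 0 \<le> rGamma (x :: real)"
  by (cases "x = 0") (auto simp: rGamma_inverse_Gamma intro!: less_imp_le[OF Gamma_real_pos])

lemma G_dens_nonpos: "s \<le> 0 \<Longrightarrow> G_dens s = 0"
  by (simp add: G_dens_def)

lemma G_dens_nonneg: "0 \<le> G_dens s"
  unfolding G_dens_def
  by (rule integral_nonneg_AE) (auto simp: indicator_def intro!: mult_nonneg_nonneg rGamma_real_nonneg)

text \<open>Since \<open>rGamma\<close> is entire, the integrand is continuous up to
  \<open>1\<close>, where it vanishes, while \<open>Gamma (1 - \<alpha>)\<close> has a pole
  there.\<close>

lemma G_dens_integrable:
  "integrable lborel (\<lambda>\<alpha>. indicator {0..1} \<alpha> * (indicator {0<..} s * (s powr (- \<alpha>) * rGamma (1 - \<alpha>))) :: real)"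
proof (cases "0 < s")
  case True
  have "continuous_on {0..1} (\<lambda>\<alpha>. s powr (- \<alpha>) * rGamma (1 - \<alpha>) :: real)"
    using True by (intro continuous_intros continuous_on_compose2[OF continuous_on_rGamma[of UNIV]]) auto
  from borel_integrable_compact[OF _ this] show ?thesis
    using True by (simp add: indicator_scaleR_eq_if indicator_def if_distrib cong: if_cong)
qed simp

lemma G_dens_antimono:
  assumes "0 < s" "s \<le> t"
  shows "G_dens t \<le> G_dens s"
  unfolding G_dens_def
proof (rule integral_mono[OF G_dens_integrable G_dens_integrable])
  fix \<alpha> :: real
  show "indicator {0..1} \<alpha> * (indicator {0<..} t * (t powr (- \<alpha>) * rGamma (1 - \<alpha>)))
      \<le> indicator {0..1} \<alpha> * (indicator {0<..} s * (s powr (- \<alpha>) * rGamma (1 - \<alpha>)))"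
    using assms
    by (auto simp: indicator_def intro!: mult_right_mono powr_mono2' rGamma_real_nonneg)
qed

lemma G_dens_measurable [measurable]: "G_dens \<in> borel_measurable borel"
proof -
  have "G_dens \<in> borel_measurable lborel"
    unfolding G_dens_def[abs_def] by measurable
  then show ?thesis by simp
qed

lemma powr_integral:
  assumes z: "0 < (z::real)"
  shows "integrable lborel (\<lambda>\<alpha>. indicator {0..1} \<alpha> * z powr (\<alpha> - 1))"
    and "(\<integral>\<alpha>. indicator {0..1} \<alpha> * z powr (\<alpha> - 1) \<partial>lborel) * ln z = 1 - 1 / z"
proof -
  have c: "continuous_on {0..1} (\<lambda>\<alpha>. z powr (\<alpha> - 1))"
    using z by (intro continuous_intros) auto
  from borel_integrable_compact[OF _ c]
  show "integrable lborel (\<lambda>\<alpha>. indicator {0..1} \<alpha> * z powr (\<alpha> - 1))"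
    by (simp add: indicator_scaleR_eq_if indicator_def if_distrib cong: if_cong)
  have "(\<integral>\<alpha>. indicator {0..1} \<alpha> *\<^sub>R (z powr (\<alpha> - 1) * ln z) \<partial>lborel) = z powr (1 - 1) - z powr (0 - 1)"
  proof (rule integral_FTC_Icc)
    show "((\<lambda>\<alpha>. z powr (\<alpha> - 1)) has_vector_derivative z powr (\<alpha> - 1) * ln z) (at \<alpha> within {0..1})" for \<alpha>
      unfolding has_real_derivative_iff_has_vector_derivative[symmetric]
      using z by (auto simp: powr_def intro!: derivative_eq_intros)
  qed (use c in \<open>auto intro!: continuous_intros\<close>)
  then have "(\<integral>\<alpha>. (indicator {0..1} \<alpha> * z powr (\<alpha> - 1)) * ln z \<partial>lborel) = 1 - 1 / z"
    using z by (simp add: mult.assoc powr_minus inverse_eq_divide)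
  then show "(\<integral>\<alpha>. indicator {0..1} \<alpha> * z powr (\<alpha> - 1) \<partial>lborel) * ln z = 1 - 1 / z" by simp
qed

lemma G_dens_laplace:
  assumes z: "0 < z"
  shows "integrable lborel (\<lambda>s. exp (- (s * z)) * G_dens s)" and "G_laplace z * ln z = 1 - 1 / z"
proof -
  let ?f = "\<lambda>\<alpha> s. indicator {0..1} \<alpha> * (rGamma (1 - \<alpha>) * (indicator {0<..} s * (exp (- (s * z)) * s powr (- \<alpha>)))) :: real"
  \<comment> \<open>The value at \<open>1\<close> is set to 0 because \<open>rGamma 0 = 0\<close>
    annihilates the integrand there. This changes \<open>z powr (\<alpha> - 1)\<close> only on a
    null set.\<close>
  define h where "h \<alpha> = (if \<alpha> = 1 then 0 else indicator {0..1} \<alpha> * z powr (\<alpha> - 1))" for \<alpha>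
  have [measurable]: "h \<in> borel_measurable borel" unfolding h_def by measurable
  have nn: "0 \<le> ?f \<alpha> s" for \<alpha> s
    by (auto simp: indicator_def intro!: mult_nonneg_nonneg rGamma_real_nonneg)
  have inner: "has_bochner_integral lborel (?f \<alpha>) (h \<alpha>)" for \<alpha>
  proof (cases "\<alpha> \<in> {0..<1}")
    case True
    then have "has_bochner_integral lborel (?f \<alpha>)
        (indicator {0..1} \<alpha> * (rGamma (1 - \<alpha>) * (Gamma (1 - \<alpha>) * z powr (\<alpha> - 1))))"
      by (intro has_bochner_integral_mult_right powr_laplace z) auto
    moreover have "rGamma (1 - \<alpha>) * (Gamma (1 - \<alpha>) * z powr (\<alpha> - 1)) = z powr (\<alpha> - 1)"
    proof -
      have "0 < Gamma (1 - \<alpha>)" using True by (intro Gamma_real_pos) auto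
      then have "Gamma (1 - \<alpha>) \<noteq> 0" by linarith
      then show ?thesis by (simp add: rGamma_inverse_Gamma)
    qed
    ultimately show ?thesis using True by (simp add: h_def)
  next
    case False
    then have "?f \<alpha> = (\<lambda>s. 0)" "h \<alpha> = 0" by (auto simp: h_def indicator_def)
    then show ?thesis by (simp add: has_bochner_integral_iff)
  qed
  have ae: "AE \<alpha> in lborel. indicator {0..1} \<alpha> * z powr (\<alpha> - 1) = h \<alpha>"
    using AE_lborel_singleton[of "1::real"] by eventually_elim (simp add: h_def)
  have h: "integrable lborel h"
    by (rule integrable_cong_AE_imp[OF powr_integral(1)[OF z] _ ae]) simp
  have f: "integrable (lborel \<Otimes>\<^sub>M lborel) (case_prod ?f)"
  proof (rule lborel_pair.Fubini_integrable)
    show "case_prod ?f \<in> borel_measurable (lborel \<Otimes>\<^sub>M lborel)" by measurable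
    have "(\<integral>s. norm (?f \<alpha> s) \<partial>lborel) = h \<alpha>" for \<alpha>
      using inner[of \<alpha>] nn[of \<alpha>] by (simp add: has_bochner_integral_iff del: mult_eq_0_iff abs_mult)
    then show "integrable lborel (\<lambda>\<alpha>. \<integral>s. norm (case_prod ?f (\<alpha>, s)) \<partial>lborel)"
      using h by (simp only: case_prod_conv)
    show "AE \<alpha> in lborel. integrable lborel (\<lambda>s. case_prod ?f (\<alpha>, s))"
      using inner by (simp add: has_bochner_integral_iff)
  qed
  have eq: "(\<integral>\<alpha>. ?f \<alpha> s \<partial>lborel) = exp (- (s * z)) * G_dens s" for s
  proof -
    have "(\<integral>\<alpha>. ?f \<alpha> s \<partial>lborel) = (\<integral>\<alpha>. exp (- (s * z)) *
        (indicator {0..1} \<alpha> * (indicator {0<..} s * (s powr (- \<alpha>) * rGamma (1 - \<alpha>)))) \<partial>lborel)"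
      by (simp only: mult_ac)
    then show ?thesis unfolding G_dens_def by (simp only: integral_mult_right_zero)
  qed
  show "integrable lborel (\<lambda>s. exp (- (s * z)) * G_dens s)"
    using lborel_pair.integrable_snd[OF f] by (simp only: eq)
  have "G_laplace z = (\<integral>s. (\<integral>\<alpha>. ?f \<alpha> s \<partial>lborel) \<partial>lborel)" by (simp only: G_laplace_def eq)
  also have "\<dots> = (\<integral>\<alpha>. (\<integral>s. ?f \<alpha> s \<partial>lborel) \<partial>lborel)" by (rule lborel_pair.Fubini_integral[OF f])
  also have "\<dots> = (\<integral>\<alpha>. h \<alpha> \<partial>lborel)"
    using inner by (intro Bochner_Integration.integral_cong refl) (simp add: has_bochner_integral_iff)
  also have "\<dots> = (\<integral>\<alpha>. indicator {0..1} \<alpha> * z powr (\<alpha> - 1) \<partial>lborel)"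
    using ae by (intro integral_cong_AE) auto
  finally show "G_laplace z * ln z = 1 - 1 / z" using powr_integral(2)[OF z] by simp
qed

lemma G_laplace_nonneg: "0 \<le> G_laplace z"
  unfolding G_laplace_def by (rule integral_nonneg_AE) (auto simp: G_dens_nonneg)

section \<open>The difference densities and their norms\<close>

definition P_dens :: "real \<Rightarrow> real \<Rightarrow> complex" where
  "P_dens t s = of_real ((G_dens s - G_dens (s - t)) / t)"

text \<open>By monotonicity the absolute value is \<open>G(s - t) - G(s)\<close>, corrected by
  \<open>2 G(s)\<close> for \<open>s <= t\<close>. The first part would integrate to 0 if
  \<open>G\<close> were integrable. As it is not, everything is damped by
  \<open>exp (- s z)\<close>, which makes the integral of the first part at most 0, and
  \<open>z\<close> is sent to 0.\<close>

lemma G_dens_diff_integrable: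
  assumes t: "0 < t"
  shows "integrable lborel (\<lambda>s. G_dens s - G_dens (s - t))"
    and "(\<integral>s. \<bar>G_dens s - G_dens (s - t)\<bar> \<partial>lborel) \<le> 2 * exp 1 * G_laplace (1 / t)"
proof -
  define d where "d s = \<bar>G_dens s - G_dens (s - t)\<bar>" for s
  define B where "B = 2 * exp 1 * G_laplace (1 / t)"
  have [measurable]: "d \<in> borel_measurable borel" unfolding d_def by measurable
  have d_eq: "d s = G_dens (s - t) - G_dens s + 2 * (indicator {..t} s * G_dens s)" for s
  proof (cases "s \<le> t")
    case True
    then show ?thesis using G_dens_nonneg[of s] by (simp add: d_def G_dens_nonpos)
  next
    case False
    then show ?thesis using G_dens_antimono[of "s - t" s] t by (simp add: d_def)
  qed
  \<comment> \<open>On \<open>(0, t]\<close> the weight \<open>exp (- s / t)\<close> is at least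
    \<open>1 / e\<close>, so the integral of \<open>G\<close> up to \<open>t\<close> is at most
    \<open>e\<close> times the transform at \<open>1 / t\<close>.\<close>
  have le: "indicator {..t} s * (exp (- (s * z)) * G_dens s) \<le> exp 1 * (exp (- (s * (1 / t))) * G_dens s)"
    if z: "0 < z" for s z
  proof (cases "0 < s \<and> s \<le> t")
    case True
    have "exp (- (s * z)) \<le> exp 1 * exp (- (s * (1 / t)))"
    proof -
      have "0 \<le> s * z" "s * (1 / t) \<le> 1" using True t z by auto
      then show ?thesis unfolding exp_add[symmetric] by simp
    qed
    then have "exp (- (s * z)) * G_dens s \<le> (exp 1 * exp (- (s * (1 / t)))) * G_dens s"
      by (rule mult_right_mono[OF _ G_dens_nonneg])
    then show ?thesis using True by (simp add: mult.assoc)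
  next
    case False
    then show ?thesis using G_dens_nonneg[of s] by (cases "s \<le> 0") (auto simp: G_dens_nonpos)
  qed
  have damped: "integrable lborel (\<lambda>s. exp (- (s * z)) * d s) \<and> (\<integral>s. exp (- (s * z)) * d s \<partial>lborel) \<le> B"
    if z: "0 < z" for z
  proof -
    let ?g = "\<lambda>s. exp (- (s * z)) * G_dens s"
    have g: "integrable lborel ?g" by (rule G_dens_laplace(1)[OF z])
    have gt: "integrable lborel (\<lambda>s. exp (- (t * z)) * ?g (s - t))"
      using lborel_integrable_real_affine[OF g, of 1 "- t"] by simp
    have gi: "integrable lborel (\<lambda>s. indicator {..t} s * ?g s)"
      by (rule Bochner_Integration.integrable_bound[OF g]) (auto simp: indicator_def)
    have eq: "exp (- (s * z)) * d s = exp (- (t * z)) * ?g (s - t) - ?g s + 2 * (indicator {..t} s * ?g s)" for s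
    proof -
      have "exp (- (s * z)) = exp (- (t * z)) * exp (- ((s - t) * z))"
        by (simp add: mult_exp_exp algebra_simps)
      then show ?thesis unfolding d_eq by (simp add: algebra_simps)
    qed
    have "(\<integral>s. exp (- (s * z)) * d s \<partial>lborel) =
        exp (- (t * z)) * G_laplace z - G_laplace z + 2 * (\<integral>s. indicator {..t} s * ?g s \<partial>lborel)"
    proof -
      have "(\<integral>s. exp (- (t * z)) * ?g (s - t) \<partial>lborel) = exp (- (t * z)) * G_laplace z"
        using integral_translate[of ?g t] by (simp only: integral_mult_right_zero G_laplace_def)
      then show ?thesis unfolding eq using gt g gi by (simp add: G_laplace_def)
    qed
    also have "exp (- (t * z)) * G_laplace z \<le> G_laplace z"
      using mult_right_mono[OF _ G_laplace_nonneg, of "exp (- (t * z))" 1 z] t z by simp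
    also have "(\<integral>s. indicator {..t} s * ?g s \<partial>lborel) \<le> (\<integral>s. exp 1 * (exp (- (s * (1 / t))) * G_dens s) \<partial>lborel)"
      by (rule integral_mono[OF gi _ le[OF z]]) (use G_dens_laplace(1)[of "1 / t"] t in auto)
    also have "\<dots> = exp 1 * G_laplace (1 / t)" by (simp only: integral_mult_right_zero G_laplace_def)
    finally have "(\<integral>s. exp (- (s * z)) * d s \<partial>lborel) \<le> B" by (simp add: B_def)
    moreover have "integrable lborel (\<lambda>s. exp (- (s * z)) * d s)"
      unfolding eq using gt g gi by auto
    ultimately show ?thesis by blast
  qed
  \<comment> \<open>The damping is released along \<open>z = 1 / (n + 1)\<close>; monotone
    convergence gives integrability of \<open>d\<close> and the bound \<open>B\<close> at
    once.\<close>
  have "(\<lambda>n. \<integral>\<^sup>+s. ennreal (exp (- (s * (1 / real (Suc n)))) * d s) \<partial>lborel) \<longlonglongrightarrow> (\<integral>\<^sup>+s. ennreal (d s) \<partial>lborel)"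
  proof (rule nn_integral_LIMSEQ)
    show "incseq (\<lambda>n s. ennreal (exp (- (s * (1 / real (Suc n)))) * d s))"
    proof (rule incseq_SucI, rule le_funI, rule ennreal_leI)
      fix n and s :: real
      show "exp (- (s * (1 / real (Suc n)))) * d s \<le> exp (- (s * (1 / real (Suc (Suc n))))) * d s"
      proof (cases "0 \<le> s")
        case True
        have "s * (1 / real (Suc (Suc n))) \<le> s * (1 / real (Suc n))"
          using True by (intro mult_left_mono frac_le) auto
        then show ?thesis by (intro mult_right_mono) (auto simp: d_def)
      next
        case False
        then show ?thesis using t by (simp add: d_def G_dens_nonpos)
      qed
    qed
    fix s :: real
    have "(\<lambda>n. exp (- (s * (1 / real (Suc n)))) * d s) \<longlonglongrightarrow> exp (- (s * 0)) * d s"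
      using LIMSEQ_inverse_real_of_nat by (intro tendsto_intros) (simp add: inverse_eq_divide)
    then show "(\<lambda>n. ennreal (exp (- (s * (1 / real (Suc n)))) * d s)) \<longlonglongrightarrow> ennreal (d s)"
      by (intro tendsto_ennrealI) simp
  qed measurable
  moreover have "(\<integral>\<^sup>+s. ennreal (exp (- (s * (1 / real (Suc n)))) * d s) \<partial>lborel) \<le> ennreal B" for n
  proof -
    have "0 < 1 / real (Suc n)" by simp
    note * = damped[OF this]
    have "(\<integral>\<^sup>+s. ennreal (exp (- (s * (1 / real (Suc n)))) * d s) \<partial>lborel) =
        ennreal (\<integral>s. exp (- (s * (1 / real (Suc n)))) * d s \<partial>lborel)"
      using * by (intro nn_integral_eq_integral) (auto simp: d_def)
    then show ?thesis using * by (simp add: ennreal_leI)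
  qed
  ultimately have nn: "(\<integral>\<^sup>+s. ennreal (d s) \<partial>lborel) \<le> ennreal B"
    by (intro LIMSEQ_le_const2) auto
  have B: "0 \<le> B" unfolding B_def using G_laplace_nonneg by simp
  have "(\<integral>\<^sup>+s. ennreal (d s) \<partial>lborel) < \<infinity>"
    using nn by (rule le_less_trans) simp
  then have d: "integrable lborel d"
    by (intro integrableI_nonneg) (auto simp: d_def)
  then show "integrable lborel (\<lambda>s. G_dens s - G_dens (s - t))"
    by (intro integrable_norm_cancel[where f = "\<lambda>s. G_dens s - G_dens (s - t)"]) (simp_all add: d_def[abs_def])
  have "ennreal (\<integral>s. d s \<partial>lborel) \<le> ennreal B"
  proof -
    have "(\<integral>\<^sup>+s. ennreal (d s) \<partial>lborel) = ennreal (\<integral>s. d s \<partial>lborel)"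
      by (rule nn_integral_eq_integral[OF d]) (simp add: d_def)
    then show ?thesis using nn by simp
  qed
  then show "(\<integral>s. \<bar>G_dens s - G_dens (s - t)\<bar> \<partial>lborel) \<le> 2 * exp 1 * G_laplace (1 / t)"
    using B by (simp add: d_def[abs_def] B_def[symmetric])
qed

lemma dens_P_dens:
  assumes "0 < t"
  shows "dens (P_dens t)"
proof -
  have "integrable lborel (P_dens t)"
    unfolding P_dens_def[abs_def]
    by (intro integrable_of_real integrable_divide_zero impI G_dens_diff_integrable(1)[OF assms])
  then show ?thesis using assms by (simp add: dens_def P_dens_def G_dens_nonpos)
qed

text \<open>The rate comes from \<open>G_laplace (1 / t) = (t - 1) / ln t\<close>: dividing by
  \<open>t\<close> leaves less than \<open>1 / ln t\<close>.\<close>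

lemma l1_P_dens:
  assumes t: "1 < t"
  shows "l1 (P_dens t) \<le> 2 * exp 1 / ln t"
proof -
  have "l1 (P_dens t) = (\<integral>s. \<bar>G_dens s - G_dens (s - t)\<bar> / t \<partial>lborel)"
    unfolding l1_def P_dens_def using t by (simp add: norm_of_real del: of_real_divide of_real_diff)
  also have "\<dots> = (\<integral>s. \<bar>G_dens s - G_dens (s - t)\<bar> \<partial>lborel) / t" by simp
  also have "\<dots> \<le> 2 * exp 1 * G_laplace (1 / t) / t"
    using t by (intro divide_right_mono G_dens_diff_integrable(2)) auto
  also have "G_laplace (1 / t) = (t - 1) / ln t"
    using G_dens_laplace(2)[of "1 / t"] t by (simp add: ln_div field_simps)
  also have "2 * exp 1 * ((t - 1) / ln t) / t = 2 * exp 1 / ln t * ((t - 1) / t)" by simp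
  also have "\<dots> \<le> 2 * exp 1 / ln t * 1"
    using t by (intro mult_left_mono) auto
  finally show ?thesis by simp
qed

text \<open>Real \<open>z\<close> suffice, as transforms are compared at positive integers; complex
  powers and complex transforms of \<open>G\<close> are thereby avoided.\<close>

lemma laplace_P_dens:
  assumes t: "0 < t" and z: "0 < z"
  shows "laplace (P_dens t) (of_real z) * Ln (of_real z) = of_real ((1 - exp (- (t * z))) / t * (1 - 1 / z))"
proof -
  let ?g = "\<lambda>s. exp (- (s * z)) * G_dens s"
  have g: "integrable lborel ?g" by (rule G_dens_laplace(1)[OF z])
  have gt: "integrable lborel (\<lambda>s. exp (- (t * z)) * ?g (s - t))"
    using lborel_integrable_real_affine[OF g, of 1 "- t"] by simp
  have "exp (- (of_real s * of_real z)) * P_dens t s = of_real ((?g s - exp (- (t * z)) * ?g (s - t)) / t)" for s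
  proof -
    have "exp (- (of_real s * of_real z)) = complex_of_real (exp (- (s * z)))"
      by (simp flip: exp_of_real)
    moreover have "exp (- (t * z)) * exp (- ((s - t) * z)) = exp (- (s * z))"
      by (simp add: mult_exp_exp algebra_simps)
    then have "?g s - exp (- (t * z)) * ?g (s - t) = exp (- (s * z)) * (G_dens s - G_dens (s - t))"
      by (simp add: mult.assoc[symmetric] right_diff_distrib)
    ultimately show ?thesis unfolding P_dens_def by (simp only: of_real_mult[symmetric] times_divide_eq_right)
  qed
  then have "laplace (P_dens t) (of_real z) = of_real (\<integral>s. (?g s - exp (- (t * z)) * ?g (s - t)) / t \<partial>lborel)"
    unfolding laplace_def by (simp only: integral_complex_of_real)
  also have "(\<integral>s. (?g s - exp (- (t * z)) * ?g (s - t)) / t \<partial>lborel) = (G_laplace z - exp (- (t * z)) * G_laplace z) / t"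
  proof -
    have "(\<integral>s. exp (- (t * z)) * ?g (s - t) \<partial>lborel) = exp (- (t * z)) * G_laplace z"
      using integral_translate[of ?g t] by (simp only: integral_mult_right_zero G_laplace_def)
    then show ?thesis using g gt by (simp add: G_laplace_def)
  qed
  finally have "laplace (P_dens t) (of_real z) * Ln (of_real z) = of_real ((G_laplace z - exp (- (t * z)) * G_laplace z) / t * ln z)"
    using z by (simp add: Ln_of_real)
  also have "(G_laplace z - exp (- (t * z)) * G_laplace z) / t * ln z = (1 - exp (- (t * z))) / t * (G_laplace z * ln z)"
    by (simp add: field_simps)
  finally show ?thesis by (simp only: G_dens_laplace(2)[OF z])
qed

text \<open>Uniqueness applied to the bounded kernel \<open>exp (- s z)\<close> as test function
  carries the agreement to the closed half-plane, including its boundary, without analytic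
  continuation.\<close>

lemma laplace_cong:
  assumes k: "dens k" and l: "dens l" and eq: "\<And>n. 1 \<le> n \<Longrightarrow> laplace k (of_nat n) = laplace l (of_nat n)"
    and z: "0 \<le> Re z"
  shows "laplace k z = laplace l z"
  unfolding laplace_max[OF k] laplace_max[OF l]
  by (rule laplace_eq_imp_integral_eq[OF k l eq, where C = 1])
    (assumption, intro continuous_intros, rule cmod_exp_le_1[OF z], simp)

section \<open>The regularised identity between the difference densities and the logarithm\<close>

definition e_dens :: "real \<Rightarrow> complex" where "e_dens s = exp_dens 1 s - W_dens s"

lemma dens_e_dens: "dens e_dens"
  unfolding e_dens_def[abs_def] by (intro dens_diff dens_exp_dens_1 dens_W_dens)

lemma one_plus_nonzero: "0 \<le> Re z \<Longrightarrow> 1 + z \<noteq> 0"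
  by (auto simp: complex_eq_iff)

lemma laplace_e_dens: "0 \<le> Re z \<Longrightarrow> laplace e_dens z = reg_e z"
  using one_plus_nonzero[of z] unfolding e_dens_def[abs_def]
  by (simp add: laplace_diff dens_exp_dens_1 dens_W_dens laplace_exp_dens_1 laplace_W_dens reg_e_def divide_simps power2_eq_square)

lemma laplace_c_dens': "0 < t \<Longrightarrow> z \<noteq> 0 \<Longrightarrow> laplace (c_dens t) z = (1 - exp (- (of_real t * z))) / (of_real t * z)"
  using laplace_c_dens[of t z] by (simp add: field_simps)

text \<open>This represents \<open>e(z) ((1 - exp (- t z)) / t - c_t(z))\<close>. Without the factor
  \<open>e\<close> the terms 1 and \<open>exp (- t z)\<close> would be Dirac masses and no
  densities.\<close>

definition main_dens :: "real \<Rightarrow> real \<Rightarrow> complex" where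
  "main_dens t s = of_real (1 / t) * (e_dens s - shift t e_dens s) - conv (c_dens t) e_dens s"

lemma dens_main: "0 < t \<Longrightarrow> dens (main_dens t)"
  unfolding main_dens_def[abs_def]
  by (intro dens_diff dens_cmult dens_shift dens_conv dens_e_dens dens_c_dens) simp

lemma laplace_main:
  assumes t: "0 < t" and z: "0 \<le> Re z"
  shows "laplace (main_dens t) z = reg_e z * ((1 - exp (- (of_real t * z))) / of_real t - laplace (c_dens t) z)"
  unfolding main_dens_def[abs_def] using t z
  by (simp add: laplace_diff laplace_cmult laplace_conv laplace_shift laplace_e_dens dens_diff dens_cmult dens_conv dens_shift dens_e_dens dens_c_dens
      del: of_real_divide)
    (simp add: algebra_simps diff_divide_distrib)

text \<open>\<open>P\<^sub>t \<cdot> log = (1 - e\<^sup>-\<^sup>t\<^sup>z)/t - c\<^sub>t\<close>, regularised by \<open>e\<close>.\<close>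
lemma laplace_P_dens_elog_dens:
  assumes t: "0 < t" and n: "1 \<le> n"
  shows "laplace (conv (P_dens t) elog_dens) (of_nat n) = laplace (main_dens t) (of_nat n)"
proof -
  let ?z = "of_nat n :: complex"
  have z: "0 \<le> Re ?z" "?z \<noteq> 0" using n by auto
  have "laplace (conv (P_dens t) elog_dens) ?z = reg_e ?z * (laplace (P_dens t) ?z * Ln ?z)"
    by (simp only: laplace_conv[OF dens_P_dens[OF t] dens_elog_dens z(1)] laplace_elog_dens[OF z] mult_ac)
  also have "laplace (P_dens t) ?z * Ln ?z = of_real ((1 - exp (- (t * real n))) / t * (1 - 1 / real n))"
    using laplace_P_dens[OF t, of "real n"] n by simp
  also have "\<dots> = (1 - exp (- (of_real t * ?z))) / of_real t - laplace (c_dens t) ?z"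
  proof -
    have "of_real (exp (- (t * real n))) = exp (- (of_real t * ?z))"
      by (simp flip: exp_of_real)
    then show ?thesis unfolding laplace_c_dens'[OF t z(2)] by (simp add: right_diff_distrib)
  qed
  finally show ?thesis using laplace_main[OF t z(1)] by simp
qed

text \<open>At \<open>t = 1\<close> the right-hand side simplifies because
  \<open>1 - exp (- z)\<close> is \<open>z\<close> times the transform of \<open>c_dens 1\<close>.
  The nonzero scalar \<open>reg_e z\<close> is cancelled, so the formula is available at every
  nonzero spectral point.\<close>

lemma laplace_P_dens_1:
  assumes z: "0 \<le> Re z" "z \<noteq> 0"
  shows "laplace (P_dens 1) z * Ln z = laplace (c_dens 1) z * (z - 1)"
proof -
  have "laplace (conv (P_dens 1) elog_dens) z = laplace (main_dens 1) z"
    by (rule laplace_cong) (use laplace_P_dens_elog_dens z in \<open>auto intro!: dens_conv dens_P_dens dens_elog_dens dens_main\<close>)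
  moreover have "laplace (conv (P_dens 1) elog_dens) z = reg_e z * (laplace (P_dens 1) z * Ln z)"
    by (simp add: laplace_conv dens_P_dens dens_elog_dens z laplace_elog_dens)
  moreover have "laplace (main_dens 1) z = reg_e z * (laplace (c_dens 1) z * (z - 1))"
  proof -
    have e: "1 - exp (- z) = z * laplace (c_dens 1) z" using laplace_c_dens[of 1 z] by simp
    have "laplace (main_dens 1) z = reg_e z * (1 - exp (- z) - laplace (c_dens 1) z)"
      using laplace_main[of 1 z] z by simp
    then show ?thesis unfolding e by (simp add: algebra_simps)
  qed
  moreover have "reg_e z \<noteq> 0" using one_plus_nonzero[OF z(1)] z(2) by (simp add: reg_e_def)
  ultimately show ?thesis by simp
qed

text \<open>Since \<open>(exp (- s l) - exp (- s z)) / (z - l)\<close> is the integral of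
  \<open>exp (- r z) exp (- (s - r) l)\<close> over \<open>r\<close> in \<open>[0, s]\<close>, the
  divided difference of the transform of \<open>k\<close> is again a transform. The inner integral
  is at most \<open>s\<close> in modulus, which is why a first moment is needed.\<close>

lemma divided_difference_density:
  assumes k: "dens k" and mom: "integrable lborel (\<lambda>s. of_real s * k s)" and l: "0 \<le> Re l"
  obtains q where "dens q" "\<And>n. 1 \<le> n \<Longrightarrow> (of_nat n - l) * laplace q (of_nat n) = laplace k l - laplace k (of_nat n)"
proof -
  let ?f = "\<lambda>s r. (indicator {0..s} r * exp (- (of_real (s - r) * l))) * k s"
  have [measurable]: "k \<in> borel_measurable borel" by (rule dens_measurable[OF k])
  have [measurable]: "(\<lambda>p :: real \<times> real. indicator {0..fst p} (snd p) :: complex) \<in> borel_measurable (lborel \<Otimes>\<^sub>M lborel)"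
  proof -
    have "(\<lambda>p :: real \<times> real. indicator {0..fst p} (snd p) :: complex) = (\<lambda>p. if 0 \<le> snd p \<and> snd p \<le> fst p then 1 else 0 :: complex)"
      by (auto simp: indicator_def)
    then show ?thesis by simp
  qed
  define q where "q r = (\<integral>s. ?f s r \<partial>lborel)" for r
  have bound: "norm (indicator {0..s} r * exp (- (of_real (s - r) * l)) :: complex) \<le> indicator {0..s} r" for s r
    using cmod_exp_le_1[OF l, of "s - r"] by (auto simp: indicator_def norm_mult)
  have i: "integrable lborel (?f s)" for s
  proof -
    have "integrable lborel (\<lambda>r. indicator {0..s} r *\<^sub>R (exp (- (of_real (s - r) * l)) * k s))"
      by (rule borel_integrable_compact) (auto intro!: continuous_intros)
    moreover have "(\<lambda>r. indicator {0..s} r *\<^sub>R (exp (- (of_real (s - r) * l)) * k s)) = ?f s"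
      by (auto simp: indicator_def)
    ultimately show ?thesis by (simp only:)
  qed
  have f: "integrable (lborel \<Otimes>\<^sub>M lborel) (case_prod ?f)"
  proof (rule lborel_pair.Fubini_integrable)
    have "(\<lambda>p. (indicator {0..fst p} (snd p) * exp (- (of_real (fst p - snd p) * l))) * k (fst p))
        \<in> borel_measurable (lborel \<Otimes>\<^sub>M lborel)" by measurable
    then show m: "case_prod ?f \<in> borel_measurable (lborel \<Otimes>\<^sub>M lborel)" by (simp add: case_prod_beta')
    show "integrable lborel (\<lambda>s. \<integral>r. norm (case_prod ?f (s, r)) \<partial>lborel)"
    proof (rule Bochner_Integration.integrable_bound[OF mom])
      have "(\<lambda>p. norm (case_prod ?f p)) \<in> borel_measurable (lborel \<Otimes>\<^sub>M lborel)" using m by measurable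
      then show "(\<lambda>s. \<integral>r. norm (case_prod ?f (s, r)) \<partial>lborel) \<in> borel_measurable lborel"
        by (intro lborel.borel_measurable_lebesgue_integral) (simp add: case_prod_beta')
      show "AE s in lborel. norm (\<integral>r. norm (case_prod ?f (s, r)) \<partial>lborel) \<le> norm (of_real s * k s)"
      proof (rule AE_I2)
        fix s :: real
        show "norm (\<integral>r. norm (case_prod ?f (s, r)) \<partial>lborel) \<le> norm (of_real s * k s)"
        proof (cases "s < 0")
          case True then show ?thesis using densD(2)[OF k] by simp
        next
          case False
          have "(\<integral>r. norm (?f s r) \<partial>lborel) \<le> (\<integral>r. indicator {0..s} r * norm (k s) \<partial>lborel)"
          proof (rule integral_mono)
            show "integrable lborel (\<lambda>r. norm (?f s r))" using i by (rule integrable_norm)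
            show "integrable lborel (\<lambda>r. indicator {0..s} r * norm (k s))"
              by (intro integrable_mult_left) (simp add: emeasure_lborel_Icc_eq)
            show "norm (?f s r) \<le> indicator {0..s} r * norm (k s)" for r
              unfolding norm_mult[of _ "k s"] by (rule mult_right_mono[OF bound]) simp
          qed
          also have "\<dots> = s * norm (k s)" using False by (simp add: measure_def emeasure_lborel_Icc_eq)
          finally have "(\<integral>r. norm (?f s r) \<partial>lborel) \<le> s * norm (k s)" .
          moreover have "0 \<le> (\<integral>r. norm (?f s r) \<partial>lborel)" by simp
          ultimately show ?thesis using False by (simp add: norm_mult del: integral_nonneg)
        qed
      qed
    qed
    show "AE s in lborel. integrable lborel (\<lambda>r. case_prod ?f (s, r))" using i by simp
  qed
  have d: "dens q"
    using lborel_pair.integrable_snd[OF f] by (simp add: dens_def q_def[abs_def])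
  have "(of_nat n - l) * laplace q (of_nat n) = laplace k l - laplace k (of_nat n)" if n: "1 \<le> n" for n
  proof -
    let ?z = "of_nat n :: complex"
    let ?u = "\<lambda>r. exp (- (of_real (max 0 r) * ?z))"
    have g: "integrable (lborel \<Otimes>\<^sub>M lborel) (case_prod (\<lambda>s r. ?u r * ?f s r))"
    proof -
      have "integrable (lborel \<Otimes>\<^sub>M lborel) (\<lambda>p. ?u (snd p) * case_prod ?f p)"
      proof (rule integrable_mult_bounded[OF f, where C = 1])
        show "(\<lambda>p. ?u (snd p)) \<in> borel_measurable (lborel \<Otimes>\<^sub>M lborel)" by measurable
        have "cmod (?u r) \<le> 1" for r by (rule cmod_exp_le_1) auto
        then show "AE p in lborel \<Otimes>\<^sub>M lborel. case_prod ?f p \<noteq> 0 \<longrightarrow> cmod (?u (snd p)) \<le> 1"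
          by (intro AE_I2 impI)
      qed
      then show ?thesis by (simp only: case_prod_beta')
    qed
    have "laplace q ?z = (\<integral>r. (\<integral>s. ?u r * ?f s r \<partial>lborel) \<partial>lborel)"
      unfolding laplace_max[OF d] q_def by (simp only: integral_mult_right_zero)
    also have "\<dots> = (\<integral>s. (\<integral>r. ?u r * ?f s r \<partial>lborel) \<partial>lborel)"
      by (rule lborel_pair.Fubini_integral[OF g])
    finally have "(?z - l) * laplace q ?z = (\<integral>s. (?z - l) * (\<integral>r. ?u r * ?f s r \<partial>lborel) \<partial>lborel)"
      by (simp only: integral_mult_right_zero)
    also have "\<dots> = (\<integral>s. exp (- (of_real s * l)) * k s - exp (- (of_real s * ?z)) * k s \<partial>lborel)"
    proof (rule Bochner_Integration.integral_cong[OF refl])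
      fix s :: real
      show "(?z - l) * (\<integral>r. ?u r * ?f s r \<partial>lborel) = exp (- (of_real s * l)) * k s - exp (- (of_real s * ?z)) * k s"
      proof (cases "s < 0")
        case True then show ?thesis using densD(2)[OF k] by simp
      next
        case False
        let ?F = "\<lambda>r. - exp (- (of_real r * (?z - l)) - of_real s * l) * k s"
        have "(\<integral>r. indicator {0..s} r *\<^sub>R ((?z - l) * exp (- (of_real r * (?z - l)) - of_real s * l) * k s) \<partial>lborel)
            = ?F s - ?F 0"
        proof (rule integral_FTC_Icc)
          show "0 \<le> s" using False by simp
          show "(?F has_vector_derivative (?z - l) * exp (- (of_real r * (?z - l)) - of_real s * l) * k s) (at r within {0..s})" for r
            by (rule has_vector_derivative_real_field)
              (auto intro!: derivative_eq_intros, simp add: algebra_simps)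
        qed (intro continuous_intros)
        also have "?F s - ?F 0 = exp (- (of_real s * l)) * k s - exp (- (of_real s * ?z)) * k s"
          by (simp add: algebra_simps)
        finally have "(\<integral>r. indicator {0..s} r *\<^sub>R ((?z - l) * exp (- (of_real r * (?z - l)) - of_real s * l) * k s) \<partial>lborel)
            = exp (- (of_real s * l)) * k s - exp (- (of_real s * ?z)) * k s" .
        moreover have "indicator {0..s} r *\<^sub>R ((?z - l) * exp (- (of_real r * (?z - l)) - of_real s * l) * k s)
            = (?z - l) * (?u r * ?f s r)" for r
        proof (cases "r \<in> {0..s}")
          case True
          then have "exp (- (of_real r * (?z - l)) - of_real s * l) = ?u r * exp (- (of_real (s - r) * l))"
            by (simp add: mult_exp_exp algebra_simps)
          then show ?thesis using True by simp
        qed simp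
        ultimately show ?thesis by (simp only: integral_mult_right_zero)
      qed
    qed
    also have "\<dots> = laplace k l - laplace k ?z"
      using laplace_integrable[OF k l] laplace_integrable[OF k, of ?z] by (simp add: laplace_def)
    finally show ?thesis .
  qed
  then show ?thesis using that d by blast
qed

section \<open>Cesaro means, the regulariser and the domain of the logarithm in terms of
  densities\<close>

context C0_semigroup begin

text \<open>This links the weak calculus with the Henstock-Kurzweil integrals that define
  \<open>cesaro\<close> and \<open>eA\<close>: on a compact interval the integrand is continuous and
  functionals pass under the integral.\<close>

lemma Op_cutoff:
  assumes \<kappa>: "continuous_on {0..b} \<kappa>" and b: "0 \<le> b"
  shows "dens (\<lambda>s. if 0 \<le> s \<and> s \<le> b then of_real (\<kappa> s) else 0)" (is "dens ?k")
    and "Op (\<lambda>s. if 0 \<le> s \<and> s \<le> b then of_real (\<kappa> s) else 0) x = integral {0..b} (\<lambda>s. \<kappa> s *\<^sub>R T s x)"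
    and "(\<lambda>s. \<kappa> s *\<^sub>R T s x) integrable_on {0..b}"
proof -
  have k: "?k = (\<lambda>s. indicator {0..b} s *\<^sub>R of_real (\<kappa> s))" by (auto simp: fun_eq_iff)
  have "integrable lborel ?k"
    unfolding k by (rule borel_integrable_compact) (auto intro!: continuous_intros \<kappa>)
  then show d: "dens ?k" by (simp add: dens_def)
  have c: "continuous_on {0..b} (\<lambda>s. \<kappa> s *\<^sub>R T s x)"
    by (intro continuous_intros \<kappa> continuous_on_subset[OF T_continuous]) auto
  then show i: "(\<lambda>s. \<kappa> s *\<^sub>R T s x) integrable_on {0..b}"
    by (rule integrable_continuous_real)
  show "Op ?k x = integral {0..b} (\<lambda>s. \<kappa> s *\<^sub>R T s x)"
  proof (rule Op_eqI[OF d])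
    fix \<psi> assume \<psi>: "\<psi> \<in> dual"
    have "set_integrable lborel {0..b} (\<lambda>s. \<psi> (\<kappa> s *\<^sub>R T s x))"
      unfolding set_integrable_def
      by (rule borel_integrable_compact) (auto intro!: bounded_linear.continuous_on[OF dual_bounded_linear[OF \<psi>]] c)
    note this[THEN set_borel_integral_eq_integral(2)]
    moreover have "integral {0..b} (\<lambda>s. \<psi> (\<kappa> s *\<^sub>R T s x)) = \<psi> (integral {0..b} (\<lambda>s. \<kappa> s *\<^sub>R T s x))"
      using integral_linear[OF i dual_bounded_linear[OF \<psi>]] by (simp add: o_def)
    moreover have "indicator {0..b} s *\<^sub>R \<psi> (\<kappa> s *\<^sub>R T s x) = \<psi> (U s x) * ?k s" for s
      by (simp add: U_eq indicator_def linear_scale[OF dual_linear[OF \<psi>]] scaleR_conv_of_real)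
    ultimately show "\<psi> (integral {0..b} (\<lambda>s. \<kappa> s *\<^sub>R T s x)) = (\<integral>s. \<psi> (U s x) * ?k s \<partial>lborel)"
      by (simp add: set_lebesgue_integral_def)
  qed
qed

lemma cesaro_eq:
  assumes "0 < t"
  shows "cesaro T t x = Op (c_dens t) x"
proof -
  have "Op (c_dens t) x = integral {0..t} (\<lambda>s. (1 / t) *\<^sub>R T s x)"
    unfolding c_dens_def[abs_def] using assms by (intro Op_cutoff) auto
  then show ?thesis by (simp add: cesaro_def)
qed

lemma cesaro_tendsto: "((\<lambda>h. cesaro T h x) \<longlongrightarrow> x) (at_right 0)"
proof -
  let ?F = "\<lambda>u. integral {0..u} (\<lambda>s. T s x)"
  have "(?F has_vector_derivative T 0 x) (at 0 within {0..1})"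
    by (rule integral_has_vector_derivative) (auto intro: continuous_on_subset[OF T_continuous])
  then have "((\<lambda>y. (1 / norm (y - 0)) *\<^sub>R (?F y - (?F 0 + (y - 0) *\<^sub>R x))) \<longlongrightarrow> 0) (at_right 0)"
    unfolding has_vector_derivative_def has_derivative_within at_within_Icc_at_right[OF zero_less_one] T_0
    by simp
  moreover have "\<forall>\<^sub>F y in at_right 0. (1 / norm (y - 0)) *\<^sub>R (?F y - (?F 0 + (y - 0) *\<^sub>R x)) = cesaro T y x - x"
    using eventually_at_right_less[of 0]
    by eventually_elim (simp add: cesaro_def scaleR_diff_right)
  ultimately have "((\<lambda>y. cesaro T y x - x) \<longlongrightarrow> 0) (at_right 0)"
    by (rule Lim_transform_eventually)
  then show ?thesis by (rule LIM_zero_cancel)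
qed

text \<open>Truncation converges in the norm that controls \<open>Op\<close>. This settles the
  improper integral in \<open>eA\<close> and later the passage to densities with finite first
  moment.\<close>

lemma l1_tail:
  assumes k: "dens k"
  shows "((\<lambda>b. l1 (\<lambda>s. k s - (if s \<le> b then k s else 0))) \<longlongrightarrow> 0) at_top"
proof -
  have [measurable]: "k \<in> borel_measurable borel" by (rule dens_measurable[OF k])
  have n: "integrable lborel (\<lambda>s. cmod (k s))" using densD(1)[OF k] by auto
  have "l1 (\<lambda>s. k s - (if s \<le> b then k s else 0)) = l1 k - (\<integral>s. indicator {..b} s *\<^sub>R cmod (k s) \<partial>lborel)" for b
  proof -
    have "integrable lborel (\<lambda>s. indicator {..b} s *\<^sub>R cmod (k s))"
      by (rule Bochner_Integration.integrable_bound[OF n]) (auto simp: indicator_def)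
    then have "l1 k - (\<integral>s. indicator {..b} s *\<^sub>R cmod (k s) \<partial>lborel) =
        (\<integral>s. cmod (k s) - indicator {..b} s *\<^sub>R cmod (k s) \<partial>lborel)"
      unfolding l1_def using n by simp
    also have "\<dots> = l1 (\<lambda>s. k s - (if s \<le> b then k s else 0))"
      unfolding l1_def by (intro Bochner_Integration.integral_cong) (auto simp: indicator_def)
    finally show ?thesis by simp
  qed
  moreover have "((\<lambda>b. l1 k - (\<integral>s. indicator {..b} s *\<^sub>R cmod (k s) \<partial>lborel)) \<longlongrightarrow> l1 k - l1 k) at_top"
    unfolding l1_def by (intro tendsto_intros tendsto_integral_at_top n) simp
  ultimately show ?thesis by simp
qed

text \<open>\<open>integral\<close> has a default value on non-integrable functions, so
  \<open>has_integral\<close> on the half-line must be proved. Over a large box the integral is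
  \<open>Op\<close> of a truncated density, and its distance to the claimed value is bounded by the
  tail of \<open>e_dens\<close>.\<close>

lemma eA_eq: "eA T x = Op e_dens x"
proof -
  let ?f = "\<lambda>s. ((1 - s) * exp (- s)) *\<^sub>R T s x"
  let ?k = "\<lambda>b s. if s \<le> b then e_dens s else 0"
  have e_dens: "e_dens s = (if 0 \<le> s then of_real ((1 - s) * exp (- s)) else 0)" for s
    by (simp add: e_dens_def exp_dens_def W_dens_def algebra_simps exp_of_real[symmetric])
  have k: "?k b = (\<lambda>s. if 0 \<le> s \<and> s \<le> b then of_real ((1 - s) * exp (- s)) else 0)" for b
    by (auto simp: e_dens)
  have c: "continuous_on {0..b} (\<lambda>s. (1 - s) * exp (- s))" for b :: real by (intro continuous_intros)
  have "(?f has_integral Op e_dens x) {0..}"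
    unfolding has_integral_alt'[of ?f]
  proof (intro conjI allI impI)
    fix a b :: real
    show "(\<lambda>s. if s \<in> {0..} then ?f s else 0) integrable_on cbox a b"
    proof (cases "0 \<le> b")
      case True
      have "?f integrable_on ({0..} \<inter> {a..b})"
        by (rule integrable_on_subinterval[OF Op_cutoff(3)[OF c True, of x], of "max 0 a" b, THEN back_subst[of "\<lambda>S. ?f integrable_on S"]])
          auto
      then show ?thesis by (subst integrable_restrict_Int) (simp add: Int_commute)
    next
      case False
      then have "{0..} \<inter> cbox a b = {}" by auto
      then show ?thesis by (simp only: integrable_restrict_Int integrable_on_empty)
    qed
  next
    fix e :: real assume e: "0 < e"
    have "((\<lambda>b. M * l1 (\<lambda>s. e_dens s - ?k b s) * norm x) \<longlongrightarrow> M * 0 * norm x) at_top"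
      by (intro tendsto_intros l1_tail dens_e_dens)
    then have "\<forall>\<^sub>F b in at_top. M * l1 (\<lambda>s. e_dens s - ?k b s) * norm x < e"
      using e by (intro order_tendstoD(2)) auto
    then obtain N where N: "\<And>b. N \<le> b \<Longrightarrow> M * l1 (\<lambda>s. e_dens s - ?k b s) * norm x < e"
      by (auto simp: eventually_at_top_linorder)
    have "norm (integral (cbox a b) (\<lambda>s. if s \<in> {0..} then ?f s else 0) - Op e_dens x) < e"
      if ab: "ball 0 (\<bar>N\<bar> + 1) \<subseteq> cbox a b" for a b
    proof -
      have "\<bar>N\<bar> \<in> cbox a b" "- \<bar>N\<bar> \<in> cbox a b" using ab by (auto simp: subset_iff dist_norm)
      then have b: "N \<le> b" "0 \<le> b" "a \<le> 0" by auto
      have dk: "dens (?k b)" unfolding k by (rule Op_cutoff(1)[OF c b(2)])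
      have "integral (cbox a b) (\<lambda>s. if s \<in> {0..} then ?f s else 0) = integral {0..b} ?f"
      proof -
        have "cbox a b \<inter> {0..} = {0..b}" "{0..} \<inter> cbox a b = {0..b}" using b by auto
        then show ?thesis by (simp only: integral_restrict_Int)
      qed
      also have "\<dots> = Op (?k b) x" unfolding k by (rule Op_cutoff(2)[OF c b(2), symmetric])
      finally have "norm (integral (cbox a b) (\<lambda>s. if s \<in> {0..} then ?f s else 0) - Op e_dens x)
          = norm (Op (\<lambda>s. e_dens s - ?k b s) x)"
        by (simp add: Op_diff_dens[OF dens_e_dens dk] norm_minus_commute)
      also have "\<dots> \<le> M * l1 (\<lambda>s. e_dens s - ?k b s) * norm x"
        by (rule Op_norm[OF dens_diff[OF dens_e_dens dk]])
      finally show ?thesis using N[OF b(1)] by simp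
    qed
    then show "\<exists>B>0. \<forall>a b. ball 0 B \<subseteq> cbox a b \<longrightarrow>
        norm (integral (cbox a b) (\<lambda>s. if s \<in> {0..} then ?f s else 0) - Op e_dens x) < e"
      by (intro exI[of _ "\<bar>N\<bar> + 1"]) auto
  qed
  then show ?thesis unfolding eA_def by (rule integral_unique)
qed

lemma Op_T: "dens k \<Longrightarrow> 0 \<le> h \<Longrightarrow> Op k (T h x) = T h (Op k x)"
  using Op_U[of k h x] by (simp add: U_eq)

lemma e_dens_Op: "Op e_dens x = Op (exp_dens 1) x - Op (exp_dens 1) (Op (exp_dens 1) x)"
  unfolding e_dens_def[abs_def]
  by (simp add: Op_diff_dens dens_exp_dens_1 dens_W_dens W_dens_eq_conv Op_conv dens_conv)

lemma Op_main:
  assumes t: "0 < t"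
  shows "Op (P_dens t) (Op elog_dens x) = Op e_dens ((1 / t) *\<^sub>R (x - T t x) - cesaro T t x)"
proof -
  have "Op (P_dens t) (Op elog_dens x) = Op (main_dens t) x"
    unfolding Op_conv[OF dens_P_dens[OF t] dens_elog_dens, symmetric]
    by (rule Op_cong_laplace[OF dens_conv[OF dens_P_dens[OF t] dens_elog_dens] dens_main[OF t] laplace_P_dens_elog_dens[OF t]])
  also have "\<dots> = (1 / t) *\<^sub>R (Op e_dens x - U t (Op e_dens x)) - Op (c_dens t) (Op e_dens x)"
    unfolding main_dens_def[abs_def] using t
    by (simp add: Op_diff_dens Op_cmult_dens cs_of_real Op_shift Op_conv dens_diff dens_cmult dens_conv
        dens_shift dens_e_dens dens_c_dens del: of_real_divide)
  also have "\<dots> = Op e_dens ((1 / t) *\<^sub>R (x - T t x) - cesaro T t x)"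
    using t by (simp add: cesaro_eq linear_diff[OF Op_linear[OF dens_e_dens]] linear_scale[OF Op_linear[OF dens_e_dens]]
        Op_commute[OF dens_c_dens dens_e_dens] Op_T[OF dens_e_dens] U_eq)
  finally show ?thesis .
qed

text \<open>Up to the factors \<open>t\<close> and \<open>h\<close>, both sides come from the second
  difference \<open>G(s) - G(s - t) - G(s - h) + G(s - t - h)\<close>, which is symmetric in
  \<open>t\<close> and \<open>h\<close>. Exchanging their roles brings out the factor
  \<open>1 / t\<close>.\<close>

lemma P_dens_T_diff:
  assumes t: "0 < t" and h: "0 < h"
  shows "Op (P_dens t) (v - T h v) = (h / t) *\<^sub>R (Op (P_dens h) v - T t (Op (P_dens h) v))"
proof -
  have eq: "(\<lambda>s. P_dens t s - shift h (P_dens t) s) = (\<lambda>s. of_real (h / t) * (P_dens h s - shift t (P_dens h) s))"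
    using t h by (auto simp: fun_eq_iff P_dens_def shift_def field_simps)
  have "Op (P_dens t) (v - T h v) = Op (\<lambda>s. P_dens t s - shift h (P_dens t) s) v"
    using t h by (simp add: Op_diff_dens dens_P_dens dens_shift Op_shift linear_diff[OF Op_linear[OF dens_P_dens]]
        Op_T U_eq)
  also have "\<dots> = (h / t) *\<^sub>R (Op (P_dens h) v - T t (Op (P_dens h) v))"
    unfolding eq using t h
    by (simp add: Op_cmult_dens Op_diff_dens dens_diff dens_P_dens dens_shift Op_shift cs_of_real U_eq del: of_real_divide)
  finally show ?thesis .
qed

text \<open>The domain is defined through some measure with transform \<open>e log\<close>.
  Uniqueness of transforms identifies its operator with that of \<open>elog_dens\<close>.\<close>

lemma log_domD:
  assumes "x \<in> log_dom cs T"
  shows "Op elog_dens x \<in> range (eA T)"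
proof -
  from assms obtain \<mu> h y where m: "bdd_cmeasure \<mu> h"
    and L: "\<And>z. 0 < Re z \<Longrightarrow> laplace_cm \<mu> h z = reg_e z * Ln z"
    and HP: "HP_value cs T \<mu> h x y" and y: "y \<in> range (eA T)"
    unfolding log_dom_def by blast
  have sets: "sets \<mu> = sets borel" and h: "integrable \<mu> h" and neg: "emeasure \<mu> {..<0} = 0"
    using m by (auto simp: bdd_cmeasure_def)
  have [measurable_cong]: "sets \<mu> = sets borel" by (rule sets)
  have ae: "AE s in \<mu>. 0 \<le> s"
  proof -
    have "{..<0::real} \<in> null_sets \<mu>" using neg sets by (auto intro: null_setsI)
    then show ?thesis by (rule AE_I'[of "{..<0}"]) auto
  qed
  have "Op elog_dens x = y"
  proof (rule Op_eqI[OF dens_elog_dens])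
    fix \<psi> assume \<psi>: "\<psi> \<in> dual"
    interpret \<psi>: bounded_linear \<psi> by (rule dual_bounded_linear[OF \<psi>])
    obtain C where C: "\<And>s. cmod (\<psi> (U s x)) \<le> C" using orbit_bounded[OF \<psi>, of x] by blast
    have [measurable]: "(\<lambda>s. \<psi> (U s x)) \<in> borel_measurable borel" by (rule orbit_measurable[OF \<psi>])
    have i: "integrable \<mu> (\<lambda>s. \<psi> (U s x) * h s)"
      by (rule integrable_mult_bounded[OF h, where C = C]) (use C in auto)
    have ae_eq: "AE s in \<mu>. \<psi> (cs (h s) (T s x)) = \<psi> (U s x) * h s"
      using ae by eventually_elim (simp add: dual_cs[OF \<psi>] U_eq mult.commute)
    \<comment> \<open>\<open>HP_value\<close> tests with real functionals, so a complex functional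
      is recovered from its real and imaginary parts.\<close>
    have part: "f (\<psi> y) = f (\<integral>s. \<psi> (U s x) * h s \<partial>\<mu>)" if f: "bounded_linear f" for f :: "complex \<Rightarrow> real"
    proof -
      have "bounded_linear (\<lambda>v. f (\<psi> v))"
        by (rule bounded_linear_compose[OF f dual_bounded_linear[OF \<psi>]])
      then have H: "integrable \<mu> (\<lambda>s. f (\<psi> (cs (h s) (T s x))))"
        "f (\<psi> y) = (\<integral>s. f (\<psi> (cs (h s) (T s x))) \<partial>\<mu>)"
        using HP unfolding HP_value_def by auto
      have [measurable]: "f \<in> borel_measurable borel"
        by (rule borel_measurable_continuous_onI[OF linear_continuous_on[OF f]])
      have "f (\<psi> y) = (\<integral>s. f (\<psi> (U s x) * h s) \<partial>\<mu>)"
        unfolding H(2)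
      proof (rule integral_cong_AE)
        show "(\<lambda>s. f (\<psi> (cs (h s) (T s x)))) \<in> borel_measurable \<mu>" using H(1) by auto
        show "(\<lambda>s. f (\<psi> (U s x) * h s)) \<in> borel_measurable \<mu>" using h by measurable
        show "AE s in \<mu>. f (\<psi> (cs (h s) (T s x))) = f (\<psi> (U s x) * h s)"
          using ae_eq by eventually_elim simp
      qed
      then show ?thesis by (simp only: integral_bounded_linear[OF f i])
    qed
    have "\<psi> y = (\<integral>s. \<psi> (U s x) * h s \<partial>\<mu>)"
      using part[OF bounded_linear_Re] part[OF bounded_linear_Im] by (simp add: complex_eq_iff)
    also have "\<dots> = (\<integral>s. \<psi> (U s x) * elog_dens s \<partial>lborel)"
    proof (rule laplace_unique[OF sets h _ _ densD(1)[OF dens_elog_dens] _ _ orbit_continuous[OF \<psi>] C])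
      show "AE s in \<mu>. h s \<noteq> 0 \<longrightarrow> 0 \<le> s" using ae by eventually_elim simp
      show "AE s in lborel. elog_dens s \<noteq> 0 \<longrightarrow> 0 \<le> s"
        using densD(2)[OF dens_elog_dens] by (intro AE_I2) (metis not_less)
      show "(\<integral>s. exp (- (of_real s * of_nat n)) * h s \<partial>\<mu>) = (\<integral>s. exp (- (of_real s * of_nat n)) * elog_dens s \<partial>lborel)"
        if "1 \<le> n" for n
        using L[of "of_nat n"] laplace_elog_dens[of "of_nat n"] that by (simp add: laplace_cm_def laplace_def)
    qed simp
    finally show "\<psi> y = (\<integral>s. \<psi> (U s x) * elog_dens s \<partial>lborel)" .
  qed
  then show ?thesis using y by simp
qed

text \<open>Lebesgue measure is not finite, as \<open>bdd_cmeasure\<close> demands. The density is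
  therefore rewritten relative to \<open>exp (- s) ds\<close> on the half-line, the factor
  \<open>exp s\<close> moving into \<open>h\<close>.\<close>

lemma log_domI:
  assumes "Op elog_dens x \<in> range (eA T)"
  shows "x \<in> log_dom cs T"
proof -
  define g :: "real \<Rightarrow> real" where "g s = indicator {0..} s *\<^sub>R exp (- (s * 1))" for s
  define \<mu> where "\<mu> = density lborel (\<lambda>s. ennreal (g s))"
  define h where "h s = of_real (exp s) * elog_dens s" for s
  have [measurable]: "elog_dens \<in> borel_measurable borel" by (rule dens_measurable[OF dens_elog_dens])
  have [measurable]: "g \<in> borel_measurable borel" unfolding g_def by measurable
  have [measurable]: "h \<in> borel_measurable borel" unfolding h_def by measurable
  have g: "integrable lborel g" "0 \<le> g s" for s
    using exp_integral_real(1)[of 1] by (simp_all add: g_def[abs_def])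
  have gh: "g s *\<^sub>R h s = elog_dens s" for s
    using densD(2)[OF dens_elog_dens, of s]
    by (cases "s < 0") (auto simp: g_def h_def scaleR_conv_of_real mult.assoc[symmetric] exp_minus simp flip: of_real_mult)
  have "bdd_cmeasure \<mu> h"
    unfolding bdd_cmeasure_def
  proof (intro conjI)
    show "sets \<mu> = sets borel" by (simp add: \<mu>_def)
    show "finite_measure \<mu>"
    proof (rule finite_measureI)
      have "emeasure \<mu> (space \<mu>) = (\<integral>\<^sup>+s. ennreal (g s) \<partial>lborel)"
        by (simp add: \<mu>_def emeasure_density)
      also have "\<dots> = ennreal (\<integral>s. g s \<partial>lborel)"
        by (rule nn_integral_eq_integral) (use g in auto)
      finally show "emeasure \<mu> (space \<mu>) \<noteq> \<infinity>" by simp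
    qed
    show "emeasure \<mu> {..<0} = 0"
    proof -
      have "emeasure \<mu> {..<0} = (\<integral>\<^sup>+s. ennreal (g s) * indicator {..<0} s \<partial>lborel)"
        by (simp add: \<mu>_def emeasure_density)
      also have "\<dots> = (\<integral>\<^sup>+s. 0 \<partial>(lborel :: real measure))"
        by (intro nn_integral_cong) (auto simp: g_def indicator_def)
      finally show ?thesis by simp
    qed
    show "integrable \<mu> h"
      unfolding \<mu>_def using g densD(1)[OF dens_elog_dens] by (simp add: integrable_density gh)
  qed
  moreover have "laplace_cm \<mu> h z = reg_e z * Ln z" if "0 < Re z" for z
  proof -
    have "laplace_cm \<mu> h z = (\<integral>s. g s *\<^sub>R (exp (- (of_real s * z)) * h s) \<partial>lborel)"
      unfolding laplace_cm_def \<mu>_def by (rule integral_density) (use g in auto)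
    also have "\<dots> = laplace elog_dens z"
      unfolding laplace_def gh[symmetric] by (simp add: mult_ac)
    also have "\<dots> = reg_e z * Ln z" using that by (intro laplace_elog_dens) auto
    finally show ?thesis .
  qed
  moreover have "HP_value cs T \<mu> h x (Op elog_dens x)"
    unfolding HP_value_def
  proof (intro allI impI)
    fix \<phi> :: "'a \<Rightarrow> real" assume \<phi>: "bounded_linear \<phi>"
    obtain K where "\<And>y. norm (\<phi> y) \<le> norm y * K" using bounded_linear.nonneg_bounded[OF \<phi>] by blast
    then have "\<And>y. \<bar>\<phi> y\<bar> \<le> K * norm y" by (simp add: mult.commute)
    then obtain \<psi> where \<psi>: "\<psi> \<in> dual" "\<And>y. Re (\<psi> y) = \<phi> y"
      using complexify[OF bounded_linear.linear[OF \<phi>]] by metis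
    have [measurable]: "(\<lambda>s. \<psi> (U s x)) \<in> borel_measurable borel" by (rule orbit_measurable[OF \<psi>(1)])
    define F where "F s = Re (h s * \<psi> (U s x))" for s
    have [measurable]: "F \<in> borel_measurable borel" unfolding F_def by measurable
    have Fphi: "F s = \<phi> (cs (h s) (T s x))" if "0 \<le> s" for s
      using that by (simp add: F_def \<psi>(2)[symmetric] dual_cs[OF \<psi>(1)] U_eq)
    have h0: "h s = 0" if "s < 0" for s using densD(2)[OF dens_elog_dens that] by (simp add: h_def)
    have Feq: "F s = \<phi> (cs (h s) (T s x))" for s
    proof (cases "0 \<le> s")
      case False
      then show ?thesis using h0[of s] linear_0[OF bounded_linear.linear[OF \<phi>]] by (simp add: F_def cs_0)
    qed (rule Fphi)
    have gF: "g s *\<^sub>R F s = Re (\<psi> (U s x) * elog_dens s)" for s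
    proof -
      have "g s *\<^sub>R F s = Re ((g s *\<^sub>R h s) * \<psi> (U s x))" by (simp add: F_def)
      then show ?thesis by (simp only: gh mult.commute)
    qed
    have i: "integrable lborel (\<lambda>s. \<psi> (U s x) * elog_dens s)" by (rule orbit_integrable[OF dens_elog_dens \<psi>(1)])
    have "integrable \<mu> F"
    proof -
      have "integrable lborel (\<lambda>s. g s *\<^sub>R F s)"
        unfolding gF by (rule integrable_bounded_linear[OF bounded_linear_Re i])
      then show ?thesis unfolding \<mu>_def using g by (subst integrable_density) auto
    qed
    moreover have "(\<integral>s. F s \<partial>\<mu>) = \<phi> (Op elog_dens x)"
    proof -
      have "(\<integral>s. F s \<partial>\<mu>) = (\<integral>s. g s *\<^sub>R F s \<partial>lborel)"
        unfolding \<mu>_def by (rule integral_density) (use g in auto)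
      also have "\<dots> = Re (\<integral>s. \<psi> (U s x) * elog_dens s \<partial>lborel)"
        unfolding gF by (rule integral_bounded_linear[OF bounded_linear_Re i])
      also have "\<dots> = \<phi> (Op elog_dens x)" by (simp add: Op_weak[OF dens_elog_dens \<psi>(1), symmetric] \<psi>(2))
      finally show ?thesis .
    qed
    ultimately show "integrable \<mu> (\<lambda>s. \<phi> (cs (h s) (T s x))) \<and>
        \<phi> (Op elog_dens x) = (\<integral>s. \<phi> (cs (h s) (T s x)) \<partial>\<mu>)"
      unfolding Feq[abs_def, symmetric] by (simp add: Feq[symmetric])
  qed
  ultimately show ?thesis using assms unfolding log_dom_def by blast
qed

end

section \<open>The resolvent and the Cesaro means\<close>

text \<open>The Taylor remainder is at most \<open>exp (1/4) |w|^2 <= 2 |w|^2\<close>, and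
  \<open>|w| <= 1/4\<close> turns this into \<open>|w| / 2\<close>. This is the origin of the 4 in
  \<open>t = 1 / (4 |z|)\<close>.\<close>

lemma one_minus_exp_lower_bound:
  fixes w :: complex
  assumes "cmod w \<le> 1 / 4"
  shows "cmod w / 2 \<le> cmod (1 - exp (- w))"
proof -
  have "cmod (exp (- w) - (\<Sum>k\<le>1. (- w) ^ k / fact k)) \<le> exp \<bar>Re (- w)\<bar> * (cmod (- w) ^ Suc 1) / fact 1"
    by (rule Taylor_exp)
  then have T: "cmod (exp (- w) - (1 - w)) \<le> exp \<bar>Re w\<bar> * (cmod w)\<^sup>2"
    by (simp add: power2_eq_square)
  have "\<bar>Re w\<bar> \<le> 1 / 4" using abs_Re_le_cmod[of w] assms by linarith
  then have "exp \<bar>Re w\<bar> \<le> 2" using real_exp_bound_lemma[of "\<bar>Re w\<bar>"] by simp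
  then have "exp \<bar>Re w\<bar> * (cmod w)\<^sup>2 \<le> 2 * (cmod w)\<^sup>2" by (intro mult_right_mono) auto
  also have "\<dots> \<le> cmod w / 2"
    using mult_right_mono[OF assms, of "cmod w"] by (simp add: power2_eq_square)
  finally have "cmod (exp (- w) - (1 - w)) \<le> cmod w / 2" using T by linarith
  moreover have "w = (1 - exp (- w)) + (exp (- w) - (1 - w))" by simp
  then have "cmod w \<le> cmod (1 - exp (- w)) + cmod (exp (- w) - (1 - w))"
    by (metis norm_triangle_ineq)
  ultimately show ?thesis by simp
qed

lemma laplace_c_dens_lower_bound:
  assumes "0 < t" "z \<noteq> 0" "t * cmod z \<le> 1 / 4"
  shows "1 / 2 \<le> cmod (laplace (c_dens t) z)"
proof -
  have "cmod (of_real t * z) / 2 \<le> cmod (1 - exp (- (of_real t * z)))"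
    by (rule one_minus_exp_lower_bound) (use assms in \<open>simp add: norm_mult\<close>)
  moreover have "0 < cmod (of_real t * z)" using assms by simp
  ultimately show ?thesis
    unfolding laplace_c_dens'[OF assms(1,2)] norm_divide by (simp add: le_divide_eq)
qed

text \<open>The product with \<open>Ln z\<close> consists of three factors of modulus at least
  \<open>1/2\<close>, which gives \<open>1/8\<close>. The logarithm satisfies
  \<open>|Ln z| <= ln (4 t) + pi <= ln t + 3 + 4 <= 8 ln t\<close>, where \<open>exp 1 <= t\<close>
  supplies \<open>1 <= ln t\<close>; together this gives 64.\<close>

lemma laplace_product_lower_bound:
  assumes z: "0 \<le> Re z" "z \<noteq> 0" "cmod z \<le> 1 / 4" and t: "t = 1 / (4 * cmod z)" "exp 1 \<le> t"
  shows "1 / (64 * ln t) \<le> cmod (laplace (conv (c_dens t) (P_dens 1)) z)"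
proof -
  have t0: "0 < t" using t(2) exp_gt_zero[of "1::real"] by linarith
  have lnt: "1 \<le> ln t" using t(2) t0 by (simp add: ln_ge_iff)
  have cz: "cmod z = 1 / (4 * t)" using t(1) z(2) by simp
  have Ln_nz: "cmod (Ln z) \<le> 8 * ln t"
  proof -
    have "cmod (Ln z) \<le> \<bar>Re (Ln z)\<bar> + \<bar>Im (Ln z)\<bar>" by (rule cmod_le)
    also have "Re (Ln z) = - ln (4 * t)" using z(2) t0 by (simp add: cz ln_div)
    also have "\<bar>Im (Ln z)\<bar> \<le> pi" using mpi_less_Im_Ln[OF z(2)] Im_Ln_le_pi[OF z(2)] by linarith
    also have "\<bar>- ln (4 * t)\<bar> = ln 4 + ln t"
    proof -
      have "ln (4 * t) = ln 4 + ln t" using t0 by (simp add: ln_mult)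
      moreover have "0 \<le> ln (4 :: real)" by simp
      ultimately show ?thesis using lnt by linarith
    qed
    also have "ln 4 \<le> (3 :: real)" using ln_le_minus_one[of 4] by simp
    finally show ?thesis using pi_less_4 lnt by linarith
  qed
  have "1 / 8 \<le> cmod (laplace (c_dens t) z) * (cmod (laplace (c_dens 1) z) * cmod (z - 1))"
  proof -
    have "1 / 2 \<le> cmod (laplace (c_dens t) z)" by (rule laplace_c_dens_lower_bound) (use t0 z cz in auto)
    moreover have "1 / 2 \<le> cmod (laplace (c_dens 1) z)" by (rule laplace_c_dens_lower_bound) (use z in auto)
    moreover have "1 / 2 \<le> cmod (z - 1)"
      using norm_triangle_ineq2[of 1 z] z(3) by (simp add: norm_minus_commute)
    ultimately have "(1 / 2) * ((1 / 2) * (1 / 2)) \<le> cmod (laplace (c_dens t) z) * (cmod (laplace (c_dens 1) z) * cmod (z - 1))"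
      by (intro mult_mono) auto
    then show ?thesis by simp
  qed
  also have "\<dots> = cmod (laplace (conv (c_dens t) (P_dens 1)) z) * cmod (Ln z)"
    using laplace_P_dens_1[OF z(1,2)] by (simp add: laplace_conv dens_c_dens dens_P_dens z norm_mult mult.assoc flip: norm_mult)
  also have "\<dots> \<le> cmod (laplace (conv (c_dens t) (P_dens 1)) z) * (8 * ln t)"
    by (rule mult_left_mono[OF Ln_nz]) simp
  finally show ?thesis using lnt by (simp add: field_simps)
qed

section \<open>The generator and its resolvent\<close>

locale C0_generator = C0_semigroup +
  fixes D :: "'a set" and A :: "'a \<Rightarrow> 'a"
  assumes generator: "neg_generator T D A"
begin

lemma D_eq: "D = {x. \<exists>y. ((\<lambda>h. (1 / h) *\<^sub>R (T h x - x)) \<longlongrightarrow> y) (at_right 0)}"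
  and A_lim: "x \<in> D \<Longrightarrow> ((\<lambda>h. (1 / h) *\<^sub>R (T h x - x)) \<longlongrightarrow> - A x) (at_right 0)"
  using generator by (auto simp: neg_generator_def)

text \<open>This is \<open>(1 + A)^-1\<close>, as \<open>A_J\<close> and
  \<open>J_left_inverse\<close> show.\<close>

abbreviation "J \<equiv> Op (exp_dens 1)"

lemma J_linear: "linear J" by (rule Op_linear[OF dens_exp_dens_1])

text \<open>The difference quotient on the range of \<open>J\<close> is the Cesaro mean of
  \<open>J x - x\<close>: both sides have the symbol
  \<open>- (1 - exp (- h z)) / (h (1 + z))\<close>. Cesaro means over short intervals converge to
  the identity.\<close>

lemma J_difference_quotient: "((\<lambda>h. (1 / h) *\<^sub>R (T h (J x) - J x)) \<longlongrightarrow> J x - x) (at_right 0)"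
proof -
  have "(1 / h) *\<^sub>R (T h (J x) - J x) = cesaro T h (J x - x)" if h: "0 < h" for h
  proof -
    have "T h (J x) - J x = Op (\<lambda>s. shift h (exp_dens 1) s - exp_dens 1 s) x"
      using h by (simp add: Op_diff_dens dens_shift dens_exp_dens_1 Op_shift U_eq)
    also have "\<dots> = Op (\<lambda>s. of_real h * (conv (c_dens h) (exp_dens 1) s - c_dens h s)) x"
    proof (rule Op_cong_laplace)
      fix n :: nat assume "1 \<le> n"
      let ?z = "of_nat n :: complex"
      have z: "0 \<le> Re ?z" "1 + ?z \<noteq> 0" using one_plus_nonzero[of ?z] by auto
      have "laplace (\<lambda>s. shift h (exp_dens 1) s - exp_dens 1 s) ?z = - (1 - exp (- (of_real h * ?z))) / (1 + ?z)"
        using h z by (simp add: laplace_diff dens_shift dens_exp_dens_1 laplace_shift laplace_exp_dens_1 diff_divide_distrib)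
      also have "\<dots> = of_real h * (laplace (c_dens h) ?z * (1 / (1 + ?z)) - laplace (c_dens h) ?z)"
        unfolding laplace_c_dens[OF h, symmetric] using z(2) by (simp add: field_simps)
      also have "\<dots> = laplace (\<lambda>s. of_real h * (conv (c_dens h) (exp_dens 1) s - c_dens h s)) ?z"
        using z by (simp add: laplace_cmult laplace_diff laplace_conv dens_conv dens_c_dens dens_exp_dens_1 laplace_exp_dens_1)
      finally show "laplace (\<lambda>s. shift h (exp_dens 1) s - exp_dens 1 s) ?z =
          laplace (\<lambda>s. of_real h * (conv (c_dens h) (exp_dens 1) s - c_dens h s)) ?z" .
    qed (use h in \<open>intro dens_diff dens_cmult dens_shift dens_conv dens_c_dens dens_exp_dens_1; simp\<close>)+
    also have "\<dots> = h *\<^sub>R (cesaro T h (J x) - cesaro T h x)"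
      using h by (simp add: Op_cmult_dens Op_diff_dens dens_diff dens_conv dens_c_dens dens_exp_dens_1 Op_conv cesaro_eq cs_of_real)
    finally show ?thesis
      using h by (simp add: cesaro_eq linear_diff[OF Op_linear[OF dens_c_dens]])
  qed
  then have "\<forall>\<^sub>F h in at_right 0. cesaro T h (J x - x) = (1 / h) *\<^sub>R (T h (J x) - J x)"
    using eventually_at_right_less[of 0] by (auto elim: eventually_mono)
  then show ?thesis by (rule Lim_transform_eventually[OF cesaro_tendsto])
qed

lemma J_in_D: "J x \<in> D"
  using J_difference_quotient[of x] by (auto simp: D_eq)

lemma A_J: "A (J x) = x - J x"
  using tendsto_unique[OF _ A_lim[OF J_in_D] J_difference_quotient[of x]] by (simp add: algebra_simps)

lemma J_left_inverse:
  assumes "x \<in> D"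
  shows "J (x + A x) = x"
proof -
  have "((\<lambda>h. J ((1 / h) *\<^sub>R (T h x - x))) \<longlongrightarrow> J (- A x)) (at_right 0)"
    by (rule bounded_linear.tendsto[OF Op_bounded_linear[OF dens_exp_dens_1] A_lim[OF assms]])
  moreover have "\<forall>\<^sub>F h in at_right 0. J ((1 / h) *\<^sub>R (T h x - x)) = (1 / h) *\<^sub>R (T h (J x) - J x)"
    using eventually_at_right_less[of 0]
    by eventually_elim (simp add: linear_scale[OF J_linear] linear_diff[OF J_linear] Op_T dens_exp_dens_1)
  ultimately have "((\<lambda>h. (1 / h) *\<^sub>R (T h (J x) - J x)) \<longlongrightarrow> J (- A x)) (at_right 0)"
    by (rule Lim_transform_eventually)
  from tendsto_unique[OF _ this J_difference_quotient] show ?thesis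
    by (simp add: linear_neg[OF J_linear] linear_add[OF J_linear] algebra_simps)
qed

text \<open>\<open>e(A)\<close> is \<open>A J J\<close>. The outer \<open>A\<close> is injective by
  assumption, and \<open>J\<close> is injective because \<open>u = A (J u) + J u\<close> recovers
  \<open>u\<close>.\<close>

lemma inj_eA:
  assumes "inj_on A D"
  shows "inj (eA T)"
proof (rule injI)
  fix x y assume eq: "eA T x = eA T y"
  have "eA T v = A (J (J v))" for v by (simp add: eA_eq e_dens_Op A_J)
  from this[of x] this[of y] have "A (J (J x)) = A (J (J y))" unfolding eq by (rule trans[OF sym])
  then have JJ: "J (J x) = J (J y)" by (rule inj_onD[OF assms _ J_in_D J_in_D])
  have J: "u = v" if "J u = J v" for u v
  proof -
    have "u - J u = v - J v" using A_J[of u] A_J[of v] unfolding that by (rule trans[OF sym])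
    then show ?thesis unfolding that by simp
  qed
  show "x = y" by (rule J, rule J, rule JJ)
qed

section \<open>Upper bounds for the Cesaro means on the domain of the logarithm\<close>

lemma cesaro_decomposition:
  assumes inj: "inj_on A D" and x: "x \<in> log_dom cs T"
  obtains w where "\<And>t. 0 < t \<Longrightarrow> cesaro T t x = (1 / t) *\<^sub>R (x - T t x) - Op (P_dens t) w"
proof -
  obtain w where w: "Op elog_dens x = eA T w" using log_domD[OF x] by blast
  have "cesaro T t x = (1 / t) *\<^sub>R (x - T t x) - Op (P_dens t) w" if t: "0 < t" for t
  proof -
    \<comment> \<open>The vector \<open>w\<close> is \<open>log(A) x\<close>. Moving
      \<open>e(A)\<close> past \<open>P_t(A)\<close> brings the regularised identity into a form in
      which \<open>e(A)\<close> can be cancelled.\<close>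
    have "eA T (Op (P_dens t) w) = Op (P_dens t) (Op elog_dens x)"
      unfolding w eA_eq by (rule Op_commute[OF dens_e_dens dens_P_dens[OF t]])
    also have "\<dots> = eA T ((1 / t) *\<^sub>R (x - T t x) - cesaro T t x)"
      unfolding eA_eq by (rule Op_main[OF t])
    finally have "Op (P_dens t) w = (1 / t) *\<^sub>R (x - T t x) - cesaro T t x"
      by (rule injD[OF inj_eA[OF inj]])
    then show ?thesis by simp
  qed
  then show ?thesis by (rule that)
qed

lemma norm_scaled_diff:
  assumes "0 < t"
  shows "norm ((1 / t) *\<^sub>R (x - T t x)) \<le> (1 + M) * norm x / t"
proof -
  have "norm (x - T t x) \<le> (1 + M) * norm x"
    using norm_triangle_ineq4[of x "T t x"] M_bound[of t x] assms by (simp add: algebra_simps)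
  then show ?thesis using assms by (simp add: divide_right_mono)
qed

lemma norm_Op_P_dens:
  assumes "1 < t"
  shows "norm (Op (P_dens t) w) \<le> M * (2 * exp 1 / ln t) * norm w"
proof -
  have "norm (Op (P_dens t) w) \<le> M * l1 (P_dens t) * norm w"
    by (rule Op_norm[OF dens_P_dens]) (use assms in auto)
  also have "\<dots> \<le> M * (2 * exp 1 / ln t) * norm w"
    using l1_P_dens[OF assms] M_ge_1 by (intro mult_right_mono mult_left_mono) auto
  finally show ?thesis .
qed

lemma ln_over_t_tendsto: "((\<lambda>t. c * (ln t / t)) \<longlongrightarrow> 0) at_top" for c :: real
  using tendsto_mult_right_zero[OF ln_x_over_x_tendsto_0] by simp

lemma cesaro_bigo:
  assumes inj: "inj_on A D" and x: "x \<in> log_dom cs T"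
  shows "(\<lambda>t. norm (cesaro T t x)) \<in> O[at_top](\<lambda>t. 1 / ln t)"
proof -
  obtain w where w: "\<And>t. 0 < t \<Longrightarrow> cesaro T t x = (1 / t) *\<^sub>R (x - T t x) - Op (P_dens t) w"
    using cesaro_decomposition[OF inj x] by blast
  define c where "c = (1 + M) * norm x + M * (2 * exp 1) * norm w"
  have "\<forall>\<^sub>F t in at_top. norm (norm (cesaro T t x)) \<le> c * norm (1 / ln t)"
    using eventually_gt_at_top[of 1]
  proof eventually_elim
    case (elim t)
    have ln: "0 < ln t" "ln t \<le> t" using elim ln_bound[of t] by auto
    have "norm (cesaro T t x) \<le> (1 + M) * norm x / t + M * (2 * exp 1 / ln t) * norm w"
      using w[of t] norm_triangle_ineq4[of "(1 / t) *\<^sub>R (x - T t x)" "Op (P_dens t) w"]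
        norm_scaled_diff[of t x] norm_Op_P_dens[OF elim, of w] elim by simp
    also have "(1 + M) * norm x / t \<le> (1 + M) * norm x / ln t"
      using ln elim M_ge_1 by (intro divide_left_mono) auto
    finally show ?case using ln by (simp add: c_def add_divide_distrib mult_ac)
  qed
  then show ?thesis by (rule bigoI)
qed

text \<open>\<open>A d\<close> is the limit of \<open>(d - T h d) / h\<close>, and the factor
  \<open>1 / h\<close> can be absorbed into the vector.\<close>

lemma range_one_minus_T_dense:
  assumes dense: "closure (A ` D) = UNIV" and e: "0 < e"
  obtains h v where "0 < h" "norm (w - (v - T h v)) < e"
proof -
  have "w \<in> closure (A ` D)" using dense by simp
  then obtain d where d: "d \<in> D" "norm (A d - w) < e / 2"
    using closure_approachable[of w "A ` D"] e by (auto simp: dist_norm dest: spec[of _ "e / 2"])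
  have "\<forall>\<^sub>F h in at_right 0. dist ((1 / h) *\<^sub>R (T h d - d)) (- A d) < e / 2"
    using A_lim[OF d(1)] e by (intro tendstoD) auto
  then have "\<forall>\<^sub>F h in at_right 0. 0 < h \<and> dist ((1 / h) *\<^sub>R (T h d - d)) (- A d) < e / 2"
    using eventually_at_right_less[of 0] by eventually_elim simp
  then obtain h where h: "0 < h" "dist ((1 / h) *\<^sub>R (T h d - d)) (- A d) < e / 2"
    using eventually_happens'[OF trivial_limit_at_right_real] by blast
  define v where "v = (1 / h) *\<^sub>R d"
  have "v - T h v = - ((1 / h) *\<^sub>R (T h d - d))"
    using h by (simp add: v_def linear_scale[OF bounded_linear.linear[OF T_bounded_linear]] algebra_simps)
  then have "norm (A d - (v - T h v)) < e / 2" using h(2) by (simp add: dist_norm add.commute)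
  moreover have "norm (w - (v - T h v)) \<le> norm (w - A d) + norm (A d - (v - T h v))"
    using dist_triangle[of w "v - T h v" "A d"] by (simp only: dist_norm)
  ultimately have "norm (w - (v - T h v)) < e"
    using d(2) norm_minus_commute[of w "A d"] by linarith
  then show ?thesis using that h(1) by blast
qed

lemma ln_Op_P_dens_tendsto:
  assumes dense: "closure (A ` D) = UNIV"
  shows "((\<lambda>t. ln t * norm (Op (P_dens t) w)) \<longlongrightarrow> 0) at_top"
proof (rule tendstoI)
  fix e :: real assume e: "0 < e"
  \<comment> \<open>\<open>K\<close> bounds \<open>ln t\<close> times the norm of
    \<open>P_t(A)\<close> uniformly in \<open>t > 1\<close>. Approximating \<open>w\<close> up to
    \<open>e / (2 * K)\<close> leaves \<open>e / 2\<close> for the part that decays like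
    \<open>ln t / t\<close>.\<close>
  define K where "K = M * (2 * exp 1)"
  have K: "0 < K" using M_ge_1 by (simp add: K_def)
  obtain h v where h: "0 < h" and hv: "norm (w - (v - T h v)) < e / (2 * K)"
    using range_one_minus_T_dense[OF dense, of "e / (2 * K)" w] e K by auto
  define C where "C = h * ((1 + M) * norm (Op (P_dens h) v))"
  have "\<forall>\<^sub>F t in at_top. C * (ln t / t) < e / 2"
    using ln_over_t_tendsto[of C] e by (intro order_tendstoD(2)) auto
  then show "\<forall>\<^sub>F t in at_top. dist (ln t * norm (Op (P_dens t) w)) 0 < e"
    using eventually_gt_at_top[of 1]
  proof eventually_elim
    case (elim t)
    have t: "1 < t" "0 < t" "0 < ln t" using elim by auto
    have lin: "linear (Op (P_dens t))" by (rule Op_linear[OF dens_P_dens[OF t(2)]])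
    have "norm (Op (P_dens t) (v - T h v)) \<le> C / t"
    proof -
      have "norm (Op (P_dens t) (v - T h v)) = h * norm ((1 / t) *\<^sub>R (Op (P_dens h) v - T t (Op (P_dens h) v)))"
        using P_dens_T_diff[OF t(2) h] h t by simp
      also have "\<dots> \<le> h * ((1 + M) * norm (Op (P_dens h) v) / t)"
        using norm_scaled_diff[OF t(2)] h by (intro mult_left_mono) auto
      finally show ?thesis by (simp add: C_def)
    qed
    moreover have "norm (Op (P_dens t) (w - (v - T h v))) \<le> K / ln t * norm (w - (v - T h v))"
      using norm_Op_P_dens[OF t(1), of "w - (v - T h v)"] by (simp add: K_def)
    moreover have "norm (Op (P_dens t) w) \<le> norm (Op (P_dens t) (w - (v - T h v))) + norm (Op (P_dens t) (v - T h v))"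
      using norm_triangle_ineq[of "Op (P_dens t) (w - (v - T h v))" "Op (P_dens t) (v - T h v)"]
      unfolding linear_add[OF lin, symmetric] by simp
    ultimately have "norm (Op (P_dens t) w) \<le> K / ln t * norm (w - (v - T h v)) + C / t" by linarith
    then have "ln t * norm (Op (P_dens t) w) \<le> ln t * (K / ln t * norm (w - (v - T h v)) + C / t)"
      using t by (intro mult_left_mono) auto
    also have "\<dots> = K * norm (w - (v - T h v)) + C * (ln t / t)"
      using t by (simp add: field_simps)
    also have "K * norm (w - (v - T h v)) < e / 2"
      using mult_strict_left_mono[OF hv K] K by simp
    finally have "ln t * norm (Op (P_dens t) w) < e" using elim(1) by linarith
    then show ?case using t by (simp add: dist_norm)
  qed
qed

lemma cesaro_smallo:
  assumes inj: "inj_on A D" and dense: "closure (A ` D) = UNIV" and x: "x \<in> log_dom cs T"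
  shows "(\<lambda>t. norm (cesaro T t x)) \<in> o[at_top](\<lambda>t. 1 / ln t)"
proof (rule landau_o.smallI)
  fix c :: real assume c: "0 < c"
  obtain w where w: "\<And>t. 0 < t \<Longrightarrow> cesaro T t x = (1 / t) *\<^sub>R (x - T t x) - Op (P_dens t) w"
    using cesaro_decomposition[OF inj x] by blast
  have "((\<lambda>t. (1 + M) * norm x * (ln t / t) + ln t * norm (Op (P_dens t) w)) \<longlongrightarrow> 0 + 0) at_top"
    by (intro tendsto_add ln_over_t_tendsto ln_Op_P_dens_tendsto[OF dense])
  then have "\<forall>\<^sub>F t in at_top. (1 + M) * norm x * (ln t / t) + ln t * norm (Op (P_dens t) w) < c"
    using c by (intro order_tendstoD(2)) auto
  then show "\<forall>\<^sub>F t in at_top. norm (norm (cesaro T t x)) \<le> c * norm (1 / ln t)"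
    using eventually_gt_at_top[of 1]
  proof eventually_elim
    case (elim t)
    then have ln: "0 < ln t" by simp
    have "norm (cesaro T t x) \<le> (1 + M) * norm x / t + norm (Op (P_dens t) w)"
      using w[of t] norm_triangle_ineq4[of "(1 / t) *\<^sub>R (x - T t x)" "Op (P_dens t) w"]
        norm_scaled_diff[of t x] elim by simp
    then have "ln t * norm (cesaro T t x) \<le> ln t * ((1 + M) * norm x / t + norm (Op (P_dens t) w))"
      using ln by (intro mult_left_mono) auto
    also have "\<dots> = (1 + M) * norm x * (ln t / t) + ln t * norm (Op (P_dens t) w)"
      by (simp add: distrib_left)
    finally have "ln t * norm (cesaro T t x) \<le> c" using elim by simp
    then show ?case using ln by (simp add: field_simps)
  qed
qed

section \<open>Spectral inclusion for the calculus\<close>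

definition pencil :: "complex \<Rightarrow> 'a \<Rightarrow> 'a" where "pencil l x = x - cs (1 + l) (J x)"

text \<open>As \<open>(l - A) J = - pencil l\<close>, a bounded inverse of \<open>pencil l\<close> yields the resolvent \<open>- J (pencil l)\<^sup>-\<^sup>1\<close> at \<open>l\<close>.\<close>
lemma not_in_spectrumI:
  assumes S: "bounded_linear S" "\<And>c x. S (cs c x) = cs c (S x)"
    and inv: "\<And>x. S (pencil l x) = x" "\<And>x. pencil l (S x) = x"
  shows "l \<notin> op_spectrum cs D A"
proof -
  define R where "R x = - J (S x)" for x
  have Req: "R x = J (- S x)" for x by (simp add: R_def linear_neg[OF J_linear])
  have AJ: "cs l (J u) - A (J u) = - pencil l u" for u
    by (simp add: A_J pencil_def cs_add_left cs_1)
  have "bounded_linear R"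
    unfolding R_def by (intro bounded_linear_minus bounded_linear_compose[OF Op_bounded_linear[OF dens_exp_dens_1] S(1)])
  moreover have "R (cs c x) = cs c (R x)" for c x
    by (simp add: R_def S(2) Op_cs[OF dens_exp_dens_1] cs_minus)
  moreover have "R x \<in> D" for x unfolding Req by (rule J_in_D)
  moreover have pencil_neg: "pencil l (- u) = - pencil l u" for u
    by (simp add: pencil_def linear_neg[OF J_linear] cs_minus)
  have "cs l (R x) - A (R x) = x" for x
    unfolding Req AJ pencil_neg by (simp add: inv(2))
  moreover have "R (cs l x - A x) = x" if "x \<in> D" for x
  proof -
    have "cs l x - A x = pencil l (- (x + A x))"
      using AJ[of "x + A x"] unfolding J_left_inverse[OF that] pencil_neg .
    then have "R (cs l x - A x) = - J (- (x + A x))" by (simp only: R_def inv(1))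
    also have "\<dots> = x" using J_left_inverse[OF that] by (simp only: linear_neg[OF J_linear] minus_minus)
    finally show ?thesis .
  qed
  ultimately show ?thesis unfolding op_spectrum_def by blast
qed

text \<open>For \<open>Re l < 0\<close> the density \<open>exp_dens (- l)\<close> yields
  \<open>B = (A - l)^-1\<close>. The resolvent identity \<open>B - J = (1 + l) B J\<close> says that
  \<open>1 + (1 + l) B\<close> inverts \<open>1 - (1 + l) J\<close>, the pencil.\<close>

lemma spectrum_right_half_plane:
  assumes "l \<in> op_spectrum cs D A"
  shows "0 \<le> Re l"
proof (rule ccontr)
  assume "\<not> 0 \<le> Re l"
  then have l: "0 < Re (- l)" by simp
  let ?B = "Op (exp_dens (- l))"
  have d: "dens (exp_dens (- l))" by (rule dens_exp_dens[OF l])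
  have BJ: "?B x - J x = cs (1 + l) (?B (J x))" for x
  proof -
    have "Op (\<lambda>s. exp_dens (- l) s - exp_dens 1 s) x = Op (\<lambda>s. (1 + l) * conv (exp_dens (- l)) (exp_dens 1) s) x"
    proof (rule Op_cong_laplace)
      fix n :: nat assume "1 \<le> n"
      let ?z = "of_nat n :: complex"
      have z: "0 \<le> Re ?z" "1 + ?z \<noteq> 0" using one_plus_nonzero[of ?z] by auto
      have "0 < Re (- l + ?z)" using l by simp
      then have nz: "- l + ?z \<noteq> 0" by (metis less_irrefl zero_complex.simps(1))
      have L: "laplace (exp_dens (- l)) ?z = 1 / (- l + ?z)" by (rule laplace_exp_dens) fact
      have "1 / (- l + ?z) - 1 / (1 + ?z) = (1 + l) * (1 / (- l + ?z) * (1 / (1 + ?z)))"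
        using nz z(2) by (simp add: divide_simps)
      then show "laplace (\<lambda>s. exp_dens (- l) s - exp_dens 1 s) ?z = laplace (\<lambda>s. (1 + l) * conv (exp_dens (- l)) (exp_dens 1) s) ?z"
        using z by (simp add: laplace_diff laplace_cmult laplace_conv d dens_exp_dens_1 laplace_exp_dens_1 L)
    qed (intro dens_diff dens_cmult dens_conv d dens_exp_dens_1)+
    then show ?thesis
      by (simp add: Op_diff_dens Op_cmult_dens Op_conv dens_conv d dens_exp_dens_1)
  qed
  define S where "S x = x + cs (1 + l) (?B x)" for x
  have Blin: "linear ?B" by (rule Op_linear[OF d])
  have SV: "S (pencil l x) = x" for x
  proof -
    have "S (pencil l x) = x - cs (1 + l) (J x) + cs (1 + l) (?B x - cs (1 + l) (?B (J x)))"
      by (simp add: S_def pencil_def linear_diff[OF Blin] Op_cs[OF d])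
    then show ?thesis unfolding BJ[symmetric] by simp
  qed
  have VS: "pencil l (S x) = x" for x
  proof -
    have "pencil l (S x) = x + cs (1 + l) (?B x) - cs (1 + l) (J x + cs (1 + l) (?B (J x)))"
      by (simp add: S_def pencil_def linear_add[OF J_linear] Op_cs[OF dens_exp_dens_1] Op_commute[OF dens_exp_dens_1 d])
    then show ?thesis unfolding BJ[symmetric] by simp
  qed
  have "l \<notin> op_spectrum cs D A"
  proof (rule not_in_spectrumI[OF _ _ SV VS])
    show "bounded_linear S"
      unfolding S_def
      by (intro bounded_linear_add bounded_linear_ident bounded_linear_compose[OF cs_bounded_linear Op_bounded_linear[OF d]])
    show "S (cs c x) = cs c (S x)" for c x
      by (simp add: S_def cs_add Op_cs[OF d] cs_mult[symmetric] mult.commute)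
  qed
  then show False using assms by simp
qed

text \<open>Put \<open>c = k^(l)\<close> and suppose \<open>|c| > B\<close>. The pencil has symbol
  \<open>(z - l) / (1 + z)\<close>, so \<open>c - k^(z) = (z - l) q^(z)\<close> factors
  \<open>c - k(A)\<close> as the pencil times an operator \<open>Q\<close>. A Neumann series inverts
  \<open>c - k(A)\<close>, hence the pencil is invertible and \<open>l\<close> is not in the
  spectrum.\<close>

lemma spectral_bound_moment:
  assumes l: "l \<in> op_spectrum cs D A"
    and k: "dens k" and mom: "integrable lborel (\<lambda>s. of_real s * k s)"
    and B0: "0 \<le> B" and B: "\<And>x. norm (Op k x) \<le> B * norm x"
  shows "cmod (laplace k l) \<le> B"
proof (rule ccontr)
  assume "\<not> cmod (laplace k l) \<le> B"
  then have BL: "B < cmod (laplace k l)" by simp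
  define c where "c = laplace k l"
  have Re: "0 \<le> Re l" by (rule spectrum_right_half_plane[OF l])
  have c: "B < cmod c" using BL by (simp add: c_def)
  then have c0: "c \<noteq> 0" using B0 by auto
  obtain q where q: "dens q" and qL: "\<And>n. 1 \<le> n \<Longrightarrow> (of_nat n - l) * laplace q (of_nat n) = c - laplace k (of_nat n)"
    using divided_difference_density[OF k mom Re] unfolding c_def by blast
  \<comment> \<open>This is the factorisation divided by \<open>1 + z\<close>: after the division
    the constant \<open>c\<close> also belongs to a density.\<close>
  have JK: "J (Op k x) = cs c (J x) - Op q x + cs (1 + l) (J (Op q x))" for x
  proof -
    have "Op (conv (exp_dens 1) k) x = Op (\<lambda>s. (c * exp_dens 1 s - q s) + (1 + l) * conv (exp_dens 1) q s) x"
    proof (rule Op_cong_laplace)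
      fix n :: nat assume n: "1 \<le> n"
      let ?z = "of_nat n :: complex"
      have z: "0 \<le> Re ?z" "1 + ?z \<noteq> 0" using one_plus_nonzero[of ?z] by auto
      have "laplace k ?z = c - (?z - l) * laplace q ?z" using qL[OF n] by simp
      moreover have "1 / w * (c - (w - 1 - l) * u) = c * (1 / w) - u + (1 + l) * (1 / w * u)"
        if "w \<noteq> 0" for w u :: complex
        using that by (simp add: field_simps)
      from this[OF z(2), of "laplace q ?z"]
      have "1 / (1 + ?z) * (c - (?z - l) * laplace q ?z) = c * (1 / (1 + ?z)) - laplace q ?z + (1 + l) * (1 / (1 + ?z) * laplace q ?z)"
        by simp
      ultimately have "1 / (1 + ?z) * laplace k ?z = c * (1 / (1 + ?z)) - laplace q ?z + (1 + l) * (1 / (1 + ?z) * laplace q ?z)"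
        by (simp only:)
      then show "laplace (conv (exp_dens 1) k) ?z = laplace (\<lambda>s. (c * exp_dens 1 s - q s) + (1 + l) * conv (exp_dens 1) q s) ?z"
        using z by (simp add: laplace_add laplace_diff laplace_cmult laplace_conv dens_add dens_diff dens_cmult dens_conv
            dens_exp_dens_1 k q laplace_exp_dens_1)
    qed (intro dens_add dens_diff dens_cmult dens_conv dens_exp_dens_1 k q)+
    then show ?thesis
      by (simp add: Op_add_dens Op_diff_dens Op_cmult_dens Op_conv dens_diff dens_cmult dens_conv
          dens_exp_dens_1 k q)
  qed
  \<comment> \<open>\<open>Q\<close> has symbol \<open>(1 + z) q^(z)\<close>, which
    \<open>(z - l) q^(z) = c - k^(z)\<close> rewrites as \<open>(1 + l) q^(z) + c - k^(z)\<close>,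
    free of the unbounded factor.\<close>
  define Q where "Q x = cs (1 + l) (Op q x) + cs c x - Op k x" for x
  have pencil_cs: "pencil l (cs d x) = cs d (pencil l x)" for d x
    by (simp add: pencil_def Op_cs[OF dens_exp_dens_1] cs_diff cs_mult[symmetric] mult.commute)
  have VQ: "pencil l (Q x) = cs c x - Op k x" for x
  proof -
    have "J (Q x) = cs (1 + l) (J (Op q x)) + cs c (J x) - J (Op k x)"
      by (simp add: Q_def linear_add[OF J_linear] linear_diff[OF J_linear] Op_cs[OF dens_exp_dens_1])
    then have "J (Q x) = Op q x" unfolding JK by simp
    then show ?thesis by (simp add: pencil_def Q_def)
  qed
  have Q_diff: "Q (x - y) = Q x - Q y" for x y
    by (simp add: Q_def linear_diff[OF Op_linear] q k cs_diff)
  have Q_cs: "Q (cs d x) = cs d (Q x)" for d x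
    by (simp add: Q_def Op_cs q k cs_diff cs_add cs_mult[symmetric] mult.commute)
  have Q_J: "Q (J x) = J (Q x)" for x
    by (simp add: Q_def linear_add[OF J_linear] linear_diff[OF J_linear] Op_cs dens_exp_dens_1
        Op_commute[OF q dens_exp_dens_1] Op_commute[OF k dens_exp_dens_1])
  have QV: "Q (pencil l x) = pencil l (Q x)" for x
    by (simp add: pencil_def Q_diff Q_cs Q_J)
  define K where "K x = cs (1 / c) (Op k x)" for x
  obtain S0 where S0: "bounded_linear S0" "\<And>x. S0 (x - K x) = x" "\<And>x. S0 x - K (S0 x) = x"
  proof (rule neumann_inverse[of K "B / cmod c"])
    show "bounded_linear K"
      unfolding K_def by (rule bounded_linear_compose[OF cs_bounded_linear Op_bounded_linear[OF k]])
    show "norm (K x) \<le> B / cmod c * norm x" for x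
      using B[of x] c0 by (simp add: K_def norm_cs norm_divide divide_right_mono)
  qed (use B0 c c0 in auto)
  have inv: "cs c x - Op k x = cs c (x - K x)" for x
    using c0 by (simp add: K_def cs_diff cs_mult[symmetric] cs_1)
  define S where "S x = Q (S0 (cs (1 / c) x))" for x
  have VS: "pencil l (S x) = x" for x
    using c0 by (simp add: S_def VQ inv S0(3) cs_mult[symmetric] cs_1)
  \<comment> \<open>\<open>Q\<close> commutes with the pencil, so their product is the injective
    \<open>c - k(A)\<close> in either order. Injectivity then yields both the left inverse and the
    complex linearity of \<open>S\<close>.\<close>
  have pencil_inj: "x = y" if "pencil l x = pencil l y" for x y
  proof -
    have "cs c (x - K x) = cs c (y - K y)"
    proof -
      have "cs c (v - K v) = Q (pencil l v)" for v by (simp only: QV VQ inv)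
      then show ?thesis by (simp only: that)
    qed
    then have "cs (1 / c) (cs c (x - K x)) = cs (1 / c) (cs c (y - K y))" by simp
    then have "x - K x = y - K y" using c0 by (simp add: cs_mult[symmetric] cs_1)
    then show ?thesis using S0(2)[of x] S0(2)[of y] by metis
  qed
  have "l \<notin> op_spectrum cs D A"
  proof (rule not_in_spectrumI[OF _ _ _ VS])
    show "bounded_linear S"
      unfolding S_def Q_def
      by (intro bounded_linear_sub bounded_linear_add
          bounded_linear_compose[OF cs_bounded_linear] bounded_linear_compose[OF Op_bounded_linear[OF q]]
          bounded_linear_compose[OF Op_bounded_linear[OF k]] bounded_linear_compose[OF S0(1)] cs_bounded_linear)
    show "S (cs d x) = cs d (S x)" for d x by (rule pencil_inj) (simp add: VS pencil_cs)
    show "S (pencil l x) = x" for x by (rule pencil_inj) (simp add: VS)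
  qed
  then show False using l by simp
qed

text \<open>Cutting \<open>k\<close> off at \<open>b\<close> gives a finite first moment. The tail
  enters the operator norm with factor \<open>M\<close> and the transform with factor 1, whence
  \<open>M + 1\<close>; it vanishes as \<open>b\<close> grows.\<close>

lemma spectral_bound:
  assumes l: "l \<in> op_spectrum cs D A" and k: "dens k" and B0: "0 \<le> B"
    and B: "\<And>x. norm (Op k x) \<le> B * norm x"
  shows "cmod (laplace k l) \<le> B"
proof -
  have Re: "0 \<le> Re l" by (rule spectrum_right_half_plane[OF l])
  let ?k = "\<lambda>b s. if s \<le> b then k s else 0"
  have [measurable]: "k \<in> borel_measurable borel" by (rule dens_measurable[OF k])
  have dk: "dens (?k b)" for b
    unfolding dens_def using densD(2)[OF k]
    by (auto intro: Bochner_Integration.integrable_bound[OF densD(1)[OF k]])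
  have mom: "integrable lborel (\<lambda>s. of_real s * ?k b s)" for b
  proof (rule integrable_mult_bounded[OF densD(1)[OF dk], where C = "\<bar>b\<bar>"])
    show "AE s in lborel. ?k b s \<noteq> 0 \<longrightarrow> cmod (of_real s) \<le> \<bar>b\<bar>"
    proof (intro AE_I2 impI)
      fix s assume "?k b s \<noteq> 0"
      then have "s \<le> b" "0 \<le> s" using densD(2)[OF k, of s] by (auto split: if_splits simp: not_less[symmetric])
      then show "cmod (of_real s) \<le> \<bar>b\<bar>" by simp
    qed
  qed simp
  have "cmod (laplace k l) \<le> B + (M + 1) * l1 (\<lambda>s. k s - ?k b s)" for b
  proof -
    let ?d = "\<lambda>s. k s - ?k b s"
    have dd: "dens ?d" by (rule dens_diff[OF k dk])
    have "norm (Op (?k b) x) \<le> (B + M * l1 ?d) * norm x" for x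
    proof -
      have "Op (?k b) x = Op k x - Op ?d x" by (simp add: Op_diff_dens[OF k dk])
      then show ?thesis
        using norm_triangle_ineq4[of "Op k x" "Op ?d x"] B[of x] Op_norm[OF dd, of x]
        by (simp add: distrib_right)
    qed
    then have "cmod (laplace (?k b) l) \<le> B + M * l1 ?d"
      by (rule spectral_bound_moment[OF l dk mom, rotated]) (use B0 M_ge_1 in \<open>simp add: l1_def\<close>)
    moreover have "cmod (laplace ?d l) \<le> 1 * l1 ?d"
      unfolding laplace_def by (rule dens_bounded_integrable(2)[OF dd]) (use cmod_exp_le_1[OF Re] in auto)
    moreover have "laplace k l = laplace (?k b) l + laplace ?d l" by (simp only: laplace_diff[OF k dk Re]) simp
    then have "cmod (laplace k l) \<le> cmod (laplace (?k b) l) + cmod (laplace ?d l)" by (simp only: norm_triangle_ineq)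
    ultimately show ?thesis by (simp add: distrib_right)
  qed
  moreover have "((\<lambda>b. B + (M + 1) * l1 (\<lambda>s. k s - ?k b s)) \<longlongrightarrow> B + (M + 1) * 0) at_top"
    by (intro tendsto_intros l1_tail k)
  ultimately have "cmod (laplace k l) \<le> B + (M + 1) * 0"
    by (intro tendsto_lowerbound[OF _ _ trivial_limit_at_top_linorder]) auto
  then show ?thesis by simp
qed

section \<open>Optimality of the rate\<close>

lemma Op_P_dens_1_in_log_dom: "Op (P_dens 1) w \<in> log_dom cs T"
proof (rule log_domI)
  have "Op elog_dens (Op (P_dens 1) w) = Op (P_dens 1) (Op elog_dens w)"
    by (rule Op_commute[OF dens_elog_dens dens_P_dens]) simp
  also have "\<dots> = eA T ((1 / 1) *\<^sub>R (w - T 1 w) - cesaro T 1 w)"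
    unfolding eA_eq by (rule Op_main) simp
  finally show "Op elog_dens (Op (P_dens 1) w) \<in> range (eA T)" by simp
qed

lemma cesaro_rate_optimal:
  fixes \<epsilon> :: "real \<Rightarrow> real"
  assumes lim: "0 islimpt op_spectrum cs D A"
    and pos: "\<And>t. 0 < t \<Longrightarrow> 0 < \<epsilon> t" and tend: "(\<epsilon> \<longlongrightarrow> 0) at_top"
  shows "\<exists>y\<in>log_dom cs T. \<not> bdd_above ((\<lambda>t. ln t * norm (cesaro T t y) / \<epsilon> t) ` {1..})"
proof (rule ccontr)
  assume neg: "\<not> ?thesis"
  have bdd: "bdd_above ((\<lambda>t. ln t * norm (cesaro T t y) / \<epsilon> t) ` {1..})" if "y \<in> log_dom cs T" for y
  proof (rule ccontr)
    assume "\<not> bdd_above ((\<lambda>t. ln t * norm (cesaro T t y) / \<epsilon> t) ` {1..})"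
    then have "\<exists>y\<in>log_dom cs T. \<not> bdd_above ((\<lambda>t. ln t * norm (cesaro T t y) / \<epsilon> t) ` {1..})"
      using that by (intro bexI[of _ y])
    with neg show False by (rule notE)
  qed
  \<comment> \<open>The range of \<open>P_1(A)\<close> lies in the domain of the logarithm, so the
    assumed bounds make this family pointwise bounded on the whole space, where the uniform
    boundedness principle applies.\<close>
  define B where "B t w = (ln t / \<epsilon> t) *\<^sub>R Op (conv (c_dens t) (P_dens 1)) w" for t w
  have dk: "dens (conv (c_dens t) (P_dens 1))" for t by (intro dens_conv dens_c_dens dens_P_dens) simp
  have B_lin: "bounded_linear (B t)" for t
    unfolding B_def by (rule bounded_linear_scaleR_right[THEN bounded_linear_compose, OF Op_bounded_linear[OF dk]])
  have B_pw: "\<exists>K. \<forall>t\<in>{1..}. norm (B t w) \<le> K" for w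
    proof -
      obtain K where K: "\<And>t. 1 \<le> t \<Longrightarrow> ln t * norm (cesaro T t (Op (P_dens 1) w)) / \<epsilon> t \<le> K"
        using bdd[OF Op_P_dens_1_in_log_dom[of w]] by (auto simp: bdd_above_def)
      have "norm (B t w) \<le> K" if "1 \<le> t" for t
        using K[OF that] that pos[of t] by (simp add: B_def Op_conv dens_c_dens dens_P_dens cesaro_eq)
      then show ?thesis by auto
    qed
  obtain K where K: "0 \<le> K" "\<And>t w. t \<in> {1..} \<Longrightarrow> norm (B t w) \<le> K * norm w"
    using uniform_boundedness[of "{1..}" B, OF B_lin B_pw] by blast
  have "((\<lambda>t. 64 * K * \<epsilon> t) \<longlongrightarrow> 64 * K * 0) at_top" by (intro tendsto_intros tend)
  then have "\<forall>\<^sub>F t in at_top. 64 * K * \<epsilon> t < 1" by (intro order_tendstoD(2)) auto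
  then obtain N where N: "\<And>t. N \<le> t \<Longrightarrow> 64 * K * \<epsilon> t < 1"
    by (auto simp: eventually_at_top_linorder)
  \<comment> \<open>Beyond \<open>N\<close> the function is too small for the final inequality;
    \<open>exp 1\<close> is the threshold of the lower bound for the product.\<close>
  define t0 where "t0 = max N (exp 1)"
  have t0: "N \<le> t0" "exp 1 \<le> t0" "1 \<le> t0"
    using one_le_exp_iff[of "1::real"] by (auto simp: t0_def le_max_iff_disj)
  \<comment> \<open>A spectral point closer to 0 than \<open>1 / (4 * t0)\<close> makes the
    associated time \<open>t = 1 / (4 |l|)\<close> exceed \<open>t0\<close>. The accumulation at 0
    provides such a nonzero point.\<close>
  have "0 < 1 / (4 * t0)" using t0 by simp
  then obtain l where l: "l \<in> op_spectrum cs D A" "l \<noteq> 0" "dist l 0 < 1 / (4 * t0)"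
    using lim unfolding islimpt_approachable by blast
  define t where "t = 1 / (4 * cmod l)"
  have cl: "0 < cmod l" "cmod l < 1 / (4 * t0)" using l by (auto simp: dist_norm)
  have "t0 < t" using cl t0 by (simp add: t_def field_simps)
  then have t: "N \<le> t" "exp 1 \<le> t" "1 < t" using t0 by auto
  have "1 / (4 * t0) \<le> 1 / 4" using t0 by simp
  then have "cmod l \<le> 1 / 4" using cl by simp
  then have "1 / (64 * ln t) \<le> cmod (laplace (conv (c_dens t) (P_dens 1)) l)"
    using l t_def t by (intro laplace_product_lower_bound spectrum_right_half_plane) auto
  also have "\<dots> \<le> K * \<epsilon> t / ln t"
  proof (rule spectral_bound[OF l(1) dk])
    show "0 \<le> K * \<epsilon> t / ln t" using K(1) t pos[of t] by simp
    fix w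
    have "ln t / \<epsilon> t * norm (Op (conv (c_dens t) (P_dens 1)) w) \<le> K * norm w"
      using K(2)[of t w] t pos[of t] by (simp add: B_def)
    then show "norm (Op (conv (c_dens t) (P_dens 1)) w) \<le> K * \<epsilon> t / ln t * norm w"
      using t pos[of t] by (simp add: field_simps)
  qed
  \<comment> \<open>The factor \<open>ln t\<close> cancels between the two bounds, leaving a
    positive lower bound for a quantity that tends to 0.\<close>
  finally have "1 \<le> 64 * K * \<epsilon> t" using t by (simp add: field_simps)
  then show False using N[OF t(1)] by simp
qed

end

theorem theorem5p3:
  fixes cs :: "complex \<Rightarrow> 'a::banach \<Rightarrow> 'a"
    and T :: "real \<Rightarrow> 'a \<Rightarrow> 'a"
    and D :: "'a set" and A :: "'a \<Rightarrow> 'a"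
  assumes "complex_scaling cs"
    and "bounded_C0_semigroup cs T"
    and "neg_generator T D A"
    and "inj_on A D"
  shows "(\<forall>x\<in>log_dom cs T. (\<lambda>t. norm (cesaro T t x)) \<in> O[at_top](\<lambda>t. 1 / ln t)) \<and>
         (closure (A ` D) = UNIV \<longrightarrow>
           (\<forall>x\<in>log_dom cs T. (\<lambda>t. norm (cesaro T t x)) \<in> o[at_top](\<lambda>t. 1 / ln t))) \<and>
         (0 islimpt op_spectrum cs D A \<longrightarrow>
           (\<forall>\<epsilon>::real \<Rightarrow> real.
              (\<forall>s t. 0 < s \<longrightarrow> s \<le> t \<longrightarrow> \<epsilon> t \<le> \<epsilon> s) \<longrightarrow>
              (\<forall>t>0. 0 < \<epsilon> t) \<longrightarrow> (\<epsilon> \<longlongrightarrow> 0) at_top \<longrightarrow>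
              (\<exists>y\<in>log_dom cs T.
                 \<not> bdd_above ((\<lambda>t. ln t * norm (cesaro T t y) / \<epsilon> t) ` {1..}))))"
proof -
  obtain M where M: "\<And>s x. 0 \<le> s \<Longrightarrow> norm (T s x) \<le> M * norm x"
    using assms(2) unfolding bounded_C0_semigroup_def by blast
  \<comment> \<open>The constant from the boundedness assumption may be below 1, for instance on the
    zero space, so it is enlarged to meet \<open>1 <= M\<close>.\<close>
  interpret C0_generator cs T "max 1 M" D A
  proof
    show "norm (T s x) \<le> max 1 M * norm x" if "0 \<le> s" for s x
      using M[OF that, of x] by (rule order.trans) (intro mult_right_mono, auto)
  qed (use assms in auto)
  show ?thesis
    using cesaro_bigo[OF assms(4)] cesaro_smallo[OF assms(4)] cesaro_rate_optimal by blast
qed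

end
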